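(* Let $\mathcal{E}$ be a connected locally connected topos and let $\mathcal{A}$ be the full subcategory of $\mathcal{E}$ whose objects are the Galois objects. Then $\mathcal{A}$ becomes an (inversely) 2-filtered 2-category by adding, for any two parallel morphisms $u, v : A \to B$ between Galois objects, a formal 2-cell $\theta_{vu} : u \Rightarrow v$, these 2-cells satisfying the following equations: $$\theta_{uu} = id, \qquad \theta_{wv}\circ\theta_{vu} = \theta_{wu} \quad (\text{thus } \theta_{uv} = \theta_{vu}^{-1}), \qquad \theta_{vu}\,\theta_{sr} = \theta_{sv\; ru},$$ where $u,v,w : A \to B$ and $r,s : B \to C$ are morphisms between Galois objects, $\circ$ is vertical composition, and $\theta_{vu}\,\theta_{sr}$ denotes the horizontal composite $ru \Rightarrow sv$ of $\theta_{vu} : u \Rightarrow v$ and $\theta_{sr} : r \Rightarrow s$.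
   Context: All topoi are Grothendieck topoi over the topos $\mathcal{S}$ of sets, with structure morphism $\gamma : \mathcal{E} \to \mathcal{S}$ (inverse image $\gamma^*$). $Aut(A)$ denotes the set of automorphisms of $A$. Connected objects are by convention not initial. A Galois object in a topos $\gamma:\mathcal{E}\to\mathcal{S}$ is an object $A$ such that: (i) the canonical map $A \times \gamma^* Aut(A) \to A \times A$, $(a,h)\mapsto (a,h(a))$, is an isomorphism; and (ii) $A$ is connected and $A \to 1$ is an epimorphism. In the resulting 2-category there is exactly one 2-cell $\theta_{vu}: u \Rightarrow v$ between any ordered pair of parallel morphisms. Inversely 2-filtered (the dual, reversing 1-cells, of the notion of 2-filtered 2-category of Dubuc and Street): a 2-category $\mathcal{A}$ is inversely 2-filtered if it is non-empty and: (F0) Given objects $A, B$ there exist an object $C$ and morphisms $C \to A$, $C \to B$. (F1) Given morphisms $f : A \to E$, $g : B \to E$ there exist an object $C$, morphisms $u : C \to A$, $v : C \to B$ and an invertible 2-cell $\gamma : fu \Rightarrow gv$. (F2) Given $f : A \to E$, $g : B \to E$, morphisms $u_i : C_i \to A$, $v_i : C_i \to B$ and 2-cells $\gamma_i : f u_i \Rightarrow g v_i$ ($i=1,2$), there exist an object $C$, morphisms $w_i : C \to C_i$ ($i=1,2$) and invertible 2-cells $\alpha : u_1 w_1 \Rightarrow u_2 w_2$, $\beta : v_1 w_1 \Rightarrow v_2 w_2$ such that $(g\beta)\circ(\gamma_1 w_1) = (\gamma_2 w_2)\circ(f\alpha)$. *)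

theory Defs
  imports "HOL-Library.Equipollence"
begin

section \<open>Categories and functors\<close>

record ('o, 'a) category =
  Obj :: "'o set"
  Arr :: "'a set"
  Dom :: "'a \<Rightarrow> 'o"
  Cod :: "'a \<Rightarrow> 'o"
  Id :: "'o \<Rightarrow> 'a"
  Comp :: "'a \<Rightarrow> 'a \<Rightarrow> 'a" (infixr "\<cdot>\<index>" 70)

definition hom :: "('o, 'a, 'z) category_scheme \<Rightarrow> 'o \<Rightarrow> 'o \<Rightarrow> 'a set" where
  "hom C A B = {f \<in> Arr C. Dom C f = A \<and> Cod C f = B}"

locale category =
  fixes C :: "('o, 'a, 'z) category_scheme" (structure)
  assumes Dom_in_Obj: "f \<in> Arr C \<Longrightarrow> Dom C f \<in> Obj C"
    and Cod_in_Obj: "f \<in> Arr C \<Longrightarrow> Cod C f \<in> Obj C"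
    and Id_in_hom: "A \<in> Obj C \<Longrightarrow> Id C A \<in> hom C A A"
    and Comp_in_hom: "\<lbrakk>f \<in> hom C A B; g \<in> hom C B D\<rbrakk> \<Longrightarrow> g \<cdot> f \<in> hom C A D"
    and Comp_Id: "f \<in> Arr C \<Longrightarrow> f \<cdot> Id C (Dom C f) = f"
    and Id_Comp: "f \<in> Arr C \<Longrightarrow> Id C (Cod C f) \<cdot> f = f"
    and Comp_assoc: "\<lbrakk>f \<in> Arr C; g \<in> Arr C; h \<in> Arr C; Dom C g = Cod C f; Dom C h = Cod C g\<rbrakk>
      \<Longrightarrow> (h \<cdot> g) \<cdot> f = h \<cdot> (g \<cdot> f)"

definition iso :: "('o, 'a, 'z) category_scheme \<Rightarrow> 'a \<Rightarrow> bool" where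
  "iso C f \<longleftrightarrow> f \<in> Arr C \<and>
    (\<exists>g \<in> hom C (Cod C f) (Dom C f).
      g \<cdot>\<^bsub>C\<^esub> f = Id C (Dom C f) \<and> f \<cdot>\<^bsub>C\<^esub> g = Id C (Cod C f))"

definition epi :: "('o, 'a, 'z) category_scheme \<Rightarrow> 'a \<Rightarrow> bool" where
  "epi C f \<longleftrightarrow> f \<in> Arr C \<and>
    (\<forall>g \<in> Arr C. \<forall>h \<in> Arr C. Dom C g = Cod C f \<and> Dom C h = Cod C f \<and> Cod C g = Cod C h \<and>
      g \<cdot>\<^bsub>C\<^esub> f = h \<cdot>\<^bsub>C\<^esub> f \<longrightarrow> g = h)"

definition op_category :: "('o, 'a) category \<Rightarrow> ('o, 'a) category" where
  "op_category C =
    \<lparr>Obj = Obj C, Arr = Arr C, Dom = Cod C, Cod = Dom C, Id = Id C, Comp = (\<lambda>f g. g \<cdot>\<^bsub>C\<^esub> f)\<rparr>"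

definition full_subcategory :: "('o, 'a) category \<Rightarrow> ('o \<Rightarrow> bool) \<Rightarrow> ('o, 'a) category" where
  "full_subcategory C P =
    \<lparr>Obj = {A \<in> Obj C. P A}, Arr = {f \<in> Arr C. P (Dom C f) \<and> P (Cod C f)},
     Dom = Dom C, Cod = Cod C, Id = Id C, Comp = Comp C\<rparr>"

record ('o, 'a, 'p, 'b) cfunctor =
  OMap :: "'o \<Rightarrow> 'p"
  AMap :: "'a \<Rightarrow> 'b"

locale cfunctor = C: category C + D: category D
  for C :: "('o, 'a) category" and D :: "('p, 'b) category"
    and F :: "('o, 'a, 'p, 'b) cfunctor" +
  assumes OMap_in_Obj: "A \<in> Obj C \<Longrightarrow> OMap F A \<in> Obj D"
    and AMap_in_hom: "f \<in> hom C A B \<Longrightarrow> AMap F f \<in> hom D (OMap F A) (OMap F B)"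
    and AMap_Id: "A \<in> Obj C \<Longrightarrow> AMap F (Id C A) = Id D (OMap F A)"
    and AMap_Comp: "\<lbrakk>f \<in> hom C A B; g \<in> hom C B E\<rbrakk>
      \<Longrightarrow> AMap F (g \<cdot>\<^bsub>C\<^esub> f) = AMap F g \<cdot>\<^bsub>D\<^esub> AMap F f"

definition id_functor :: "('o, 'a, 'o, 'a) cfunctor" where
  "id_functor = \<lparr>OMap = (\<lambda>A. A), AMap = (\<lambda>f. f)\<rparr>"

definition comp_functor ::
  "('p, 'b, 'q, 'c) cfunctor \<Rightarrow> ('o, 'a, 'p, 'b) cfunctor \<Rightarrow> ('o, 'a, 'q, 'c) cfunctor"
  (infixr "\<circ>\<^sub>F" 55) where
  "G \<circ>\<^sub>F F = \<lparr>OMap = OMap G \<circ> OMap F, AMap = AMap G \<circ> AMap F\<rparr>"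

definition nat_trans :: "('o, 'a) category \<Rightarrow> ('p, 'b) category \<Rightarrow>
  ('o, 'a, 'p, 'b) cfunctor \<Rightarrow> ('o, 'a, 'p, 'b) cfunctor \<Rightarrow> ('o \<Rightarrow> 'b) \<Rightarrow> bool" where
  "nat_trans C D F G \<alpha> \<longleftrightarrow> cfunctor C D F \<and> cfunctor C D G \<and>
    (\<forall>A \<in> Obj C. \<alpha> A \<in> hom D (OMap F A) (OMap G A)) \<and>
    (\<forall>f \<in> Arr C. AMap G f \<cdot>\<^bsub>D\<^esub> \<alpha> (Dom C f) = \<alpha> (Cod C f) \<cdot>\<^bsub>D\<^esub> AMap F f)"

definition equivalent_categories :: "('o, 'a) category \<Rightarrow> ('p, 'b) category \<Rightarrow> bool" where
  "equivalent_categories C D \<longleftrightarrow>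
    (\<exists>F G \<eta> \<epsilon>. cfunctor C D F \<and> cfunctor D C G \<and>
      nat_trans C C id_functor (G \<circ>\<^sub>F F) \<eta> \<and> (\<forall>A \<in> Obj C. iso C (\<eta> A)) \<and>
      nat_trans D D (F \<circ>\<^sub>F G) id_functor \<epsilon> \<and> (\<forall>B \<in> Obj D. iso D (\<epsilon> B)))"

text \<open>\<^term>\<open>L\<close> is left adjoint to \<^term>\<open>R\<close>: unit, counit and the two triangle identities.\<close>
definition adjoint_functors :: "('o, 'a) category \<Rightarrow> ('p, 'b) category \<Rightarrow>
  ('o, 'a, 'p, 'b) cfunctor \<Rightarrow> ('p, 'b, 'o, 'a) cfunctor \<Rightarrow> bool" where
  "adjoint_functors C D L R \<longleftrightarrow> cfunctor C D L \<and> cfunctor D C R \<and>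
    (\<exists>\<eta> \<epsilon>. nat_trans C C id_functor (R \<circ>\<^sub>F L) \<eta> \<and> nat_trans D D (L \<circ>\<^sub>F R) id_functor \<epsilon> \<and>
      (\<forall>A \<in> Obj C. \<epsilon> (OMap L A) \<cdot>\<^bsub>D\<^esub> AMap L (\<eta> A) = Id D (OMap L A)) \<and>
      (\<forall>B \<in> Obj D. AMap R (\<epsilon> B) \<cdot>\<^bsub>C\<^esub> \<eta> (OMap R B) = Id C (OMap R B)))"

definition fully_faithful ::
  "('o, 'a) category \<Rightarrow> ('p, 'b) category \<Rightarrow> ('o, 'a, 'p, 'b) cfunctor \<Rightarrow> bool" where
  "fully_faithful C D F \<longleftrightarrow> cfunctor C D F \<and>
    (\<forall>A \<in> Obj C. \<forall>B \<in> Obj C. bij_betw (AMap F) (hom C A B) (hom D (OMap F A) (OMap F B)))"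


section \<open>Limits and coproducts\<close>

definition terminal :: "('o, 'a) category \<Rightarrow> 'o \<Rightarrow> bool" where
  "terminal C T \<longleftrightarrow> T \<in> Obj C \<and> (\<forall>A \<in> Obj C. \<exists>!f. f \<in> hom C A T)"

definition initial :: "('o, 'a) category \<Rightarrow> 'o \<Rightarrow> bool" where
  "initial C I \<longleftrightarrow> I \<in> Obj C \<and> (\<forall>A \<in> Obj C. \<exists>!f. f \<in> hom C I A)"

definition is_product ::
  "('o, 'a) category \<Rightarrow> 'o \<Rightarrow> 'o \<Rightarrow> 'o \<Rightarrow> 'a \<Rightarrow> 'a \<Rightarrow> bool" where
  "is_product C A B P p q \<longleftrightarrow> p \<in> hom C P A \<and> q \<in> hom C P B \<and>
    (\<forall>X \<in> Obj C. \<forall>f \<in> hom C X A. \<forall>g \<in> hom C X B.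
      \<exists>!m. m \<in> hom C X P \<and> p \<cdot>\<^bsub>C\<^esub> m = f \<and> q \<cdot>\<^bsub>C\<^esub> m = g)"

definition is_coproduct ::
  "('o, 'a) category \<Rightarrow> 'o \<Rightarrow> 'o \<Rightarrow> 'o \<Rightarrow> 'a \<Rightarrow> 'a \<Rightarrow> bool" where
  "is_coproduct C A B S i j \<longleftrightarrow> i \<in> hom C A S \<and> j \<in> hom C B S \<and>
    (\<forall>X \<in> Obj C. \<forall>f \<in> hom C A X. \<forall>g \<in> hom C B X.
      \<exists>!m. m \<in> hom C S X \<and> m \<cdot>\<^bsub>C\<^esub> i = f \<and> m \<cdot>\<^bsub>C\<^esub> j = g)"

definition is_cone :: "('i, 'j) category \<Rightarrow> ('o, 'a) category \<Rightarrow> ('i, 'j, 'o, 'a) cfunctor \<Rightarrow>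
  'o \<Rightarrow> ('i \<Rightarrow> 'a) \<Rightarrow> bool" where
  "is_cone J C D L p \<longleftrightarrow> L \<in> Obj C \<and> (\<forall>i \<in> Obj J. p i \<in> hom C L (OMap D i)) \<and>
    (\<forall>k \<in> Arr J. AMap D k \<cdot>\<^bsub>C\<^esub> p (Dom J k) = p (Cod J k))"

definition is_limit :: "('i, 'j) category \<Rightarrow> ('o, 'a) category \<Rightarrow> ('i, 'j, 'o, 'a) cfunctor \<Rightarrow>
  'o \<Rightarrow> ('i \<Rightarrow> 'a) \<Rightarrow> bool" where
  "is_limit J C D L p \<longleftrightarrow> is_cone J C D L p \<and>
    (\<forall>M q. is_cone J C D M q \<longrightarrow>
      (\<exists>!m. m \<in> hom C M L \<and> (\<forall>i \<in> Obj J. p i \<cdot>\<^bsub>C\<^esub> m = q i)))"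

text \<open>Preservation of finite limits. Every finite category is isomorphic to one whose objects and
  arrows are natural numbers, so these suffice as diagram shapes.\<close>
definition left_exact ::
  "('o, 'a) category \<Rightarrow> ('p, 'b) category \<Rightarrow> ('o, 'a, 'p, 'b) cfunctor \<Rightarrow> bool" where
  "left_exact C D F \<longleftrightarrow> cfunctor C D F \<and>
    (\<forall>(J :: (nat, nat) category) K L p. finite (Obj J) \<and> finite (Arr J) \<and> cfunctor J C K \<and>
      is_limit J C K L p \<longrightarrow> is_limit J D (F \<circ>\<^sub>F K) (OMap F L) (\<lambda>i. AMap F (p i)))"


section \<open>Sets\<close>

text \<open>The sets of the mathematical text are the subsets of a fixed type \<^typ>\<open>'u\<close> that are
  strictly smaller than the type. When the cardinality of \<^typ>\<open>'u\<close> is an uncountable strongly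
  inaccessible cardinal, which is what the second definition says, these are, up to bijection, the
  elements of a Grothendieck universe. HOL does not prove that such a type exists, so this is
  a hypothesis wherever it is needed.\<close>

definition small :: "'u set \<Rightarrow> bool" where
  "small X \<longleftrightarrow> X \<prec> (UNIV :: 'u set)"

definition grothendieck_universe :: "'u itself \<Rightarrow> bool" where
  "grothendieck_universe (_ :: 'u itself) \<longleftrightarrow>
    (\<exists>X :: 'u set. small X \<and> infinite X) \<and>
    (\<forall>X :: 'u set. small X \<longrightarrow> Pow X \<prec> (UNIV :: 'u set)) \<and>
    (\<forall>(I :: 'u set) (X :: 'u \<Rightarrow> 'u set).
      small I \<and> (\<forall>i \<in> I. small (X i)) \<longrightarrow> small (\<Union>i \<in> I. X i))"

datatype ('x, 'f) arrow = Arrow (source: 'x) (rule: 'f) (target: 'x)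

type_synonym 'u map = "('u set, 'u \<Rightarrow> 'u) arrow"

definition Sets :: "('u set, 'u map) category" where
  "Sets =
    \<lparr>Obj = {X. small X},
     Arr = {Arrow X f Y |X f Y. small X \<and> small Y \<and> f \<in> X \<rightarrow>\<^sub>E Y},
     Dom = source, Cod = target,
     Id = (\<lambda>X. Arrow X (\<lambda>x\<in>X. x) X),
     Comp = (\<lambda>g f. Arrow (source f) (\<lambda>x\<in>source f. rule g (rule f x)) (target g))\<rparr>"

definition inclusion :: "'u set \<Rightarrow> 'u set \<Rightarrow> 'u map" where
  "inclusion X Y = Arrow X (\<lambda>x\<in>X. x) Y"


section \<open>Grothendieck topoi\<close>

text \<open>The maps making up functors and transformations are normalised outside their domains, so
  that equality of objects and arrows is equality of functors and of transformations.\<close>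
definition functor_category :: "('o, 'a) category \<Rightarrow> ('p, 'b) category \<Rightarrow>
  (('o, 'a, 'p, 'b) cfunctor, (('o, 'a, 'p, 'b) cfunctor, 'o \<Rightarrow> 'b) arrow) category" where
  "functor_category C D =
    (let Ob = {F. cfunctor C D F \<and> OMap F \<in> extensional (Obj C) \<and> AMap F \<in> extensional (Arr C)} in
    \<lparr>Obj = Ob,
     Arr = {Arrow F \<alpha> G |F \<alpha> G. F \<in> Ob \<and> G \<in> Ob \<and> nat_trans C D F G \<alpha> \<and> \<alpha> \<in> extensional (Obj C)},
     Dom = source, Cod = target,
     Id = (\<lambda>F. Arrow F (\<lambda>A\<in>Obj C. Id D (OMap F A)) F),
     Comp = (\<lambda>\<beta> \<alpha>. Arrow (source \<alpha>) (\<lambda>A\<in>Obj C. rule \<beta> A \<cdot>\<^bsub>D\<^esub> rule \<alpha> A) (target \<beta>))\<rparr>)"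

definition sieve :: "('o, 'a) category \<Rightarrow> 'o \<Rightarrow> 'a set \<Rightarrow> bool" where
  "sieve C A S \<longleftrightarrow> (\<forall>f \<in> S. f \<in> Arr C \<and> Cod C f = A) \<and>
    (\<forall>f \<in> S. \<forall>g \<in> Arr C. Cod C g = Dom C f \<longrightarrow> f \<cdot>\<^bsub>C\<^esub> g \<in> S)"

definition maximal_sieve :: "('o, 'a) category \<Rightarrow> 'o \<Rightarrow> 'a set" where
  "maximal_sieve C A = {f \<in> Arr C. Cod C f = A}"

definition pullback_sieve :: "('o, 'a) category \<Rightarrow> 'a \<Rightarrow> 'a set \<Rightarrow> 'a set" where
  "pullback_sieve C h S = {g \<in> Arr C. Cod C g = Dom C h \<and> h \<cdot>\<^bsub>C\<^esub> g \<in> S}"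

locale grothendieck_topology = category C
  for C :: "('o, 'a) category" and J :: "'o \<Rightarrow> 'a set set" +
  assumes covering_sieve: "\<lbrakk>A \<in> Obj C; S \<in> J A\<rbrakk> \<Longrightarrow> sieve C A S"
    and maximal_covers: "A \<in> Obj C \<Longrightarrow> maximal_sieve C A \<in> J A"
    and stable: "\<lbrakk>h \<in> Arr C; S \<in> J (Cod C h)\<rbrakk> \<Longrightarrow> pullback_sieve C h S \<in> J (Dom C h)"
    and transitive: "\<lbrakk>A \<in> Obj C; S \<in> J A; sieve C A R;
      \<And>h. h \<in> S \<Longrightarrow> pullback_sieve C h R \<in> J (Dom C h)\<rbrakk> \<Longrightarrow> R \<in> J A"

definition matching_family :: "('o, 'a) category \<Rightarrow> ('o, 'a, 'u set, 'u map) cfunctor \<Rightarrow>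
  'a set \<Rightarrow> ('a \<Rightarrow> 'u) \<Rightarrow> bool" where
  "matching_family C F S x \<longleftrightarrow> (\<forall>f \<in> S. x f \<in> OMap F (Dom C f)) \<and>
    (\<forall>f \<in> S. \<forall>g \<in> Arr C. Cod C g = Dom C f \<longrightarrow> rule (AMap F g) (x f) = x (f \<cdot>\<^bsub>C\<^esub> g))"

definition is_sheaf :: "('o, 'a) category \<Rightarrow> ('o \<Rightarrow> 'a set set) \<Rightarrow>
  ('o, 'a, 'u set, 'u map) cfunctor \<Rightarrow> bool" where
  "is_sheaf C J F \<longleftrightarrow>
    (\<forall>A \<in> Obj C. \<forall>S \<in> J A. \<forall>x. matching_family C F S x \<longrightarrow>
      (\<exists>!y. y \<in> OMap F A \<and> (\<forall>f \<in> S. rule (AMap F f) y = x f)))"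

definition Sheaves :: "('o, 'a) category \<Rightarrow> ('o \<Rightarrow> 'a set set) \<Rightarrow>
  (('o, 'a, 'u set, 'u map) cfunctor,
   (('o, 'a, 'u set, 'u map) cfunctor, 'o \<Rightarrow> 'u map) arrow) category" where
  "Sheaves C J = full_subcategory (functor_category (op_category C) Sets) (is_sheaf C J)"

definition grothendieck_topos :: "'u itself \<Rightarrow> ('o, 'a) category \<Rightarrow> bool" where
  "grothendieck_topos (_ :: 'u itself) E \<longleftrightarrow>
    (\<exists>(C :: ('u, 'u) category) J. small (Obj C) \<and> small (Arr C) \<and> grothendieck_topology C J \<and>
      equivalent_categories E
        (Sheaves C J :: (('u, 'u, 'u set, 'u map) cfunctor,
          (('u, 'u, 'u set, 'u map) cfunctor, 'u \<Rightarrow> 'u map) arrow) category))"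


section \<open>The structure morphism\<close>

record ('o, 'a, 'p, 'b) geometric_morphism =
  inverse_image :: "('p, 'b, 'o, 'a) cfunctor"
  direct_image :: "('o, 'a, 'p, 'b) cfunctor"

definition geometric_morphism :: "('o, 'a) category \<Rightarrow> ('p, 'b) category \<Rightarrow>
  ('o, 'a, 'p, 'b) geometric_morphism \<Rightarrow> bool" where
  "geometric_morphism E F \<gamma> \<longleftrightarrow>
    adjoint_functors F E (inverse_image \<gamma>) (direct_image \<gamma>) \<and> left_exact F E (inverse_image \<gamma>)"

definition connected_topos ::
  "('o, 'a) category \<Rightarrow> ('o, 'a, 'u set, 'u map) geometric_morphism \<Rightarrow> bool" where
  "connected_topos E \<gamma> \<longleftrightarrow> fully_faithful Sets E (inverse_image \<gamma>)"

text \<open>Over the topos of sets a left adjoint of the inverse image is automatically indexed, so no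
  further condition is imposed on it.\<close>
definition locally_connected_topos ::
  "('o, 'a) category \<Rightarrow> ('o, 'a, 'u set, 'u map) geometric_morphism \<Rightarrow> bool" where
  "locally_connected_topos E \<gamma> \<longleftrightarrow> (\<exists>K. adjoint_functors E Sets K (inverse_image \<gamma>))"


section \<open>Galois objects\<close>

definition Aut :: "('o, 'a) category \<Rightarrow> 'o \<Rightarrow> 'a set" where
  "Aut E A = {h \<in> hom E A A. iso E h}"

definition connected_object :: "('o, 'a) category \<Rightarrow> 'o \<Rightarrow> bool" where
  "connected_object E A \<longleftrightarrow> A \<in> Obj E \<and> \<not> initial E A \<and>
    (\<forall>X Y i j. X \<in> Obj E \<and> Y \<in> Obj E \<and> is_coproduct E X Y A i j \<longrightarrow> initial E X \<or> initial E Y)"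

text \<open>The constant generalised element: for \<^term>\<open>h \<in> H\<close>, the arrow from \<^term>\<open>A\<close> to the constant
  object on \<^term>\<open>H\<close> that factors through the global element given by \<^term>\<open>h\<close>. The object
  \<^term>\<open>OMap (inverse_image \<gamma>) {h}\<close> is terminal when the inverse image is left exact.\<close>
definition is_constant_element :: "('o, 'a) category \<Rightarrow>
  ('o, 'a, 'u set, 'u map) geometric_morphism \<Rightarrow> 'o \<Rightarrow> 'u set \<Rightarrow> 'u \<Rightarrow> 'a \<Rightarrow> bool" where
  "is_constant_element E \<gamma> A H h k \<longleftrightarrow>
    (\<exists>t \<in> hom E A (OMap (inverse_image \<gamma>) {h}).
      k = AMap (inverse_image \<gamma>) (inclusion {h} H) \<cdot>\<^bsub>E\<^esub> t)"

text \<open>The arrow \<open>(a, h) \<mapsto> (a, h(a))\<close> from the product \<open>(P, p, p')\<close> of \<^term>\<open>A\<close> with the constant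
  object on \<^term>\<open>H\<close> to the product \<open>(Q, q, q')\<close> of \<^term>\<open>A\<close> with itself, where \<^term>\<open>e h\<close> is the
  endomorphism of \<^term>\<open>A\<close> named by \<^term>\<open>h \<in> H\<close>. It is the unique arrow over \<^term>\<open>A\<close> whose second
  component restricts to \<^term>\<open>e h\<close> along the section \<open>a \<mapsto> (a, h)\<close>, for every \<^term>\<open>h \<in> H\<close>:
  the product with the constant object is a coproduct of copies of \<^term>\<open>A\<close>, and these sections
  are its injections.\<close>
definition is_canonical_map :: "('o, 'a) category \<Rightarrow>
  ('o, 'a, 'u set, 'u map) geometric_morphism \<Rightarrow> 'o \<Rightarrow> 'u set \<Rightarrow> ('u \<Rightarrow> 'a) \<Rightarrow>
  'o \<Rightarrow> 'a \<Rightarrow> 'a \<Rightarrow> 'o \<Rightarrow> 'a \<Rightarrow> 'a \<Rightarrow> 'a \<Rightarrow> bool" where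
  "is_canonical_map E \<gamma> A H e P p p' Q q q' c \<longleftrightarrow>
    c \<in> hom E P Q \<and> q \<cdot>\<^bsub>E\<^esub> c = p \<and>
    (\<forall>h \<in> H. \<exists>s \<in> hom E A P.
      p \<cdot>\<^bsub>E\<^esub> s = Id E A \<and> is_constant_element E \<gamma> A H h (p' \<cdot>\<^bsub>E\<^esub> s) \<and>
      q' \<cdot>\<^bsub>E\<^esub> (c \<cdot>\<^bsub>E\<^esub> s) = e h)"

text \<open>The automorphisms of \<^term>\<open>A\<close> are arrows, whereas the inverse image applies to small subsets
  of \<^typ>\<open>'u\<close>; \<^term>\<open>H\<close> with the bijection \<^term>\<open>e\<close> is a copy of \<^term>\<open>Aut E A\<close> there. The
  condition depends neither on that copy nor on the products.\<close>
definition galois_object ::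
  "('o, 'a) category \<Rightarrow> ('o, 'a, 'u set, 'u map) geometric_morphism \<Rightarrow> 'o \<Rightarrow> bool" where
  "galois_object E \<gamma> A \<longleftrightarrow>
    (\<exists>(H :: 'u set) e P p p' Q q q' c.
      small H \<and> bij_betw e H (Aut E A) \<and>
      is_product E A (OMap (inverse_image \<gamma>) H) P p p' \<and> is_product E A A Q q q' \<and>
      is_canonical_map E \<gamma> A H e P p p' Q q q' c \<and> iso E c) \<and>
    connected_object E A \<and>
    (\<exists>T t. terminal E T \<and> t \<in> hom E A T \<and> epi E t)"


section \<open>2-categories\<close>

text \<open>Both compositions are written in the order of composition of maps: \<^term>\<open>vcomp A \<beta> \<alpha>\<close> and
  \<^term>\<open>hcomp A \<beta> \<alpha>\<close> have \<^term>\<open>\<alpha>\<close> as the first cell.\<close>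
record ('o, 'a, 't) two_category = "('o, 'a) category" +
  Cell :: "'t set"
  src :: "'t \<Rightarrow> 'a"
  tgt :: "'t \<Rightarrow> 'a"
  id_cell :: "'a \<Rightarrow> 't"
  vcomp :: "'t \<Rightarrow> 't \<Rightarrow> 't"
  hcomp :: "'t \<Rightarrow> 't \<Rightarrow> 't"

definition cells :: "('o, 'a, 't) two_category \<Rightarrow> 'a \<Rightarrow> 'a \<Rightarrow> 't set" where
  "cells A u v = {\<alpha> \<in> Cell A. src A \<alpha> = u \<and> tgt A \<alpha> = v}"

locale two_category = category A
  for A :: "('o, 'a, 't) two_category" (structure) +
  assumes src_in_Arr: "\<alpha> \<in> Cell A \<Longrightarrow> src A \<alpha> \<in> Arr A"
    and tgt_in_Arr: "\<alpha> \<in> Cell A \<Longrightarrow> tgt A \<alpha> \<in> Arr A"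
    and parallel_Dom: "\<alpha> \<in> Cell A \<Longrightarrow> Dom A (src A \<alpha>) = Dom A (tgt A \<alpha>)"
    and parallel_Cod: "\<alpha> \<in> Cell A \<Longrightarrow> Cod A (src A \<alpha>) = Cod A (tgt A \<alpha>)"
    and id_cell_in_cells: "u \<in> Arr A \<Longrightarrow> id_cell A u \<in> cells A u u"
    and vcomp_in_cells: "\<lbrakk>\<alpha> \<in> cells A u v; \<beta> \<in> cells A v w\<rbrakk> \<Longrightarrow> vcomp A \<beta> \<alpha> \<in> cells A u w"
    and vcomp_id: "\<alpha> \<in> cells A u v \<Longrightarrow> vcomp A \<alpha> (id_cell A u) = \<alpha>"
    and id_vcomp: "\<alpha> \<in> cells A u v \<Longrightarrow> vcomp A (id_cell A v) \<alpha> = \<alpha>"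
    and vcomp_assoc: "\<lbrakk>\<alpha> \<in> cells A u v; \<beta> \<in> cells A v w; \<delta> \<in> cells A w x\<rbrakk>
      \<Longrightarrow> vcomp A (vcomp A \<delta> \<beta>) \<alpha> = vcomp A \<delta> (vcomp A \<beta> \<alpha>)"
    and hcomp_in_cells: "\<lbrakk>\<alpha> \<in> cells A u v; \<beta> \<in> cells A r s; Cod A u = Dom A r\<rbrakk>
      \<Longrightarrow> hcomp A \<beta> \<alpha> \<in> cells A (r \<cdot> u) (s \<cdot> v)"
    and hcomp_id: "\<alpha> \<in> cells A u v \<Longrightarrow> hcomp A \<alpha> (id_cell A (Id A (Dom A u))) = \<alpha>"
    and id_hcomp: "\<alpha> \<in> cells A u v \<Longrightarrow> hcomp A (id_cell A (Id A (Cod A u))) \<alpha> = \<alpha>"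
    and hcomp_assoc: "\<lbrakk>\<alpha> \<in> cells A u v; \<beta> \<in> cells A r s; \<delta> \<in> cells A x y;
        Cod A u = Dom A r; Cod A r = Dom A x\<rbrakk>
      \<Longrightarrow> hcomp A (hcomp A \<delta> \<beta>) \<alpha> = hcomp A \<delta> (hcomp A \<beta> \<alpha>)"
    and hcomp_id_cells: "\<lbrakk>u \<in> Arr A; r \<in> Arr A; Cod A u = Dom A r\<rbrakk>
      \<Longrightarrow> hcomp A (id_cell A r) (id_cell A u) = id_cell A (r \<cdot> u)"
    and interchange: "\<lbrakk>\<alpha> \<in> cells A u v; \<alpha>' \<in> cells A v w; \<beta> \<in> cells A r s; \<beta>' \<in> cells A s x;
        Cod A u = Dom A r\<rbrakk>
      \<Longrightarrow> hcomp A (vcomp A \<beta>' \<beta>) (vcomp A \<alpha>' \<alpha>) = vcomp A (hcomp A \<beta>' \<alpha>') (hcomp A \<beta> \<alpha>)"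

definition inverse_cells :: "('o, 'a, 't) two_category \<Rightarrow> 't \<Rightarrow> 't \<Rightarrow> bool" where
  "inverse_cells A \<alpha> \<beta> \<longleftrightarrow> \<alpha> \<in> Cell A \<and> \<beta> \<in> cells A (tgt A \<alpha>) (src A \<alpha>) \<and>
    vcomp A \<beta> \<alpha> = id_cell A (src A \<alpha>) \<and> vcomp A \<alpha> \<beta> = id_cell A (tgt A \<alpha>)"

definition invertible_cell :: "('o, 'a, 't) two_category \<Rightarrow> 't \<Rightarrow> bool" where
  "invertible_cell A \<alpha> \<longleftrightarrow> (\<exists>\<beta>. inverse_cells A \<alpha> \<beta>)"

abbreviation whisker_left :: "('o, 'a, 't) two_category \<Rightarrow> 'a \<Rightarrow> 't \<Rightarrow> 't" where
  "whisker_left A f \<alpha> \<equiv> hcomp A (id_cell A f) \<alpha>"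

abbreviation whisker_right :: "('o, 'a, 't) two_category \<Rightarrow> 't \<Rightarrow> 'a \<Rightarrow> 't" where
  "whisker_right A \<alpha> f \<equiv> hcomp A \<alpha> (id_cell A f)"

locale inversely_2_filtered = two_category A
  for A :: "('o, 'a, 't) two_category" (structure) +
  assumes nonempty: "Obj A \<noteq> {}"
    and F0: "\<lbrakk>X \<in> Obj A; Y \<in> Obj A\<rbrakk> \<Longrightarrow> \<exists>Z \<in> Obj A. (\<exists>u. u \<in> hom A Z X) \<and> (\<exists>v. v \<in> hom A Z Y)"
    and F1: "\<lbrakk>f \<in> hom A X E; g \<in> hom A Y E\<rbrakk> \<Longrightarrow>
      \<exists>Z \<in> Obj A. \<exists>u \<in> hom A Z X. \<exists>v \<in> hom A Z Y. \<exists>\<gamma> \<in> cells A (f \<cdot> u) (g \<cdot> v).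
        invertible_cell A \<gamma>"
    and F2: "\<lbrakk>f \<in> hom A X E; g \<in> hom A Y E;
        u\<^sub>1 \<in> hom A Z\<^sub>1 X; v\<^sub>1 \<in> hom A Z\<^sub>1 Y; \<gamma>\<^sub>1 \<in> cells A (f \<cdot> u\<^sub>1) (g \<cdot> v\<^sub>1);
        u\<^sub>2 \<in> hom A Z\<^sub>2 X; v\<^sub>2 \<in> hom A Z\<^sub>2 Y; \<gamma>\<^sub>2 \<in> cells A (f \<cdot> u\<^sub>2) (g \<cdot> v\<^sub>2)\<rbrakk> \<Longrightarrow>
      \<exists>Z \<in> Obj A. \<exists>w\<^sub>1 \<in> hom A Z Z\<^sub>1. \<exists>w\<^sub>2 \<in> hom A Z Z\<^sub>2.
        \<exists>\<alpha> \<in> cells A (u\<^sub>1 \<cdot> w\<^sub>1) (u\<^sub>2 \<cdot> w\<^sub>2). \<exists>\<beta> \<in> cells A (v\<^sub>1 \<cdot> w\<^sub>1) (v\<^sub>2 \<cdot> w\<^sub>2).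
          invertible_cell A \<alpha> \<and> invertible_cell A \<beta> \<and>
          vcomp A (whisker_left A g \<beta>) (whisker_right A \<gamma>\<^sub>1 w\<^sub>1) =
          vcomp A (whisker_right A \<gamma>\<^sub>2 w\<^sub>2) (whisker_left A f \<alpha>)"

text \<open>\<open>\<theta> v u\<close> is the formal cell from \<^term>\<open>u\<close> to \<^term>\<open>v\<close>: the target comes first.\<close>
datatype 'a formal_cell = Theta (theta_tgt: 'a) (theta_src: 'a) ("\<theta>")

definition add_formal_cells :: "('o, 'a) category \<Rightarrow> ('o, 'a, 'a formal_cell) two_category" where
  "add_formal_cells C =
    \<lparr>Obj = Obj C, Arr = Arr C, Dom = Dom C, Cod = Cod C, Id = Id C, Comp = Comp C,
     Cell = {\<theta> v u |u v. u \<in> Arr C \<and> v \<in> Arr C \<and> Dom C u = Dom C v \<and> Cod C u = Cod C v},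
     src = theta_src, tgt = theta_tgt,
     id_cell = (\<lambda>u. \<theta> u u),
     vcomp = (\<lambda>\<beta> \<alpha>. \<theta> (theta_tgt \<beta>) (theta_src \<alpha>)),
     hcomp = (\<lambda>\<beta> \<alpha>. \<theta> (theta_tgt \<beta> \<cdot>\<^bsub>C\<^esub> theta_tgt \<alpha>) (theta_src \<beta> \<cdot>\<^bsub>C\<^esub> theta_src \<alpha>))\<rparr>"

end

theory Submission
  imports Defs
begin

text \<open>Cells between parallel arrows being unique, the only contents of the 2-filteredness are that a Galois
  object exists and that two Galois objects \<open>A\<close>, \<open>B\<close> are dominated by a third. A Galois object is the same
  thing as a connected torsor under a constant group, and \<open>A \<times> B\<close> is again such a torsor \<open>X\<close>, though possibly not
  connected. Local connectedness provides a nonempty component \<open>Z\<close> of \<open>X\<close>; it is connected, and it is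
  a torsor under its stabiliser provided that it has global support. The latter uses that the terminal object is
  connected: the predicate on components ``\<open>Z\<close> is locally inhabited where this component is'' is invariant
  under the group, hence descends along \<open>X \<rightarrow> 1\<close> to a global truth value, which is true because it is so on \<open>Z\<close>.

  All of this is computed with sections over a site. Constant objects enter through the adjunctions on both
  sides of the inverse image and its full faithfulness: their sections are the locally constant functions.\<close>

section \<open>Local properties on a site\<close>

text \<open>The isomorphism in the definition of a Galois object is awkward for products and
  components, whose automorphisms are not known beforehand. On sections it says that a family of
  arrows indexed by a set acts freely and, on a cover, transitively. Torsors in this sense pass to
  products and components with evident index sets, and the index set is identified with the
  automorphisms only once the object is connected. The adjunctions have separate tasks. The left
  adjoint of the inverse image turns arrows into constant objects into functions on a set whose
  elements label the components; the direct image exhibits a constant object as the coproduct of its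
  points; fullness makes these points the only global elements. An epimorphism to the terminal
  object has to be read as local existence of sections, and a subobject classifier built from closed
  sieves makes this reading possible. The universe hypothesis keeps pairs of sections and sets of
  arrows within small subsets of the fixed type.\<close>

context category
begin

lemma homD:
  assumes "f \<in> hom C A B"
  shows "f \<in> Arr C" "Dom C f = A" "Cod C f = B" "A \<in> Obj C" "B \<in> Obj C"
  using assms Dom_in_Obj Cod_in_Obj by (auto simp: hom_def)

lemma homI: "f \<in> Arr C \<Longrightarrow> f \<in> hom C (Dom C f) (Cod C f)"
  by (simp add: hom_def)

lemma hom_assoc:
  "\<lbrakk>f \<in> hom C A B; g \<in> hom C B D; h \<in> hom C D F\<rbrakk> \<Longrightarrow> (h \<cdot> g) \<cdot> f = h \<cdot> (g \<cdot> f)"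
  using Comp_assoc by (simp add: hom_def)

lemma hom_Id: "f \<in> hom C A B \<Longrightarrow> f \<cdot> Id C A = f" "f \<in> hom C A B \<Longrightarrow> Id C B \<cdot> f = f"
  using Comp_Id Id_Comp by (auto simp: hom_def)

end

context grothendieck_topology
begin

text \<open>Along a member of \<open>S\<close> the sieve \<open>R\<close> pulls back to the maximal
  sieve, because it contains that member and is closed under precomposition; the transitivity axiom
  then applies.\<close>

lemma covering_superset:
  assumes A: "A \<in> Obj C" and S: "S \<in> J A" and R: "sieve C A R" and sub: "S \<subseteq> R"
  shows "R \<in> J A"
proof (rule transitive[OF A S R])
  fix h assume h: "h \<in> S"
  then have hC: "h \<in> Arr C" "Cod C h = A" using covering_sieve[OF A S] by (auto simp: sieve_def)
  have "pullback_sieve C h R = maximal_sieve C (Dom C h)"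
    using R h sub by (auto simp: pullback_sieve_def maximal_sieve_def sieve_def)
  then show "pullback_sieve C h R \<in> J (Dom C h)" using maximal_covers Dom_in_Obj hC by simp
qed

text \<open>This is the Kripke-Joyal meaning of truth on a cover. The predicate receives the stage
  and the arrow separately, so that it can speak both of sections over the stage and of restrictions
  along the arrow. It is not assumed to be stable under restriction.\<close>

definition locally :: "'o \<Rightarrow> ('o \<Rightarrow> 'a \<Rightarrow> bool) \<Rightarrow> bool" where
  "locally c P \<longleftrightarrow> (\<exists>S \<in> J c. \<forall>k \<in> S. P (Dom C k) k)"

lemma locallyI: "c \<in> Obj C \<Longrightarrow> (\<And>d k. k \<in> hom C d c \<Longrightarrow> P d k) \<Longrightarrow> locally c P"
  unfolding locally_def by (rule bexI[OF _ maximal_covers]) (auto simp: maximal_sieve_def hom_def)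

lemma locally_mono:
  assumes c: "c \<in> Obj C" and P: "locally c P" and PQ: "\<And>d k. k \<in> hom C d c \<Longrightarrow> P d k \<Longrightarrow> Q d k"
  shows "locally c Q"
proof -
  obtain S where S: "S \<in> J c" "\<forall>k \<in> S. P (Dom C k) k" using P by (auto simp: locally_def)
  then have "\<forall>k \<in> S. Q (Dom C k) k" using covering_sieve[OF c S(1)] PQ by (auto simp: sieve_def hom_def)
  with S(1) show ?thesis by (auto simp: locally_def)
qed

lemma locally_pullback:
  assumes P: "locally c P" and h: "h \<in> hom C b c"
  shows "locally b (\<lambda>d k. P d (h \<cdot>\<^bsub>C\<^esub> k))"
proof -
  obtain S where S: "S \<in> J c" "\<forall>k \<in> S. P (Dom C k) k" using P by (auto simp: locally_def)
  have "pullback_sieve C h S \<in> J b" using stable[of h S] S(1) homD[OF h] by auto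
  moreover have "P (Dom C k) (h \<cdot>\<^bsub>C\<^esub> k)" if k: "k \<in> pullback_sieve C h S" for k
  proof -
    have "h \<cdot>\<^bsub>C\<^esub> k \<in> hom C (Dom C k) c"
      using k h homD[OF h] by (intro Comp_in_hom[OF _ h]) (auto simp: pullback_sieve_def hom_def)
    then show ?thesis using k S(2) by (auto simp: pullback_sieve_def hom_def)
  qed
  ultimately show ?thesis by (auto simp: locally_def)
qed

text \<open>The sieve generated by a predicate need not satisfy it, so the covering sieve is taken to be
  the largest one contained in \<^term>\<open>Q\<close>.\<close>
lemma locally_trans:
  assumes c: "c \<in> Obj C" and P: "locally c P"
    and PQ: "\<And>d k. k \<in> hom C d c \<Longrightarrow> P d k \<Longrightarrow> locally d (\<lambda>e l. Q e (k \<cdot>\<^bsub>C\<^esub> l))"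
  shows "locally c Q"
proof -
  define R where "R = {m. m \<in> hom C (Dom C m) c \<and> (\<forall>e n. n \<in> hom C e (Dom C m) \<longrightarrow> Q e (m \<cdot>\<^bsub>C\<^esub> n))}"
  have R: "m \<cdot>\<^bsub>C\<^esub> n \<in> R" if m: "m \<in> hom C d c" and n: "n \<in> hom C e d"
    and Q: "\<And>b l. l \<in> hom C b e \<Longrightarrow> Q b ((m \<cdot>\<^bsub>C\<^esub> n) \<cdot>\<^bsub>C\<^esub> l)" for d e m n
    using Comp_in_hom[OF n m] Q by (auto simp: R_def hom_def)
  have sR: "sieve C c R"
    unfolding sieve_def
  proof (intro conjI ballI impI)
    fix f assume f: "f \<in> R"
    then show "f \<in> Arr C" "Cod C f = c" by (auto simp: R_def hom_def)
    fix g assume g: "g \<in> Arr C" "Cod C g = Dom C f"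
    have fc: "f \<in> hom C (Dom C f) c" and gh: "g \<in> hom C (Dom C g) (Dom C f)"
      using f g by (auto simp: R_def hom_def)
    show "f \<cdot>\<^bsub>C\<^esub> g \<in> R"
    proof (rule R[OF fc gh])
      fix b l assume l: "l \<in> hom C b (Dom C g)"
      show "Q b ((f \<cdot>\<^bsub>C\<^esub> g) \<cdot>\<^bsub>C\<^esub> l)"
        using f Comp_in_hom[OF l gh] hom_assoc[OF l gh fc] by (auto simp: R_def)
    qed
  qed
  obtain S where S: "S \<in> J c" "\<forall>k \<in> S. P (Dom C k) k" using P by (auto simp: locally_def)
  have "R \<in> J c"
  proof (rule transitive[OF c S(1) sR])
    fix h assume h: "h \<in> S"
    then have hh: "h \<in> hom C (Dom C h) c" using covering_sieve[OF c S(1)] by (auto simp: sieve_def hom_def)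
    note d = homD(4)[OF hh]
    obtain T where T: "T \<in> J (Dom C h)" "\<forall>l \<in> T. Q (Dom C l) (h \<cdot>\<^bsub>C\<^esub> l)"
      using PQ[OF hh] S(2) h by (auto simp: locally_def)
    have sT: "sieve C (Dom C h) T" using covering_sieve[OF d T(1)] .
    show "pullback_sieve C h R \<in> J (Dom C h)"
    proof (rule covering_superset[OF d T(1)])
      show "sieve C (Dom C h) (pullback_sieve C h R)"
        unfolding sieve_def
      proof (intro conjI ballI impI)
        fix f assume f: "f \<in> pullback_sieve C h R"
        then show "f \<in> Arr C" "Cod C f = Dom C h" by (auto simp: pullback_sieve_def)
        fix g assume g: "g \<in> Arr C" "Cod C g = Dom C f"
        have fh: "f \<in> hom C (Dom C f) (Dom C h)" and gh: "g \<in> hom C (Dom C g) (Dom C f)"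
          using f g by (auto simp: pullback_sieve_def hom_def)
        have "(h \<cdot>\<^bsub>C\<^esub> f) \<cdot>\<^bsub>C\<^esub> g \<in> R"
          using sR f g Comp_in_hom[OF fh hh] by (auto simp: sieve_def pullback_sieve_def hom_def)
        then show "f \<cdot>\<^bsub>C\<^esub> g \<in> pullback_sieve C h R"
          using hom_assoc[OF gh fh hh] Comp_in_hom[OF gh fh] by (auto simp: pullback_sieve_def hom_def)
      qed
      show "T \<subseteq> pullback_sieve C h R"
      proof
        fix l assume l: "l \<in> T"
        then have lh: "l \<in> hom C (Dom C l) (Dom C h)" using sT by (auto simp: sieve_def hom_def)
        have "h \<cdot>\<^bsub>C\<^esub> l \<in> R"
        proof (rule R[OF hh lh])
          fix b n assume n: "n \<in> hom C b (Dom C l)"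
          have "l \<cdot>\<^bsub>C\<^esub> n \<in> T" using sT l n by (auto simp: sieve_def hom_def)
          then have "Q b (h \<cdot>\<^bsub>C\<^esub> (l \<cdot>\<^bsub>C\<^esub> n))" using T(2) Comp_in_hom[OF n lh] by (auto simp: hom_def)
          then show "Q b ((h \<cdot>\<^bsub>C\<^esub> l) \<cdot>\<^bsub>C\<^esub> n)" using hom_assoc[OF n lh hh] by simp
        qed
        then show "l \<in> pullback_sieve C h R" using lh by (auto simp: pullback_sieve_def hom_def)
      qed
    qed
  qed
  \<comment> \<open>Membership in \<open>R\<close> quantifies over all further arrows; the identity
    is the one taken here.\<close>
  moreover have "Q (Dom C m) m" if "m \<in> R" for m
    using that Id_in_hom[of "Dom C m"] hom_Id(1)[of m] homD(4) by (fastforce simp: R_def)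
  ultimately show ?thesis by (auto simp: locally_def)
qed

text \<open>The cover for \<open>Q\<close> is pulled back along each arrow of the cover for
  \<open>P\<close>. This moves further down, so \<open>P\<close> has to persist under restriction,
  whereas \<open>Q\<close> is read off at the end of the composite.\<close>

lemma locally_conj:
  assumes c: "c \<in> Obj C" and P: "locally c P" and Q: "locally c Q"
    and stable: "\<And>d k e l. k \<in> hom C d c \<Longrightarrow> P d k \<Longrightarrow> l \<in> hom C e d \<Longrightarrow> P e (k \<cdot>\<^bsub>C\<^esub> l)"
  shows "locally c (\<lambda>d k. P d k \<and> Q d k)"
proof (rule locally_trans[OF c P])
  fix d k assume k: "k \<in> hom C d c" "P d k"
  show "locally d (\<lambda>e l. P e (k \<cdot>\<^bsub>C\<^esub> l) \<and> Q e (k \<cdot>\<^bsub>C\<^esub> l))"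
    using locally_mono[OF homD(4)[OF k(1)] locally_pullback[OF Q k(1)]] stable[OF k] by simp
qed

text \<open>Over a degenerate stage every sheaf has exactly one section, so distinctness of sections can only be
  asserted away from degenerate stages.\<close>
definition degenerate :: "'o \<Rightarrow> bool" where "degenerate c \<longleftrightarrow> locally c (\<lambda>d k. False)"

lemma degenerate_locally: "c \<in> Obj C \<Longrightarrow> degenerate c \<Longrightarrow> locally c P"
  using locally_mono unfolding degenerate_def by blast

lemma degenerate_restrict: "degenerate c \<Longrightarrow> k \<in> hom C d c \<Longrightarrow> degenerate d"
  unfolding degenerate_def by (drule (1) locally_pullback)

lemma locally_degenerate:
  assumes c: "c \<in> Obj C" and "locally c (\<lambda>d k. degenerate d)" shows "degenerate c"
  unfolding degenerate_def by (rule locally_trans[OF assms]) (simp add: degenerate_def)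

text \<open>If every arrow of the cover started at a degenerate stage, the stage itself would be
  degenerate. This extracts an actual witness from a local statement, much as one would choose a
  point.\<close>

lemma not_degenerate_locally:
  assumes "c \<in> Obj C" "\<not> degenerate c" "locally c P"
  obtains d k where "k \<in> hom C d c" "\<not> degenerate d" "P d k"
  using assms locally_degenerate[of c] locally_mono[of c P "\<lambda>d k. degenerate d"] by blast

section \<open>Sheaves as families of sets with restriction maps\<close>

text \<open>Sheaves are constructed in this unpackaged form, with arbitrary values outside the site,
  and become normalised functors only when an object of the topos is extracted. The last clause is
  the amalgamation of matching families.\<close>

definition sheaf_data :: "('o \<Rightarrow> 'u set) \<Rightarrow> ('a \<Rightarrow> 'u \<Rightarrow> 'u) \<Rightarrow> bool" where
  "sheaf_data T r \<longleftrightarrow>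
    (\<forall>c \<in> Obj C. small (T c)) \<and>
    (\<forall>c d k. \<forall>x \<in> T c. k \<in> hom C d c \<longrightarrow> r k x \<in> T d) \<and>
    (\<forall>c \<in> Obj C. \<forall>x \<in> T c. r (Id C c) x = x) \<and>
    (\<forall>c d e k l. \<forall>x \<in> T c. k \<in> hom C d c \<and> l \<in> hom C e d \<longrightarrow> r (k \<cdot>\<^bsub>C\<^esub> l) x = r l (r k x)) \<and>
    (\<forall>c \<in> Obj C. \<forall>S \<in> J c. \<forall>y. (\<forall>f \<in> S. y f \<in> T (Dom C f)) \<and>
        (\<forall>f \<in> S. \<forall>g \<in> Arr C. Cod C g = Dom C f \<longrightarrow> r g (y f) = y (f \<cdot>\<^bsub>C\<^esub> g)) \<longrightarrow>
      (\<exists>!z. z \<in> T c \<and> (\<forall>f \<in> S. r f z = y f)))"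

text \<open>Uniqueness of amalgamations follows from separatedness, which is asked for in the form
  with \<open>locally\<close>; a construction thus supplies only the existence of an
  amalgamation.\<close>

lemma sheaf_dataI:
  assumes "\<And>c. c \<in> Obj C \<Longrightarrow> small (T c)"
    and "\<And>c d k x. k \<in> hom C d c \<Longrightarrow> x \<in> T c \<Longrightarrow> r k x \<in> T d"
    and "\<And>c x. c \<in> Obj C \<Longrightarrow> x \<in> T c \<Longrightarrow> r (Id C c) x = x"
    and "\<And>c d e k l x. k \<in> hom C d c \<Longrightarrow> l \<in> hom C e d \<Longrightarrow> x \<in> T c \<Longrightarrow> r (k \<cdot>\<^bsub>C\<^esub> l) x = r l (r k x)"
    and "\<And>c S y. c \<in> Obj C \<Longrightarrow> S \<in> J c \<Longrightarrow> (\<And>f. f \<in> S \<Longrightarrow> y f \<in> T (Dom C f)) \<Longrightarrow>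
      (\<And>f d e g. f \<in> S \<Longrightarrow> f \<in> hom C d c \<Longrightarrow> g \<in> hom C e d \<Longrightarrow> r g (y f) = y (f \<cdot>\<^bsub>C\<^esub> g)) \<Longrightarrow>
      \<exists>z \<in> T c. \<forall>f \<in> S. r f z = y f"
    and sep: "\<And>c x y. c \<in> Obj C \<Longrightarrow> x \<in> T c \<Longrightarrow> y \<in> T c \<Longrightarrow> locally c (\<lambda>d k. r k x = r k y) \<Longrightarrow> x = y"
  shows "sheaf_data T r"
proof -
  have "\<exists>!z. z \<in> T c \<and> (\<forall>f \<in> S. r f z = y f)"
    if c: "c \<in> Obj C" and S: "S \<in> J c" and 1: "\<forall>f \<in> S. y f \<in> T (Dom C f)"
      and 2: "\<forall>f \<in> S. \<forall>g \<in> Arr C. Cod C g = Dom C f \<longrightarrow> r g (y f) = y (f \<cdot>\<^bsub>C\<^esub> g)" for c S y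
  proof -
    have "\<exists>z \<in> T c. \<forall>f \<in> S. r f z = y f"
      using 1 2 by (intro assms(5)[OF c S]) (auto simp: hom_def)
    moreover have "z = z'" if "z \<in> T c" "z' \<in> T c" "\<forall>f \<in> S. r f z = y f" "\<forall>f \<in> S. r f z' = y f" for z z'
      using that by (intro sep[OF c]) (auto simp: locally_def intro: bexI[OF _ S])
    ultimately show ?thesis by blast
  qed
  then have 5: "\<forall>c \<in> Obj C. \<forall>S \<in> J c. \<forall>y. (\<forall>f \<in> S. y f \<in> T (Dom C f)) \<and>
        (\<forall>f \<in> S. \<forall>g \<in> Arr C. Cod C g = Dom C f \<longrightarrow> r g (y f) = y (f \<cdot>\<^bsub>C\<^esub> g)) \<longrightarrow>
      (\<exists>!z. z \<in> T c \<and> (\<forall>f \<in> S. r f z = y f))" by simp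
  show ?thesis unfolding sheaf_data_def
    by (intro conjI 5 ballI allI impI; (elim conjE)?) (simp_all add: assms(1-4))
qed

lemma sheaf_dataD:
  assumes "sheaf_data T r"
  shows "c \<in> Obj C \<Longrightarrow> small (T c)"
    and "k \<in> hom C d c \<Longrightarrow> x \<in> T c \<Longrightarrow> r k x \<in> T d"
    and "c \<in> Obj C \<Longrightarrow> x \<in> T c \<Longrightarrow> r (Id C c) x = x"
    and "k \<in> hom C d c \<Longrightarrow> l \<in> hom C e d \<Longrightarrow> x \<in> T c \<Longrightarrow> r (k \<cdot>\<^bsub>C\<^esub> l) x = r l (r k x)"
    and "c \<in> Obj C \<Longrightarrow> S \<in> J c \<Longrightarrow> \<forall>f \<in> S. y f \<in> T (Dom C f) \<Longrightarrow>
      \<forall>f \<in> S. \<forall>g \<in> Arr C. Cod C g = Dom C f \<longrightarrow> r g (y f) = y (f \<cdot>\<^bsub>C\<^esub> g) \<Longrightarrow>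
      \<exists>!z. z \<in> T c \<and> (\<forall>f \<in> S. r f z = y f)"
proof -
  note * = assms[unfolded sheaf_data_def]
  note 2 = *[THEN conjunct2] note 3 = 2[THEN conjunct2] note 4 = 3[THEN conjunct2] note 5 = 4[THEN conjunct2]
  show "c \<in> Obj C \<Longrightarrow> small (T c)" using *[THEN conjunct1] by blast
  show "k \<in> hom C d c \<Longrightarrow> x \<in> T c \<Longrightarrow> r k x \<in> T d" using 2[THEN conjunct1] by blast
  show "c \<in> Obj C \<Longrightarrow> x \<in> T c \<Longrightarrow> r (Id C c) x = x" using 3[THEN conjunct1] by blast
  show "k \<in> hom C d c \<Longrightarrow> l \<in> hom C e d \<Longrightarrow> x \<in> T c \<Longrightarrow> r (k \<cdot>\<^bsub>C\<^esub> l) x = r l (r k x)"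
    using 4[THEN conjunct1] by blast
  assume "c \<in> Obj C" "S \<in> J c"
  note 6 = 5[THEN bspec, OF this(1), THEN bspec, OF this(2), THEN spec, THEN mp]
  show "\<forall>f \<in> S. y f \<in> T (Dom C f) \<Longrightarrow>
      \<forall>f \<in> S. \<forall>g \<in> Arr C. Cod C g = Dom C f \<longrightarrow> r g (y f) = y (f \<cdot>\<^bsub>C\<^esub> g) \<Longrightarrow>
      \<exists>!z. z \<in> T c \<and> (\<forall>f \<in> S. r f z = y f)"
    by (rule 6, rule conjI)
qed

text \<open>The restrictions of \<open>x\<close> along the cover form a matching family, and both
  \<open>x\<close> and \<open>y\<close> amalgamate it.\<close>

lemma sheaf_separated:
  assumes T: "sheaf_data T r" and c: "c \<in> Obj C" and x: "x \<in> T c" and y: "y \<in> T c"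
    and eq: "locally c (\<lambda>d k. r k x = r k y)"
  shows "x = y"
proof -
  obtain S where S: "S \<in> J c" "\<forall>k \<in> S. r k x = r k y" using eq by (auto simp: locally_def)
  have k: "k \<in> hom C (Dom C k) c" if "k \<in> S" for k
    using that covering_sieve[OF c S(1)] by (auto simp: sieve_def hom_def)
  have "\<exists>!z. z \<in> T c \<and> (\<forall>f \<in> S. r f z = r f x)"
  proof (rule sheaf_dataD(5)[OF T c S(1)])
    show "\<forall>f \<in> S. r f x \<in> T (Dom C f)" using sheaf_dataD(2)[OF T k x] by blast
    show "\<forall>f \<in> S. \<forall>g \<in> Arr C. Cod C g = Dom C f \<longrightarrow> r g (r f x) = r (f \<cdot>\<^bsub>C\<^esub> g) x"
      using sheaf_dataD(4)[OF T k _ x] by (auto simp: hom_def)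
  qed
  then show ?thesis using S(2) x y by metis
qed

text \<open>A functional relation stable under restriction replaces the matching family: the arrows
  on which it is defined form a sieve, which covers because it contains a covering one. In return
  the glued section is known wherever the relation holds, not only on a chosen cover.\<close>

lemma sheaf_glue:
  assumes T: "sheaf_data T r" and c: "c \<in> Obj C"
    and closed: "\<And>d k z. k \<in> hom C d c \<Longrightarrow> R d k z \<Longrightarrow> z \<in> T d"
    and func: "\<And>d k z z'. k \<in> hom C d c \<Longrightarrow> R d k z \<Longrightarrow> R d k z' \<Longrightarrow> z = z'"
    and stab: "\<And>d e k l z. k \<in> hom C d c \<Longrightarrow> l \<in> hom C e d \<Longrightarrow> R d k z \<Longrightarrow> R e (k \<cdot>\<^bsub>C\<^esub> l) (r l z)"
    and total: "locally c (\<lambda>d k. \<exists>z. R d k z)"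
  shows "\<exists>y \<in> T c. \<forall>d k z. k \<in> hom C d c \<longrightarrow> R d k z \<longrightarrow> r k y = z"
proof -
  define S where "S = {k \<in> Arr C. Cod C k = c \<and> (\<exists>z. R (Dom C k) k z)}"
  obtain S' where S': "S' \<in> J c" "\<forall>k \<in> S'. \<exists>z. R (Dom C k) k z" using total by (auto simp: locally_def)
  have "sieve C c S"
    unfolding sieve_def
  proof (intro conjI ballI impI)
    fix f assume f: "f \<in> S"
    then show "f \<in> Arr C" "Cod C f = c" by (auto simp: S_def)
    fix g assume "g \<in> Arr C" "Cod C g = Dom C f"
    then show "f \<cdot>\<^bsub>C\<^esub> g \<in> S"
      using f stab[of f "Dom C f" g "Dom C g"] Comp_in_hom[of g "Dom C g" "Dom C f" f c]
      by (auto simp: S_def hom_def)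
  qed
  moreover have "S' \<subseteq> S" using S' covering_sieve[OF c S'(1)] by (auto simp: S_def sieve_def)
  ultimately have S: "S \<in> J c" using covering_superset[OF c S'(1)] by blast
  define y where "y k = (THE z. R (Dom C k) k z)" for k
  have y: "y k = z" if "k \<in> hom C d c" "R d k z" for d k z
    unfolding y_def using that func by (intro the_equality) (auto simp: hom_def)
  have "\<exists>!z. z \<in> T c \<and> (\<forall>f \<in> S. r f z = y f)"
  proof (rule sheaf_dataD(5)[OF T c S]; intro ballI impI)
    fix f assume "f \<in> S"
    then obtain z where f: "f \<in> hom C (Dom C f) c" "R (Dom C f) f z" by (auto simp: S_def hom_def)
    then show "y f \<in> T (Dom C f)" using y closed by simp
    fix g assume "g \<in> Arr C" "Cod C g = Dom C f"
    then have g: "g \<in> hom C (Dom C g) (Dom C f)" by (simp add: hom_def)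
    show "r g (y f) = y (f \<cdot>\<^bsub>C\<^esub> g)" using y[OF f] y[OF Comp_in_hom[OF g f(1)] stab[OF f(1) g f(2)]] by simp
  qed
  then obtain z where z: "z \<in> T c" "\<forall>f \<in> S. r f z = y f" by blast
  have "r k z = z'" if "k \<in> hom C d c" "R d k z'" for d k z'
    using z(2) y[OF that] that by (auto simp: S_def hom_def)
  with z(1) show ?thesis by blast
qed

end

section \<open>Arrows and subobjects in terms of sections\<close>

lemma small_subset: "X \<subseteq> Y \<Longrightarrow> small Y \<Longrightarrow> small X"
  unfolding small_def using lesspoll_trans1 subset_imp_lepoll by blast

text \<open>A topos \<^term>\<open>E\<close> of sheaves on \<^term>\<open>(C, J)\<close>, up to equivalence: \<^term>\<open>Sec X\<close> with \<^term>\<open>res X\<close> is the sheaf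
  corresponding to the object \<^term>\<open>X\<close>, and \<^term>\<open>app f\<close> the transformation corresponding to the arrow \<^term>\<open>f\<close>.\<close>
locale topos_sections = E: category E + grothendieck_topology C J
  for E :: "('o, 'a) category" and C :: "('u, 'u) category" and J +
  fixes Sec :: "'o \<Rightarrow> 'u \<Rightarrow> 'u set" and res :: "'o \<Rightarrow> 'u \<Rightarrow> 'u \<Rightarrow> 'u"
    and app :: "'a \<Rightarrow> 'u \<Rightarrow> 'u \<Rightarrow> 'u"
  assumes sheaf: "X \<in> Obj E \<Longrightarrow> sheaf_data (Sec X) (res X)"
    and app_in: "f \<in> hom E X Y \<Longrightarrow> c \<in> Obj C \<Longrightarrow> x \<in> Sec X c \<Longrightarrow> app f c x \<in> Sec Y c"
    and app_res: "f \<in> hom E X Y \<Longrightarrow> k \<in> hom C d c \<Longrightarrow> x \<in> Sec X c \<Longrightarrow>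
      app f d (res X k x) = res Y k (app f c x)"
    and app_Id: "X \<in> Obj E \<Longrightarrow> c \<in> Obj C \<Longrightarrow> x \<in> Sec X c \<Longrightarrow> app (Id E X) c x = x"
    and app_Comp: "f \<in> hom E X Y \<Longrightarrow> g \<in> hom E Y Z \<Longrightarrow> c \<in> Obj C \<Longrightarrow> x \<in> Sec X c \<Longrightarrow>
      app (g \<cdot>\<^bsub>E\<^esub> f) c x = app g c (app f c x)"
    and faithful: "f \<in> hom E X Y \<Longrightarrow> g \<in> hom E X Y \<Longrightarrow>
      (\<And>c x. c \<in> Obj C \<Longrightarrow> x \<in> Sec X c \<Longrightarrow> app f c x = app g c x) \<Longrightarrow> f = g"
    and full: "X \<in> Obj E \<Longrightarrow> Y \<in> Obj E \<Longrightarrow>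
      (\<And>c x. c \<in> Obj C \<Longrightarrow> x \<in> Sec X c \<Longrightarrow> \<phi> c x \<in> Sec Y c) \<Longrightarrow>
      (\<And>c d k x. k \<in> hom C d c \<Longrightarrow> x \<in> Sec X c \<Longrightarrow> \<phi> d (res X k x) = res Y k (\<phi> c x)) \<Longrightarrow>
      \<exists>f \<in> hom E X Y. \<forall>c \<in> Obj C. \<forall>x \<in> Sec X c. app f c x = \<phi> c x"
    and represent: "sheaf_data (T :: 'u \<Rightarrow> 'u set) r \<Longrightarrow>
      \<exists>X \<in> Obj E. \<exists>\<beta>. (\<forall>c \<in> Obj C. bij_betw (\<beta> c) (Sec X c) (T c)) \<and>
        (\<forall>c d k. \<forall>x \<in> Sec X c. k \<in> hom C d c \<longrightarrow> \<beta> d (res X k x) = r k (\<beta> c x))"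
    and small_pow: "\<And>X :: 'u set. small X \<Longrightarrow> Pow X \<prec> (UNIV :: 'u set)"
    and infinite_univ: "infinite (UNIV :: 'u set)"
    and small_UN: "\<And>(I :: 'u set) (X :: 'u \<Rightarrow> 'u set). small I \<Longrightarrow> (\<And>i. i \<in> I \<Longrightarrow> small (X i)) \<Longrightarrow> small (\<Union>i \<in> I. X i)"
    and small_Arr: "small (Arr C)"
begin

lemma res_in: "X \<in> Obj E \<Longrightarrow> k \<in> hom C d c \<Longrightarrow> x \<in> Sec X c \<Longrightarrow> res X k x \<in> Sec X d"
  using sheaf_dataD(2)[OF sheaf] .

lemma res_comp: "X \<in> Obj E \<Longrightarrow> k \<in> hom C d c \<Longrightarrow> l \<in> hom C e d \<Longrightarrow> x \<in> Sec X c \<Longrightarrow>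
    res X (k \<cdot>\<^bsub>C\<^esub> l) x = res X l (res X k x)"
  using sheaf_dataD(4)[OF sheaf] .

lemma res_Id: "X \<in> Obj E \<Longrightarrow> c \<in> Obj C \<Longrightarrow> x \<in> Sec X c \<Longrightarrow> res X (Id C c) x = x"
  using sheaf_dataD(3)[OF sheaf] .

lemmas separated = sheaf_separated[OF sheaf]
lemmas glue = sheaf_glue[OF sheaf]

lemma degenerate_eq:
  assumes "X \<in> Obj E" "c \<in> Obj C" "degenerate c" "x \<in> Sec X c" "y \<in> Sec X c" shows "x = y"
  using separated[OF assms(1,2,4,5)] degenerate_locally[OF assms(2,3)] by blast

text \<open>This is the tool for constructing arrows whose values are explicit only on a cover. The
  local values glue since the relation is functional and stable, and naturality of the result is
  checked on a cover by separatedness.\<close>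

lemma arrow_by_relation:
  assumes X: "X \<in> Obj E" and Z: "Z \<in> Obj E"
    and closed: "\<And>c x z. c \<in> Obj C \<Longrightarrow> x \<in> Sec X c \<Longrightarrow> R c x z \<Longrightarrow> z \<in> Sec Z c"
    and func: "\<And>c x z z'. c \<in> Obj C \<Longrightarrow> x \<in> Sec X c \<Longrightarrow> R c x z \<Longrightarrow> R c x z' \<Longrightarrow> z = z'"
    and stab: "\<And>c d k x z. k \<in> hom C d c \<Longrightarrow> x \<in> Sec X c \<Longrightarrow> R c x z \<Longrightarrow> R d (res X k x) (res Z k z)"
    and total: "\<And>c x. c \<in> Obj C \<Longrightarrow> x \<in> Sec X c \<Longrightarrow> locally c (\<lambda>d k. \<exists>z. R d (res X k x) z)"
  shows "\<exists>f \<in> hom E X Z. \<forall>c x z. c \<in> Obj C \<longrightarrow> x \<in> Sec X c \<longrightarrow> R c x z \<longrightarrow> app f c x = z"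
proof -
  have ex: "\<exists>y \<in> Sec Z c. \<forall>d k z. k \<in> hom C d c \<longrightarrow> R d (res X k x) z \<longrightarrow> res Z k y = z"
    if c: "c \<in> Obj C" and x: "x \<in> Sec X c" for c x
  proof (rule glue[OF Z c])
    fix d k z assume k: "k \<in> hom C d c" and R: "R d (res X k x) z"
    note d = homD(4)[OF k] and r = res_in[OF X k x]
    show "z \<in> Sec Z d" using closed[OF d r R] .
    show "z = z'" if "R d (res X k x) z'" for z' using func[OF d r R that] .
    show "R e (res X (k \<cdot>\<^bsub>C\<^esub> l) x) (res Z l z)" if l: "l \<in> hom C e d" for e l
      using stab[OF l r R] res_comp[OF X k l x] by simp
  qed (rule total[OF c x])
  define \<phi> where "\<phi> c x = (SOME y. y \<in> Sec Z c \<and> (\<forall>d k z. k \<in> hom C d c \<longrightarrow> R d (res X k x) z \<longrightarrow> res Z k y = z))" for c x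
  have \<phi>: "\<phi> c x \<in> Sec Z c \<and> (\<forall>d k z. k \<in> hom C d c \<longrightarrow> R d (res X k x) z \<longrightarrow> res Z k (\<phi> c x) = z)"
    if "c \<in> Obj C" "x \<in> Sec X c" for c x
    unfolding \<phi>_def by (rule someI_ex[OF ex[OF that, unfolded Bex_def]])
  have "\<exists>f \<in> hom E X Z. \<forall>c \<in> Obj C. \<forall>x \<in> Sec X c. app f c x = \<phi> c x"
  proof (rule full[OF X Z])
    show "\<phi> c x \<in> Sec Z c" if "c \<in> Obj C" "x \<in> Sec X c" for c x using \<phi>[OF that] by simp
    fix c d k x assume k: "k \<in> hom C d c" and x: "x \<in> Sec X c"
    note d = homD(4)[OF k] and c = homD(5)[OF k] and rx = res_in[OF X k x]
    show "\<phi> d (res X k x) = res Z k (\<phi> c x)"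
    proof (rule separated[OF Z d])
      show "\<phi> d (res X k x) \<in> Sec Z d" using \<phi>[OF d rx] by simp
      show "res Z k (\<phi> c x) \<in> Sec Z d" using \<phi>[OF c x] res_in[OF Z k] by simp
      show "locally d (\<lambda>e l. res Z l (\<phi> d (res X k x)) = res Z l (res Z k (\<phi> c x)))"
      proof (rule locally_mono[OF d total[OF d rx]])
        fix e l assume l: "l \<in> hom C e d" and "\<exists>z. R e (res X l (res X k x)) z"
        then obtain z where z: "R e (res X l (res X k x)) z" by blast
        have "R e (res X (k \<cdot>\<^bsub>C\<^esub> l) x) z" using z res_comp[OF X k l x] by simp
        then have "res Z (k \<cdot>\<^bsub>C\<^esub> l) (\<phi> c x) = z" using \<phi>[OF c x] Comp_in_hom[OF l k] by blast
        moreover have "res Z l (\<phi> d (res X k x)) = z" using \<phi>[OF d rx] l z by blast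
        ultimately show "res Z l (\<phi> d (res X k x)) = res Z l (res Z k (\<phi> c x))"
          using res_comp[OF Z k l] \<phi>[OF c x] by simp
      qed
    qed
  qed
  then obtain f where f: "f \<in> hom E X Z" "\<And>c x. c \<in> Obj C \<Longrightarrow> x \<in> Sec X c \<Longrightarrow> app f c x = \<phi> c x" by blast
  \<comment> \<open>A value already prescribed at the stage itself is recovered by restricting along
    the identity.\<close>
  have "app f c x = z" if c: "c \<in> Obj C" and x: "x \<in> Sec X c" and R: "R c x z" for c x z
  proof -
    have "res Z (Id C c) (\<phi> c x) = z" using \<phi>[OF c x] Id_in_hom[OF c] res_Id[OF X c x] R by simp
    then show ?thesis using f(2)[OF c x] res_Id[OF Z c] \<phi>[OF c x] by simp
  qed
  with f(1) show ?thesis by blast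
qed

text \<open>The stagewise inverses are natural because they invert a natural map, hence they come
  from an arrow by fullness; faithfulness gives the two equations.\<close>

lemma isoI:
  assumes f: "f \<in> hom E X Y" and bij: "\<And>c. c \<in> Obj C \<Longrightarrow> bij_betw (app f c) (Sec X c) (Sec Y c)"
  shows "iso E f"
proof -
  note X = E.homD(4)[OF f] and Y = E.homD(5)[OF f]
  let ?i = "\<lambda>c. inv_into (Sec X c) (app f c)"
  have i: "?i c y \<in> Sec X c" "app f c (?i c y) = y" if "c \<in> Obj C" "y \<in> Sec Y c" for c y
    using bij[OF that(1)] that(2) by (auto simp: bij_betw_def f_inv_into_f intro: inv_into_into)
  have i': "?i c (app f c x) = x" if "c \<in> Obj C" "x \<in> Sec X c" for c x
    using bij[OF that(1)] that(2) by (simp add: bij_betw_def)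
  have "\<exists>g \<in> hom E Y X. \<forall>c \<in> Obj C. \<forall>y \<in> Sec Y c. app g c y = ?i c y"
  proof (rule full[OF Y X i(1)])
    fix c d k y assume k: "k \<in> hom C d c" and y: "y \<in> Sec Y c"
    note d = homD(4)[OF k] and c = homD(5)[OF k]
    have "?i d (res Y k y) = ?i d (app f d (res X k (?i c y)))"
      using app_res[OF f k i(1)[OF c y]] i(2)[OF c y] by simp
    then show "?i d (res Y k y) = res X k (?i c y)" using i'[OF d res_in[OF X k i(1)[OF c y]]] by simp
  qed
  then obtain g where g: "g \<in> hom E Y X" "\<forall>c \<in> Obj C. \<forall>y \<in> Sec Y c. app g c y = ?i c y" by blast
  have "g \<cdot>\<^bsub>E\<^esub> f = Id E X"
    using i' app_in[OF f] g(2)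
    by (intro faithful[OF E.Comp_in_hom[OF f g(1)] E.Id_in_hom[OF X]]) (simp add: app_Comp[OF f g(1)] app_Id[OF X])
  moreover have "f \<cdot>\<^bsub>E\<^esub> g = Id E Y"
    using i g(2)
    by (intro faithful[OF E.Comp_in_hom[OF g(1) f] E.Id_in_hom[OF Y]]) (simp add: app_Comp[OF g(1) f] app_Id[OF Y])
  ultimately show ?thesis using f g(1) E.homD[OF f] by (auto simp: iso_def)
qed

lemma iso_inverse:
  assumes f: "f \<in> hom E X Y" and "iso E f"
  obtains g where "g \<in> hom E Y X" "g \<cdot>\<^bsub>E\<^esub> f = Id E X" "f \<cdot>\<^bsub>E\<^esub> g = Id E Y"
    "\<And>c x. c \<in> Obj C \<Longrightarrow> x \<in> Sec X c \<Longrightarrow> app g c (app f c x) = x"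
    "\<And>c y. c \<in> Obj C \<Longrightarrow> y \<in> Sec Y c \<Longrightarrow> app f c (app g c y) = y"
proof -
  obtain g where g: "g \<in> hom E Y X" "g \<cdot>\<^bsub>E\<^esub> f = Id E X" "f \<cdot>\<^bsub>E\<^esub> g = Id E Y"
    using assms E.homD[OF f] by (auto simp: iso_def)
  show thesis
    using that[OF g] app_Comp[OF f g(1)] app_Comp[OF g(1) f] g(2,3) app_Id E.homD(4,5)[OF f] by metis
qed

lemma isoD:
  assumes f: "f \<in> hom E X Y" and i: "iso E f" and c: "c \<in> Obj C"
  shows "bij_betw (app f c) (Sec X c) (Sec Y c)"
proof -
  obtain g where g: "g \<in> hom E Y X" "\<And>c x. c \<in> Obj C \<Longrightarrow> x \<in> Sec X c \<Longrightarrow> app g c (app f c x) = x"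
    "\<And>c y. c \<in> Obj C \<Longrightarrow> y \<in> Sec Y c \<Longrightarrow> app f c (app g c y) = y"
    using iso_inverse[OF f i] by metis
  show ?thesis
    using g c app_in[OF f c] app_in[OF g(1) c] by (intro bij_betw_byWitness[of _ "app g c"]) auto
qed

lemma representE:
  fixes T :: "'u \<Rightarrow> 'u set"
  assumes "sheaf_data T r"
  obtains X \<beta> where "X \<in> Obj E" "\<And>c. c \<in> Obj C \<Longrightarrow> bij_betw (\<beta> c) (Sec X c) (T c)"
    "\<And>c d k x. x \<in> Sec X c \<Longrightarrow> k \<in> hom C d c \<Longrightarrow> \<beta> d (res X k x) = r k (\<beta> c x)"
proof -
  obtain X \<beta> where X: "X \<in> Obj E" "\<forall>c \<in> Obj C. bij_betw (\<beta> c) (Sec X c) (T c)"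
    "\<forall>c d k. \<forall>x \<in> Sec X c. k \<in> hom C d c \<longrightarrow> \<beta> d (res X k x) = r k (\<beta> c x)"
    using represent[OF assms] by (elim bexE exE conjE)
  show thesis by (rule that[OF X(1)]) (use X in blast)+
qed

definition subsheaf :: "'o \<Rightarrow> ('u \<Rightarrow> 'u \<Rightarrow> bool) \<Rightarrow> bool" where
  "subsheaf X P \<longleftrightarrow> X \<in> Obj E \<and>
    (\<forall>c d k. \<forall>x \<in> Sec X c. k \<in> hom C d c \<longrightarrow> P c x \<longrightarrow> P d (res X k x)) \<and>
    (\<forall>c \<in> Obj C. \<forall>x \<in> Sec X c. locally c (\<lambda>d k. P d (res X k x)) \<longrightarrow> P c x)"

text \<open>Amalgamations are formed in \<open>X\<close>, and the local character of
  \<open>P\<close> brings them back into the subset. The representing object is known only up to a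
  renaming of sections, hence the description of the inclusion by injectivity and image.\<close>

lemma subobject:
  assumes P: "subsheaf X P"
  obtains Y i where "i \<in> hom E Y X" "\<And>c. c \<in> Obj C \<Longrightarrow> inj_on (app i c) (Sec Y c)"
    "\<And>c. c \<in> Obj C \<Longrightarrow> app i c ` Sec Y c = {x \<in> Sec X c. P c x}"
proof -
  have X: "X \<in> Obj E" using P by (simp add: subsheaf_def)
  let ?T = "\<lambda>c. {x \<in> Sec X c. P c x}"
  have "sheaf_data ?T (res X)"
  proof (rule sheaf_dataI)
    show "small (?T c)" if "c \<in> Obj C" for c
      using sheaf_dataD(1)[OF sheaf[OF X] that] by (rule small_subset[rotated]) blast
    show "\<And>c d k x. k \<in> hom C d c \<Longrightarrow> x \<in> ?T c \<Longrightarrow> res X k x \<in> ?T d"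
      using P res_in[OF X] by (auto simp: subsheaf_def)
    show "\<And>c x. c \<in> Obj C \<Longrightarrow> x \<in> ?T c \<Longrightarrow> res X (Id C c) x = x" using res_Id[OF X] by auto
    show "\<And>c d e k l x. k \<in> hom C d c \<Longrightarrow> l \<in> hom C e d \<Longrightarrow> x \<in> ?T c \<Longrightarrow>
        res X (k \<cdot>\<^bsub>C\<^esub> l) x = res X l (res X k x)" using res_comp[OF X] by auto
    show "\<And>c x y. c \<in> Obj C \<Longrightarrow> x \<in> ?T c \<Longrightarrow> y \<in> ?T c \<Longrightarrow> locally c (\<lambda>d k. res X k x = res X k y) \<Longrightarrow> x = y"
      using separated[OF X] by auto
    fix c S y assume c: "c \<in> Obj C" and S: "S \<in> J c" and y: "\<And>f. f \<in> S \<Longrightarrow> y f \<in> ?T (Dom C f)"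
      and m: "\<And>f d e g. f \<in> S \<Longrightarrow> f \<in> hom C d c \<Longrightarrow> g \<in> hom C e d \<Longrightarrow> res X g (y f) = y (f \<cdot>\<^bsub>C\<^esub> g)"
    have h: "f \<in> hom C (Dom C f) c" if "f \<in> S" for f
      using covering_sieve[OF c S] that by (auto simp: sieve_def hom_def)
    have "\<exists>!z. z \<in> Sec X c \<and> (\<forall>f \<in> S. res X f z = y f)"
      using y m h by (intro sheaf_dataD(5)[OF sheaf[OF X] c S]) (auto simp: hom_def)
    then obtain z where z: "z \<in> Sec X c" "\<forall>f \<in> S. res X f z = y f" by blast
    have "locally c (\<lambda>d k. P d (res X k z))" unfolding locally_def using z(2) y by (intro bexI[OF _ S]) auto
    then have "P c z" using P c z(1) by (auto simp: subsheaf_def)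
    then show "\<exists>z \<in> ?T c. \<forall>f \<in> S. res X f z = y f" using z by blast
  qed
  then obtain Y \<beta> where Y: "Y \<in> Obj E" and b: "\<And>c. c \<in> Obj C \<Longrightarrow> bij_betw (\<beta> c) (Sec Y c) (?T c)"
    and n: "\<And>c d k x. x \<in> Sec Y c \<Longrightarrow> k \<in> hom C d c \<Longrightarrow> \<beta> d (res Y k x) = res X k (\<beta> c x)"
    by (rule representE) blast
  have "\<exists>i \<in> hom E Y X. \<forall>c \<in> Obj C. \<forall>x \<in> Sec Y c. app i c x = \<beta> c x"
    using n b bij_betw_apply[OF b] by (intro full[OF Y X]) auto
  then obtain i where i: "i \<in> hom E Y X" "\<forall>c \<in> Obj C. \<forall>x \<in> Sec Y c. app i c x = \<beta> c x" by blast
  show thesis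
  proof (rule that[OF i(1)])
    fix c assume c: "c \<in> Obj C"
    show "inj_on (app i c) (Sec Y c)" using b[OF c] i(2) c by (auto simp: bij_betw_def inj_on_def)
    show "app i c ` Sec Y c = ?T c" using b[OF c] i(2) c by (simp add: bij_betw_def)
  qed
qed

text \<open>Injectivity of \<open>i\<close> makes the preimage under \<open>i\<close> a functional
  relation, and naturality of \<open>i\<close> and \<open>f\<close> makes it stable.\<close>

lemma lift:
  assumes i: "i \<in> hom E Y X" and inj: "\<And>c. c \<in> Obj C \<Longrightarrow> inj_on (app i c) (Sec Y c)"
    and f: "f \<in> hom E Z X" and im: "\<And>c z. c \<in> Obj C \<Longrightarrow> z \<in> Sec Z c \<Longrightarrow> app f c z \<in> app i c ` Sec Y c"
  obtains g where "g \<in> hom E Z Y" "i \<cdot>\<^bsub>E\<^esub> g = f"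
    "\<And>c z. c \<in> Obj C \<Longrightarrow> z \<in> Sec Z c \<Longrightarrow> app i c (app g c z) = app f c z"
proof -
  note Y = E.homD(4)[OF i] and X = E.homD(5)[OF i] and Z = E.homD(4)[OF f]
  have "\<exists>g \<in> hom E Z Y. \<forall>c z y. c \<in> Obj C \<longrightarrow> z \<in> Sec Z c \<longrightarrow>
      (y \<in> Sec Y c \<and> app i c y = app f c z) \<longrightarrow> app g c z = y"
  proof (rule arrow_by_relation[OF Z Y])
    show "y = y'" if "c \<in> Obj C" "y \<in> Sec Y c \<and> app i c y = app f c z" "y' \<in> Sec Y c \<and> app i c y' = app f c z" for c y y' z
      using inj[OF that(1)] that by (metis inj_onD)
    show "res Y k y \<in> Sec Y d \<and> app i d (res Y k y) = app f d (res Z k z)"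
      if k: "k \<in> hom C d c" "z \<in> Sec Z c" "y \<in> Sec Y c \<and> app i c y = app f c z" for c d k z y
      using that res_in[OF Y] app_res[OF i k(1)] app_res[OF f k(1)] by simp
    fix c z assume c: "c \<in> Obj C" and z: "z \<in> Sec Z c"
    show "locally c (\<lambda>d k. \<exists>y. y \<in> Sec Y d \<and> app i d y = app f d (res Z k z))"
    proof (rule locallyI[OF c])
      fix d k assume k: "k \<in> hom C d c"
      show "\<exists>y. y \<in> Sec Y d \<and> app i d y = app f d (res Z k z)"
        using im[OF homD(4)[OF k] res_in[OF Z k z]] by force
    qed
  qed simp
  then obtain g where g: "g \<in> hom E Z Y" and
    "\<And>c z y. c \<in> Obj C \<Longrightarrow> z \<in> Sec Z c \<Longrightarrow> y \<in> Sec Y c \<Longrightarrow> app i c y = app f c z \<Longrightarrow> app g c z = y" by blast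
  then have e: "app i c (app g c z) = app f c z" if "c \<in> Obj C" "z \<in> Sec Z c" for c z
    using that im[OF that] by force
  moreover have "i \<cdot>\<^bsub>E\<^esub> g = f"
    using e by (intro faithful[OF E.Comp_in_hom[OF g i] f]) (simp add: app_Comp[OF g i])
  ultimately show thesis using that g by blast
qed


section \<open>Small sets, the terminal object and binary products\<close>

lemma small_singleton: "small {x :: 'u}"
  by (simp add: small_def finite_lesspoll_infinite[OF infinite_univ])

lemma small_image: "small (X :: 'u set) \<Longrightarrow> small (f ` X :: 'u set)"
  unfolding small_def by (rule lesspoll_trans1[OF image_lepoll])

text \<open>Sections of a product must again be elements of the fixed type, so pairs are coded in
  it.\<close>

lemma pairing_exists: "\<exists>pr :: 'u \<times> 'u \<Rightarrow> 'u. inj pr"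
proof -
  obtain f :: "'u \<times> 'u \<Rightarrow> 'u" where "bij_betw f (UNIV \<times> UNIV) UNIV"
    using card_of_Times_same_infinite[OF infinite_univ] card_of_ordIso by blast
  then show ?thesis by (auto simp: bij_betw_def)
qed

text \<open>The coded product is a union, indexed by \<open>X\<close>, of images of
  \<open>Y\<close>, so closure of the universe under small unions applies.\<close>

lemma small_pairs:
  fixes X Y :: "'u set" and pr :: "'u \<times> 'u \<Rightarrow> 'u"
  assumes X: "small X" and Y: "small Y" shows "small (pr ` (X \<times> Y))"
proof -
  have "pr ` (X \<times> Y) = (\<Union>x \<in> X. (\<lambda>y. pr (x, y)) ` Y)" by auto
  then show ?thesis using small_UN[OF X] small_image[OF Y] by simp
qed

lemma one_exists: "\<exists>T \<in> Obj E. \<forall>c \<in> Obj C. \<exists>x. Sec T c = {x}"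
proof -
  have "sheaf_data (\<lambda>c. {undefined :: 'u}) (\<lambda>k x. undefined)"
    by (rule sheaf_dataI) (auto simp: small_singleton)
  then obtain X and \<beta> :: "'u \<Rightarrow> 'u \<Rightarrow> 'u" where
    X: "X \<in> Obj E" and b: "\<And>c. c \<in> Obj C \<Longrightarrow> bij_betw (\<beta> c) (Sec X c) {undefined}"
    by (rule representE) blast
  have "\<exists>x. Sec X c = {x}" if "c \<in> Obj C" for c
    using bij_betw_same_card[OF b[OF that]] by (simp add: card_1_singleton_iff)
  with X show ?thesis by blast
qed

lemma terminalI:
  assumes T: "T \<in> Obj E" and s: "\<And>c. c \<in> Obj C \<Longrightarrow> \<exists>x. Sec T c = {x}"
  shows "terminal E T"
  unfolding terminal_def
proof (intro conjI ballI T ex_ex1I)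
  fix X assume X: "X \<in> Obj E"
  have "\<exists>f \<in> hom E X T. \<forall>c \<in> Obj C. \<forall>x \<in> Sec X c. app f c x = (THE y. y \<in> Sec T c)"
  proof (rule full[OF X T])
    show t: "(THE y. y \<in> Sec T c) \<in> Sec T c" if "c \<in> Obj C" for c using s[OF that] by auto
    show "(THE y. y \<in> Sec T d) = res T k (THE y. y \<in> Sec T c)" if k: "k \<in> hom C d c" for c d k
      using s[OF homD(4)[OF k]] t[OF homD(4)[OF k]] t[OF homD(5)[OF k]] res_in[OF T k] by fastforce
  qed
  then show "\<exists>f. f \<in> hom E X T" by blast
  fix f g assume f: "f \<in> hom E X T" and g: "g \<in> hom E X T"
  show "f = g" using s app_in[OF f] app_in[OF g] by (intro faithful[OF f g]) fastforce
qed

text \<open>A terminal object is a retract of the sheaf with one section everywhere, since its only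
  endomorphism is the identity.\<close>

lemma terminalD:
  assumes T: "terminal E T" and c: "c \<in> Obj C" shows "\<exists>x. Sec T c = {x}"
proof -
  obtain S where S: "S \<in> Obj E" "\<And>c. c \<in> Obj C \<Longrightarrow> \<exists>x. Sec S c = {x}" using one_exists by blast
  have T': "T \<in> Obj E" using T by (simp add: terminal_def)
  obtain f where f: "f \<in> hom E S T" using T S(1) by (auto simp: terminal_def)
  obtain g where g: "g \<in> hom E T S" using terminalI[OF S] T' by (auto simp: terminal_def)
  have fg: "f \<cdot>\<^bsub>E\<^esub> g = Id E T"
    using T T' E.Comp_in_hom[OF g f] E.Id_in_hom[OF T'] by (auto simp: terminal_def)
  obtain x where x: "Sec S c = {x}" using S(2)[OF c] by blast
  have "y = app f c x" if "y \<in> Sec T c" for y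
    using app_Comp[OF g f c that] fg app_Id[OF T' c that] app_in[OF g c that] x by simp
  then show ?thesis using app_in[OF f c, of x] x by blast
qed

text \<open>The universal property read on sections: an element of the product is a pair of
  elements. Its equivalence with \<open>is_product\<close> allows the arbitrary products in the
  Galois condition to be handled by coordinates.\<close>

definition sec_product :: "'o \<Rightarrow> 'o \<Rightarrow> 'o \<Rightarrow> 'a \<Rightarrow> 'a \<Rightarrow> bool" where
  "sec_product A B P p q \<longleftrightarrow> p \<in> hom E P A \<and> q \<in> hom E P B \<and>
    (\<forall>c \<in> Obj C. bij_betw (\<lambda>w. (app p c w, app q c w)) (Sec P c) (Sec A c \<times> Sec B c))"

lemma sec_productD:
  assumes "sec_product A B P p q"
  shows "p \<in> hom E P A" "q \<in> hom E P B"
    and "\<And>c x y. c \<in> Obj C \<Longrightarrow> x \<in> Sec A c \<Longrightarrow> y \<in> Sec B c \<Longrightarrow> \<exists>w \<in> Sec P c. app p c w = x \<and> app q c w = y"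
    and "\<And>c w w'. c \<in> Obj C \<Longrightarrow> w \<in> Sec P c \<Longrightarrow> w' \<in> Sec P c \<Longrightarrow> app p c w = app p c w' \<Longrightarrow>
      app q c w = app q c w' \<Longrightarrow> w = w'"
proof -
  show "p \<in> hom E P A" "q \<in> hom E P B" using assms by (auto simp: sec_product_def)
  fix c assume "c \<in> Obj C"
  then have b: "bij_betw (\<lambda>w. (app p c w, app q c w)) (Sec P c) (Sec A c \<times> Sec B c)"
    using assms by (auto simp: sec_product_def)
  show "\<exists>w \<in> Sec P c. app p c w = x \<and> app q c w = y" if "x \<in> Sec A c" "y \<in> Sec B c" for x y
  proof -
    have "(x, y) \<in> (\<lambda>w. (app p c w, app q c w)) ` Sec P c" using b that by (simp add: bij_betw_def)
    then show ?thesis by blast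
  qed
  show "w = w'" if "w \<in> Sec P c" "w' \<in> Sec P c" "app p c w = app p c w'" "app q c w = app q c w'" for w w'
    using b that by (auto simp: bij_betw_def dest: inj_onD)
qed

lemma sec_product_pair:
  assumes P: "sec_product A B P p q" and f: "f \<in> hom E Z A" and g: "g \<in> hom E Z B"
  obtains m where "m \<in> hom E Z P" "p \<cdot>\<^bsub>E\<^esub> m = f" "q \<cdot>\<^bsub>E\<^esub> m = g"
    "\<And>c z. c \<in> Obj C \<Longrightarrow> z \<in> Sec Z c \<Longrightarrow> app p c (app m c z) = app f c z"
    "\<And>c z. c \<in> Obj C \<Longrightarrow> z \<in> Sec Z c \<Longrightarrow> app q c (app m c z) = app g c z"
proof -
  note d = sec_productD[OF P]
  note Z = E.homD(4)[OF f] and PO = E.homD(4)[OF d(1)]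
  let ?R = "\<lambda>c z w. w \<in> Sec P c \<and> app p c w = app f c z \<and> app q c w = app g c z"
  have ex: "\<exists>w. ?R c z w" if "c \<in> Obj C" "z \<in> Sec Z c" for c z
    using d(3)[OF that(1) app_in[OF f that] app_in[OF g that]] by blast
  have "\<exists>m \<in> hom E Z P. \<forall>c z w. c \<in> Obj C \<longrightarrow> z \<in> Sec Z c \<longrightarrow> ?R c z w \<longrightarrow> app m c z = w"
  proof (rule arrow_by_relation[OF Z PO])
    show "?R c z w \<Longrightarrow> ?R c z w' \<Longrightarrow> w = w'" if "c \<in> Obj C" for c z w w' using d(4)[OF that] by metis
    show "?R d (res Z k z) (res P k w)" if "k \<in> hom C d c" "z \<in> Sec Z c" "?R c z w" for c d k z w
      using that res_in[OF PO] app_res[OF d(1)] app_res[OF d(2)] app_res[OF f] app_res[OF g] by simp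
    show "locally c (\<lambda>d k. \<exists>w. ?R d (res Z k z) w)" if "c \<in> Obj C" "z \<in> Sec Z c" for c z
      using that ex res_in[OF Z _ that(2)] homD(4) by (intro locallyI) blast+
  qed simp
  then obtain m where m: "m \<in> hom E Z P" and
    "\<And>c z w. c \<in> Obj C \<Longrightarrow> z \<in> Sec Z c \<Longrightarrow> ?R c z w \<Longrightarrow> app m c z = w" by blast
  then have e: "?R c z (app m c z)" if "c \<in> Obj C" "z \<in> Sec Z c" for c z
    using ex[OF that] that by metis
  have "p \<cdot>\<^bsub>E\<^esub> m = f" "q \<cdot>\<^bsub>E\<^esub> m = g"
    using e app_Comp[OF m d(1)] app_Comp[OF m d(2)]
    by (auto intro!: faithful[OF E.Comp_in_hom[OF m d(1)] f] faithful[OF E.Comp_in_hom[OF m d(2)] g])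
  with that m e show thesis by blast
qed

lemma sec_product_is_product:
  assumes P: "sec_product A B P p q" shows "is_product E A B P p q"
  unfolding is_product_def
proof (intro conjI ballI)
  note d = sec_productD[OF P]
  show "p \<in> hom E P A" "q \<in> hom E P B" by (fact d)+
  fix X f g assume f: "f \<in> hom E X A" and g: "g \<in> hom E X B"
  have "m = m'" if m: "m \<in> hom E X P" "p \<cdot>\<^bsub>E\<^esub> m = f" "q \<cdot>\<^bsub>E\<^esub> m = g"
    and m': "m' \<in> hom E X P" "p \<cdot>\<^bsub>E\<^esub> m' = f" "q \<cdot>\<^bsub>E\<^esub> m' = g" for m m'
  proof (rule faithful[OF m(1) m'(1)])
    fix c x assume c: "c \<in> Obj C" and x: "x \<in> Sec X c"
    show "app m c x = app m' c x"
      using app_Comp[OF m(1) d(1) c x] app_Comp[OF m(1) d(2) c x] app_Comp[OF m'(1) d(1) c x]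
        app_Comp[OF m'(1) d(2) c x] m m'
      by (intro d(4)[OF c app_in[OF m(1) c x] app_in[OF m'(1) c x]]) simp_all
  qed
  then show "\<exists>!m. m \<in> hom E X P \<and> p \<cdot>\<^bsub>E\<^esub> m = f \<and> q \<cdot>\<^bsub>E\<^esub> m = g"
    using sec_product_pair[OF P f g] by metis
qed

text \<open>Sections are coded pairs, decoded by \<open>inv pr\<close>; restriction and amalgamation
  are done in each coordinate.\<close>

lemma product_exists:
  assumes A: "A \<in> Obj E" and B: "B \<in> Obj E" obtains P p q where "sec_product A B P p q"
proof -
  obtain pr :: "'u \<times> 'u \<Rightarrow> 'u" where "inj pr" using pairing_exists by blast
  then have pr[simp]: "pr u = pr v \<longleftrightarrow> u = v" "inv pr (pr u) = u" for u v by (auto simp: inj_eq)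
  let ?T = "\<lambda>c. pr ` (Sec A c \<times> Sec B c)"
  let ?r = "\<lambda>k w. pr (res A k (fst (inv pr w)), res B k (snd (inv pr w)))"
  have "sheaf_data ?T ?r"
  proof (rule sheaf_dataI)
    show "small (?T c)" if "c \<in> Obj C" for c
      using small_pairs sheaf_dataD(1)[OF sheaf[OF A] that] sheaf_dataD(1)[OF sheaf[OF B] that] .
    show "?r k w \<in> ?T d" if "k \<in> hom C d c" "w \<in> ?T c" for c d k w
      using that res_in[OF A] res_in[OF B] by auto
    show "?r (Id C c) w = w" if "c \<in> Obj C" "w \<in> ?T c" for c w
      using that res_Id[OF A] res_Id[OF B] by auto
    show "?r (k \<cdot>\<^bsub>C\<^esub> l) w = ?r l (?r k w)" if "k \<in> hom C d c" "l \<in> hom C e d" "w \<in> ?T c" for c d e k l w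
      using that res_comp[OF A] res_comp[OF B] by auto
    show "w = w'" if "c \<in> Obj C" "w \<in> ?T c" "w' \<in> ?T c" "locally c (\<lambda>d k. ?r k w = ?r k w')" for c w w'
      using that separated[OF A that(1)] separated[OF B that(1)] locally_mono[OF that(1)] by auto
    fix c S y assume c: "c \<in> Obj C" and S: "S \<in> J c" and y: "\<And>f. f \<in> S \<Longrightarrow> y f \<in> ?T (Dom C f)"
      and m: "\<And>f d e g. f \<in> S \<Longrightarrow> f \<in> hom C d c \<Longrightarrow> g \<in> hom C e d \<Longrightarrow> ?r g (y f) = y (f \<cdot>\<^bsub>C\<^esub> g)"
    have h: "f \<in> hom C (Dom C f) c" if "f \<in> S" for f
      using covering_sieve[OF c S] that by (auto simp: sieve_def hom_def)
    have y1: "fst (inv pr (y f)) \<in> Sec A (Dom C f)" "snd (inv pr (y f)) \<in> Sec B (Dom C f)" if "f \<in> S" for f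
      using y[OF that] by auto
    have m1: "res A g (fst (inv pr (y f))) = fst (inv pr (y (f \<cdot>\<^bsub>C\<^esub> g)))"
      "res B g (snd (inv pr (y f))) = snd (inv pr (y (f \<cdot>\<^bsub>C\<^esub> g)))"
      if "f \<in> S" "g \<in> Arr C" "Cod C g = Dom C f" for f g
      using m[OF that(1) h[OF that(1)], of g "Dom C g", symmetric] that by (simp_all add: hom_def)
    obtain a where a: "a \<in> Sec A c" "\<forall>f \<in> S. res A f a = fst (inv pr (y f))"
      using sheaf_dataD(5)[OF sheaf[OF A] c S, of "\<lambda>f. fst (inv pr (y f))"] y1 m1 by auto
    obtain b where b: "b \<in> Sec B c" "\<forall>f \<in> S. res B f b = snd (inv pr (y f))"
      using sheaf_dataD(5)[OF sheaf[OF B] c S, of "\<lambda>f. snd (inv pr (y f))"] y1 m1 by auto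
    have "?r f (pr (a, b)) = y f" if "f \<in> S" for f using a(2) b(2) y[OF that] that by auto
    then show "\<exists>z \<in> ?T c. \<forall>f \<in> S. ?r f z = y f" using a(1) b(1) by blast
  qed
  then obtain P \<beta> where P: "P \<in> Obj E" and b: "\<And>c. c \<in> Obj C \<Longrightarrow> bij_betw (\<beta> c) (Sec P c) (?T c)"
    and n: "\<And>c d k x. x \<in> Sec P c \<Longrightarrow> k \<in> hom C d c \<Longrightarrow> \<beta> d (res P k x) = ?r k (\<beta> c x)"
    by (rule representE) blast
  note bin = bij_betw_apply[OF b]
  have "\<exists>p \<in> hom E P A. \<forall>c \<in> Obj C. \<forall>x \<in> Sec P c. app p c x = fst (inv pr (\<beta> c x))"
    using n bin by (intro full[OF P A]) fastforce+
  then obtain p where p: "p \<in> hom E P A" "\<forall>c \<in> Obj C. \<forall>x \<in> Sec P c. app p c x = fst (inv pr (\<beta> c x))" by blast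
  have "\<exists>q \<in> hom E P B. \<forall>c \<in> Obj C. \<forall>x \<in> Sec P c. app q c x = snd (inv pr (\<beta> c x))"
    using n bin by (intro full[OF P B]) fastforce+
  then obtain q where q: "q \<in> hom E P B" "\<forall>c \<in> Obj C. \<forall>x \<in> Sec P c. app q c x = snd (inv pr (\<beta> c x))" by blast
  have "sec_product A B P p q"
    unfolding sec_product_def
  proof (intro conjI ballI p(1) q(1))
    fix c assume c: "c \<in> Obj C"
    have "bij_betw (inv pr \<circ> \<beta> c) (Sec P c) (Sec A c \<times> Sec B c)"
      by (rule bij_betw_trans[OF b[OF c]]) (auto simp: bij_betw_def inj_on_def image_iff)
    then show "bij_betw (\<lambda>w. (app p c w, app q c w)) (Sec P c) (Sec A c \<times> Sec B c)"
      using p(2) q(2) c by (subst bij_betw_cong[of _ _ "inv pr \<circ> \<beta> c"]) auto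
  qed
  with that show thesis by blast
qed

text \<open>The constructed product has pairs as sections by design. An arbitrary one is isomorphic
  to it compatibly with the projections, and an isomorphism is bijective on sections.\<close>

lemma is_product_sec_product:
  assumes P: "is_product E A B P p q" shows "sec_product A B P p q"
proof -
  have p: "p \<in> hom E P A" and q: "q \<in> hom E P B" using P by (auto simp: is_product_def)
  note PO = E.homD(4)[OF p]
  obtain Q p' q' where Q: "sec_product A B Q p' q'" using product_exists E.homD(5) p q by metis
  note d = sec_productD[OF Q]
  note QO = E.homD(4)[OF d(1)]
  obtain m where m: "m \<in> hom E P Q" "p' \<cdot>\<^bsub>E\<^esub> m = p" "q' \<cdot>\<^bsub>E\<^esub> m = q" by (rule sec_product_pair[OF Q p q])
  have "\<exists>!n. n \<in> hom E Q P \<and> p \<cdot>\<^bsub>E\<^esub> n = p' \<and> q \<cdot>\<^bsub>E\<^esub> n = q'"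
    using P QO d(1,2) by (auto simp: is_product_def)
  then obtain n where n: "n \<in> hom E Q P" "p \<cdot>\<^bsub>E\<^esub> n = p'" "q \<cdot>\<^bsub>E\<^esub> n = q'" by blast
  have u: "\<exists>!k. k \<in> hom E P P \<and> p \<cdot>\<^bsub>E\<^esub> k = p \<and> q \<cdot>\<^bsub>E\<^esub> k = q" using P PO p q by (auto simp: is_product_def)
  have nm: "n \<cdot>\<^bsub>E\<^esub> m = Id E P"
    using u E.Comp_in_hom[OF m(1) n(1)] E.Id_in_hom[OF PO] E.hom_Id[OF p] E.hom_Id[OF q]
      E.hom_assoc[OF m(1) n(1) p] E.hom_assoc[OF m(1) n(1) q] m n by metis
  have u: "\<exists>!k. k \<in> hom E Q Q \<and> p' \<cdot>\<^bsub>E\<^esub> k = p' \<and> q' \<cdot>\<^bsub>E\<^esub> k = q'"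
    using sec_product_is_product[OF Q] QO d by (auto simp: is_product_def)
  have mn: "m \<cdot>\<^bsub>E\<^esub> n = Id E Q"
    using u E.Comp_in_hom[OF n(1) m(1)] E.Id_in_hom[OF QO] E.hom_Id[OF d(1)] E.hom_Id[OF d(2)]
      E.hom_assoc[OF n(1) m(1) d(1)] E.hom_assoc[OF n(1) m(1) d(2)] m n by metis
  have i: "iso E m" using m n nm mn E.homD[OF m(1)] by (auto simp: iso_def)
  show ?thesis
    unfolding sec_product_def
  proof (intro conjI ballI p q)
    fix c assume c: "c \<in> Obj C"
    have "bij_betw ((\<lambda>w. (app p' c w, app q' c w)) \<circ> app m c) (Sec P c) (Sec A c \<times> Sec B c)"
      using bij_betw_trans[OF isoD[OF m(1) i c]] Q c by (auto simp: sec_product_def)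
    then show "bij_betw (\<lambda>w. (app p c w, app q c w)) (Sec P c) (Sec A c \<times> Sec B c)"
      using app_Comp[OF m(1) d(1) c] app_Comp[OF m(1) d(2) c] m
      by (subst bij_betw_cong[of _ _ "(\<lambda>w. (app p' c w, app q' c w)) \<circ> app m c"]) auto
  qed
qed

end

section \<open>The subobject classifier and global support\<close>

context grothendieck_topology
begin

text \<open>These are the truth values at the stage \<open>c\<close>, that is, the sections of the
  subobject classifier. The last condition is closedness for the topology: an arrow belongs to the
  sieve as soon as it does so on a cover.\<close>

definition closed_sieve :: "'o \<Rightarrow> 'a set \<Rightarrow> bool" where
  "closed_sieve c S \<longleftrightarrow> (\<forall>k \<in> S. k \<in> hom C (Dom C k) c) \<and>
    (\<forall>d e k l. k \<in> S \<longrightarrow> k \<in> hom C d c \<longrightarrow> l \<in> hom C e d \<longrightarrow> k \<cdot>\<^bsub>C\<^esub> l \<in> S) \<and>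
    (\<forall>d k. k \<in> hom C d c \<longrightarrow> locally d (\<lambda>e l. k \<cdot>\<^bsub>C\<^esub> l \<in> S) \<longrightarrow> k \<in> S)"

lemma closed_sieveI:
  assumes "\<And>k. k \<in> S \<Longrightarrow> k \<in> hom C (Dom C k) c"
    and "\<And>d e k l. k \<in> S \<Longrightarrow> k \<in> hom C d c \<Longrightarrow> l \<in> hom C e d \<Longrightarrow> k \<cdot>\<^bsub>C\<^esub> l \<in> S"
    and "\<And>d k. k \<in> hom C d c \<Longrightarrow> locally d (\<lambda>e l. k \<cdot>\<^bsub>C\<^esub> l \<in> S) \<Longrightarrow> k \<in> S"
  shows "closed_sieve c S"
  unfolding closed_sieve_def by (intro conjI) (use assms in blast)+

lemma closed_sieveD:
  assumes "closed_sieve c S"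
  shows "k \<in> S \<Longrightarrow> k \<in> hom C (Dom C k) c"
    and "k \<in> S \<Longrightarrow> k \<in> hom C d c \<Longrightarrow> l \<in> hom C e d \<Longrightarrow> k \<cdot>\<^bsub>C\<^esub> l \<in> S"
    and "k \<in> hom C d c \<Longrightarrow> locally d (\<lambda>e l. k \<cdot>\<^bsub>C\<^esub> l \<in> S) \<Longrightarrow> k \<in> S"
  using assms[unfolded closed_sieve_def, THEN conjunct1]
    assms[unfolded closed_sieve_def, THEN conjunct2, THEN conjunct1]
    assms[unfolded closed_sieve_def, THEN conjunct2, THEN conjunct2] by blast+

lemma in_pullback_sieve: "k \<in> hom C d c \<Longrightarrow> l \<in> pullback_sieve C k S \<longleftrightarrow> l \<in> hom C (Dom C l) d \<and> k \<cdot>\<^bsub>C\<^esub> l \<in> S"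
  by (auto simp: pullback_sieve_def hom_def)

lemma closed_pullback:
  assumes S: "closed_sieve c S" and k: "k \<in> hom C d c" shows "closed_sieve d (pullback_sieve C k S)"
proof (rule closed_sieveI)
  note i = in_pullback_sieve[OF k, of _ S] and D = closed_sieveD[OF S]
  show "l \<in> hom C (Dom C l) d" if "l \<in> pullback_sieve C k S" for l using that i by simp
  show "l \<cdot>\<^bsub>C\<^esub> m \<in> pullback_sieve C k S"
    if "l \<in> pullback_sieve C k S" and l: "l \<in> hom C e d" and m: "m \<in> hom C b e" for b e l m
    using that i D(2)[OF _ Comp_in_hom[OF l k] m] hom_assoc[OF m l k] Comp_in_hom[OF m l] homD(2)
    by auto
  fix e l assume l: "l \<in> hom C e d" and "locally e (\<lambda>b m. l \<cdot>\<^bsub>C\<^esub> m \<in> pullback_sieve C k S)"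
  then have "locally e (\<lambda>b m. (k \<cdot>\<^bsub>C\<^esub> l) \<cdot>\<^bsub>C\<^esub> m \<in> S)"
    using i hom_assoc[OF _ l k] homD(4)[OF l] by (auto elim!: locally_mono[rotated])
  then show "l \<in> pullback_sieve C k S"
    using i l D(3)[OF Comp_in_hom[OF l k]] homD(2)[OF l] by auto
qed

end

context topos_sections
begin

text \<open>Closed sieves with pullback form a sheaf. They are subsets of the small set of arrows,
  so the strong limit property of the universe allows them to be coded by elements of the type;
  \<open>enc\<close> and \<open>dec\<close> are this coding.\<close>

lemma classifier_exists:
  obtains Om \<beta> where "Om \<in> Obj E" "\<And>c. c \<in> Obj C \<Longrightarrow> bij_betw (\<beta> c) (Sec Om c) {S. closed_sieve c S}"
    "\<And>c d k x. x \<in> Sec Om c \<Longrightarrow> k \<in> hom C d c \<Longrightarrow> \<beta> d (res Om k x) = pullback_sieve C k (\<beta> c x)"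
proof -
  obtain enc :: "'u set \<Rightarrow> 'u" where inj: "inj_on enc (Pow (Arr C))"
    using small_pow[OF small_Arr] by (auto simp: lesspoll_def lepoll_def)
  define dec where "dec = inv_into (Pow (Arr C)) enc"
  have sub: "S \<subseteq> Arr C" if "closed_sieve c S" for c S
    using closed_sieveD(1)[OF that] homD(1) by blast
  have dec: "dec (enc S) = S" if "closed_sieve c S" for c S
    using inj sub[OF that] by (simp add: dec_def)
  let ?T = "\<lambda>c. enc ` {S. closed_sieve c S}"
  let ?r = "\<lambda>k w. enc (pullback_sieve C k (dec w))"
  have "sheaf_data ?T ?r"
  proof (rule sheaf_dataI)
    fix c assume c: "c \<in> Obj C"
    have "?T c \<lesssim> Pow (Arr C)" using sub by (blast intro: lepoll_trans[OF image_lepoll subset_imp_lepoll])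
    then show "small (?T c)" unfolding small_def using small_pow[OF small_Arr] lesspoll_trans1 by blast
    show "?r (Id C c) w = w" if w: "w \<in> ?T c" for w
    proof -
      obtain S where S: "closed_sieve c S" "w = enc S" using w by auto
      have "l \<in> pullback_sieve C (Id C c) S \<longleftrightarrow> l \<in> S" for l
        unfolding in_pullback_sieve[OF Id_in_hom[OF c]]
        using closed_sieveD(1)[OF S(1), of l] hom_Id(2)[of l "Dom C l" c] by auto
      then have "pullback_sieve C (Id C c) S = S" by blast
      then show ?thesis using S dec by auto
    qed
    fix S y assume S: "S \<in> J c" and y: "\<And>f. f \<in> S \<Longrightarrow> y f \<in> ?T (Dom C f)"
      and m: "\<And>f d e g. f \<in> S \<Longrightarrow> f \<in> hom C d c \<Longrightarrow> g \<in> hom C e d \<Longrightarrow> ?r g (y f) = y (f \<cdot>\<^bsub>C\<^esub> g)"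
    have h: "f \<in> hom C (Dom C f) c" and Sg: "\<And>g e. g \<in> hom C e (Dom C f) \<Longrightarrow> f \<cdot>\<^bsub>C\<^esub> g \<in> S" if "f \<in> S" for f
      using covering_sieve[OF c S] that by (auto simp: sieve_def hom_def)
    define U where "U f = dec (y f)" for f
    have U: "closed_sieve (Dom C f) (U f)" "y f = enc (U f)" if "f \<in> S" for f
      using y[OF that] dec by (auto simp: U_def)
    have Ug: "U (f \<cdot>\<^bsub>C\<^esub> g) = pullback_sieve C g (U f)" if f: "f \<in> S" and g: "g \<in> hom C e (Dom C f)" for f g e
      using m[OF f h[OF f] g] dec[OF closed_pullback[OF U(1)[OF f] g]] by (simp add: U_def)
    \<comment> \<open>An arrow belongs to the amalgamation when, on a cover, it enters
      \<open>S\<close> and the sieve prescribed there is maximal, which is tested by the identity.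
      The local formulation makes the sieve closed.\<close>
    define Y where "Y = {k \<in> Arr C. Cod C k = c \<and> locally (Dom C k) (\<lambda>e l. k \<cdot>\<^bsub>C\<^esub> l \<in> S \<and> Id C e \<in> U (k \<cdot>\<^bsub>C\<^esub> l))}"
    have Y: "k \<in> Y \<longleftrightarrow> locally d (\<lambda>e l. k \<cdot>\<^bsub>C\<^esub> l \<in> S \<and> Id C e \<in> U (k \<cdot>\<^bsub>C\<^esub> l))" if "k \<in> hom C d c" for k d
      using that by (auto simp: Y_def hom_def)
    have clY: "closed_sieve c Y"
    proof (rule closed_sieveI)
      show "k \<in> hom C (Dom C k) c" if "k \<in> Y" for k using that by (simp add: Y_def hom_def)
      show "k \<cdot>\<^bsub>C\<^esub> l \<in> Y" if "k \<in> Y" and k: "k \<in> hom C d c" and l: "l \<in> hom C e d" for d e k l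
      proof -
        have "locally e (\<lambda>b n. k \<cdot>\<^bsub>C\<^esub> (l \<cdot>\<^bsub>C\<^esub> n) \<in> S \<and> Id C b \<in> U (k \<cdot>\<^bsub>C\<^esub> (l \<cdot>\<^bsub>C\<^esub> n)))"
          using locally_pullback[OF _ l] that Y[OF k] by blast
        then show ?thesis unfolding Y[OF Comp_in_hom[OF l k]]
          by (rule locally_mono[OF homD(4)[OF l]]) (simp add: hom_assoc[OF _ l k])
      qed
      fix d k assume k: "k \<in> hom C d c" and l: "locally d (\<lambda>e l. k \<cdot>\<^bsub>C\<^esub> l \<in> Y)"
      show "k \<in> Y" unfolding Y[OF k]
      proof (rule locally_trans[OF homD(4)[OF k] l])
        fix e l assume l: "l \<in> hom C e d" and "k \<cdot>\<^bsub>C\<^esub> l \<in> Y"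
        then have "locally e (\<lambda>b n. (k \<cdot>\<^bsub>C\<^esub> l) \<cdot>\<^bsub>C\<^esub> n \<in> S \<and> Id C b \<in> U ((k \<cdot>\<^bsub>C\<^esub> l) \<cdot>\<^bsub>C\<^esub> n))"
          using Y[OF Comp_in_hom[OF l k]] by blast
        then show "locally e (\<lambda>b n. k \<cdot>\<^bsub>C\<^esub> (l \<cdot>\<^bsub>C\<^esub> n) \<in> S \<and> Id C b \<in> U (k \<cdot>\<^bsub>C\<^esub> (l \<cdot>\<^bsub>C\<^esub> n)))"
          by (rule locally_mono[OF homD(4)[OF l]]) (simp add: hom_assoc[OF _ l k])
      qed
    qed
    have "pullback_sieve C f Y = U f" if f: "f \<in> S" for f
    proof -
      have "f \<cdot>\<^bsub>C\<^esub> l \<in> Y \<longleftrightarrow> l \<in> U f" if l: "l \<in> hom C e (Dom C f)" for e l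
      proof -
        note e = homD(4)[OF l]
        \<comment> \<open>The sieve prescribed at the composite is a pullback of \<open>U f\<close>,
          and a pullback contains the identity exactly when the arrow pulled back along lies in the
          sieve.\<close>
        have q: "f \<cdot>\<^bsub>C\<^esub> (l \<cdot>\<^bsub>C\<^esub> n) \<in> S \<and> Id C b \<in> U (f \<cdot>\<^bsub>C\<^esub> (l \<cdot>\<^bsub>C\<^esub> n)) \<longleftrightarrow> l \<cdot>\<^bsub>C\<^esub> n \<in> U f"
          if n: "n \<in> hom C b e" for b n
        proof -
          note ln = Comp_in_hom[OF n l]
          note Ib = Id_in_hom[OF homD(4)[OF n]]
          show ?thesis
            using Sg[OF f ln] Ug[OF f ln] in_pullback_sieve[OF ln] Ib homD(2)[OF Ib] hom_Id(1)[OF ln] by simp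
        qed
        have "f \<cdot>\<^bsub>C\<^esub> l \<in> Y \<longleftrightarrow> locally e (\<lambda>b n. f \<cdot>\<^bsub>C\<^esub> (l \<cdot>\<^bsub>C\<^esub> n) \<in> S \<and> Id C b \<in> U (f \<cdot>\<^bsub>C\<^esub> (l \<cdot>\<^bsub>C\<^esub> n)))"
          unfolding Y[OF Comp_in_hom[OF l h[OF f]]]
          by (rule iffI; erule locally_mono[OF e]) (simp_all add: hom_assoc[OF _ l h[OF f]])
        also have "\<dots> \<longleftrightarrow> locally e (\<lambda>b n. l \<cdot>\<^bsub>C\<^esub> n \<in> U f)"
          by (rule iffI; erule locally_mono[OF e]) (simp_all only: q)
        also have "\<dots> \<longleftrightarrow> l \<in> U f"
          by (rule iffI, erule closed_sieveD(3)[OF U(1)[OF f] l], rule locallyI[OF e],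
              erule (1) closed_sieveD(2)[OF U(1)[OF f] _ l])
        finally show ?thesis .
      qed
      then show ?thesis using in_pullback_sieve[OF h[OF f], of _ Y] closed_sieveD(1)[OF U(1)[OF f]] by blast
    qed
    then show "\<exists>z \<in> ?T c. \<forall>f \<in> S. ?r f z = y f" using clY dec[OF clY] U(2) by (intro bexI[of _ "enc Y"]) auto
  next
    show "?r k w \<in> ?T d" if k: "k \<in> hom C d c" and w: "w \<in> ?T c" for c d k w
    proof -
      obtain S where "closed_sieve c S" "w = enc S" using w by blast
      then show ?thesis using dec[of c S] closed_pullback[OF _ k] by simp
    qed
    show "?r (k \<cdot>\<^bsub>C\<^esub> l) w = ?r l (?r k w)"
      if k: "k \<in> hom C d c" and l: "l \<in> hom C e d" and w: "w \<in> ?T c" for c d e k l w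
    proof -
      obtain S where S: "closed_sieve c S" "w = enc S" using w by auto
      have "pullback_sieve C (k \<cdot>\<^bsub>C\<^esub> l) S = pullback_sieve C l (pullback_sieve C k S)"
        using in_pullback_sieve[OF Comp_in_hom[OF l k], of _ S] in_pullback_sieve[OF k, of _ S]
          in_pullback_sieve[OF l, of _ "pullback_sieve C k S"] hom_assoc[OF _ l k] Comp_in_hom[OF _ l] homD(2)
        by (metis (no_types, lifting) subset_antisym subsetI)
      then show ?thesis using S dec[OF S(1)] dec[OF closed_pullback[OF S(1) k]] by simp
    qed
    fix c w w' assume c: "c \<in> Obj C" and w: "w \<in> ?T c" "w' \<in> ?T c" and l: "locally c (\<lambda>d k. ?r k w = ?r k w')"
    obtain S S' where S: "closed_sieve c S" "w = enc S" and S': "closed_sieve c S'" "w' = enc S'"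
      using w by auto
    have "locally c (\<lambda>d k. pullback_sieve C k S = pullback_sieve C k S')"
    proof (rule locally_mono[OF c l])
      fix d k assume k: "k \<in> hom C d c" and "?r k w = ?r k w'"
      then have "dec (enc (pullback_sieve C k S)) = dec (enc (pullback_sieve C k S'))"
        using S S' dec[OF S(1)] dec[OF S'(1)] by simp
      then show "pullback_sieve C k S = pullback_sieve C k S'"
        using dec closed_pullback[OF S(1) k] closed_pullback[OF S'(1) k] by metis
    qed
    \<comment> \<open>One inclusion suffices, as the local agreement of the sieves is symmetric.
      Membership of a composite is again tested by an identity in the pullback.\<close>
    moreover have "S \<subseteq> S'"
      if S: "closed_sieve c S" and S': "closed_sieve c S'"
        and eq: "locally c (\<lambda>d k. pullback_sieve C k S = pullback_sieve C k S')" for S S'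
    proof
      fix k assume kS: "k \<in> S"
      define d where "d = Dom C k"
      have k: "k \<in> hom C d c" using closed_sieveD(1)[OF S kS] by (simp add: d_def)
      have "locally d (\<lambda>e l. k \<cdot>\<^bsub>C\<^esub> l \<in> S')"
      proof (rule locally_mono[OF homD(4)[OF k] locally_pullback[OF eq k]])
        fix e l assume l: "l \<in> hom C e d" and eq: "pullback_sieve C (k \<cdot>\<^bsub>C\<^esub> l) S = pullback_sieve C (k \<cdot>\<^bsub>C\<^esub> l) S'"
        note kl = Comp_in_hom[OF l k]
        have "Id C e \<in> pullback_sieve C (k \<cdot>\<^bsub>C\<^esub> l) T \<longleftrightarrow> k \<cdot>\<^bsub>C\<^esub> l \<in> T" for T
          using in_pullback_sieve[OF kl, of "Id C e" T] Id_in_hom[OF homD(4)[OF l]]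
            homD(2)[OF Id_in_hom[OF homD(4)[OF l]]] hom_Id(1)[OF kl] by simp
        then show "k \<cdot>\<^bsub>C\<^esub> l \<in> S'" using eq closed_sieveD(2)[OF S kS k l] by blast
      qed
      then show "k \<in> S'" by (rule closed_sieveD(3)[OF S' k])
    qed
    moreover have "locally c (\<lambda>d k. pullback_sieve C k S' = pullback_sieve C k S)"
      using calculation(1) by (simp add: eq_commute)
    ultimately have "S = S'" using S(1) S'(1) by blast
    then show "w = w'" using S S' by simp
  qed
  then obtain Om \<beta> where Om: "Om \<in> Obj E" and b: "\<And>c. c \<in> Obj C \<Longrightarrow> bij_betw (\<beta> c) (Sec Om c) (?T c)"
    and n: "\<And>c d k x. x \<in> Sec Om c \<Longrightarrow> k \<in> hom C d c \<Longrightarrow> \<beta> d (res Om k x) = ?r k (\<beta> c x)"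
    by (rule representE) blast
  show thesis
  proof (rule that[OF Om, of "\<lambda>c x. dec (\<beta> c x)"])
    have B: "bij_betw dec (?T c) {S. closed_sieve c S}" for c
      using dec by (intro bij_betw_byWitness[of _ enc]) auto
    then show "bij_betw (\<lambda>x. dec (\<beta> c x)) (Sec Om c) {S. closed_sieve c S}" if "c \<in> Obj C" for c
      using bij_betw_trans[OF b[OF that] B] by (simp add: comp_def)
    show "dec (\<beta> d (res Om k x)) = pullback_sieve C k (dec (\<beta> c x))"
      if x: "x \<in> Sec Om c" and k: "k \<in> hom C d c" for c d k x
    proof -
      obtain S where "closed_sieve c S" "\<beta> c x = enc S"
        using bij_betw_apply[OF b[OF homD(5)[OF k]] x] by blast
      then show ?thesis using n[OF x k] dec[of c S] dec[OF closed_pullback[OF _ k], of S] by simp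
    qed
  qed
qed

section \<open>Global support and initial objects\<close>

text \<open>This is the external form of global support, that is, of an epimorphism to the terminal
  object. Unlike the latter it can be checked for products and components by manipulating
  covers.\<close>

definition locally_inhabited :: "'o \<Rightarrow> bool" where
  "locally_inhabited X \<longleftrightarrow> X \<in> Obj E \<and> (\<forall>c \<in> Obj C. locally c (\<lambda>d k. Sec X d \<noteq> {}))"

text \<open>Truth and local inhabitedness of \<open>X\<close> are two global truth values, that is,
  arrows from the terminal object to the classifier. They agree after composition with
  \<open>t\<close>, because over \<open>X\<close> a section is given; cancelling the epimorphism
  makes them equal.\<close>

lemma epi_locally_inhabited:
  assumes T: "terminal E T" and t: "t \<in> hom E X T" and e: "epi E t" shows "locally_inhabited X"
proof -
  note X = E.homD(4)[OF t] and TO = E.homD(5)[OF t]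
  obtain Om \<beta> where Om: "Om \<in> Obj E" and b: "\<And>c. c \<in> Obj C \<Longrightarrow> bij_betw (\<beta> c) (Sec Om c) {S. closed_sieve c S}"
    and n: "\<And>c d k x. x \<in> Sec Om c \<Longrightarrow> k \<in> hom C d c \<Longrightarrow> \<beta> d (res Om k x) = pullback_sieve C k (\<beta> c x)"
    by (rule classifier_exists) blast
  \<comment> \<open>A family of closed sieves compatible with pullback is a global element of the
    classifier.\<close>
  have arrow: "\<exists>f \<in> hom E T Om. \<forall>c \<in> Obj C. \<forall>x \<in> Sec T c. \<beta> c (app f c x) = V c"
    if cl: "\<And>c. closed_sieve c (V c)" and nat: "\<And>c d k. k \<in> hom C d c \<Longrightarrow> pullback_sieve C k (V c) = V d" for V
  proof -
    define g where "g c = inv_into (Sec Om c) (\<beta> c) (V c)" for c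
    have "V c \<in> \<beta> c ` Sec Om c" if "c \<in> Obj C" for c using b[OF that] cl by (simp add: bij_betw_def)
    then have g: "g c \<in> Sec Om c" "\<beta> c (g c) = V c" if "c \<in> Obj C" for c
      using that by (auto simp: g_def inv_into_into f_inv_into_f)
    have "\<exists>f \<in> hom E T Om. \<forall>c \<in> Obj C. \<forall>x \<in> Sec T c. app f c x = g c"
    proof (rule full[OF TO Om])
      fix c d k assume k: "k \<in> hom C d c"
      note d = homD(4)[OF k] and c = homD(5)[OF k]
      have "\<beta> d (res Om k (g c)) = \<beta> d (g d)" using n[OF g(1)[OF c] k] g(2) c d nat[OF k] by simp
      then show "g d = res Om k (g c)"
        using b[OF d] g(1)[OF d] res_in[OF Om k g(1)[OF c]] by (auto simp: bij_betw_def dest: inj_onD)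
    qed (rule g(1))
    then show ?thesis using g(2) by (elim bexE, intro bexI) simp_all
  qed
  \<comment> \<open>\<open>?M\<close> is the maximal sieve, the value true; \<open>?L\<close> is the
    extent to which \<open>X\<close> is locally inhabited.\<close>
  let ?M = "\<lambda>c. {k. k \<in> hom C (Dom C k) c}"
  let ?L = "\<lambda>c. {k. k \<in> hom C (Dom C k) c \<and> locally (Dom C k) (\<lambda>e l. Sec X e \<noteq> {})}"
  have dom: "k \<in> hom C (Dom C k) c" if "k \<in> hom C d c" for k d c using that by (simp add: hom_def)
  have M: "closed_sieve c (?M c)" for c
    by (rule closed_sieveI) (auto intro: Comp_in_hom dom)
  have L: "closed_sieve c (?L c)" for c
  proof (rule closed_sieveI)
    show "k \<cdot>\<^bsub>C\<^esub> l \<in> ?L c" if "k \<in> ?L c" "k \<in> hom C d c" "l \<in> hom C e d" for d e k l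
    proof -
      have "locally d (\<lambda>e l. Sec X e \<noteq> {})" using that homD(2)[OF that(2)] by simp
      then have "locally e (\<lambda>e l. Sec X e \<noteq> {})" by (rule locally_pullback[OF _ that(3)])
      then show ?thesis using Comp_in_hom[OF that(3,2)] by (simp add: hom_def)
    qed
    show "k \<in> ?L c" if k: "k \<in> hom C d c" and l: "locally d (\<lambda>e l. k \<cdot>\<^bsub>C\<^esub> l \<in> ?L c)" for d k
    proof -
      have "locally d (\<lambda>e l. Sec X e \<noteq> {})"
        by (rule locally_trans[OF homD(4)[OF k] l]) (use homD(2)[OF Comp_in_hom[OF _ k]] in auto)
      then show ?thesis using k by (auto simp: hom_def)
    qed
  qed blast
  have Mn: "pullback_sieve C k (?M c) = ?M d" if k: "k \<in> hom C d c" for c d k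
    using in_pullback_sieve[OF k, of _ "?M c"] dom[OF Comp_in_hom[OF _ k]] by blast
  have Ln: "pullback_sieve C k (?L c) = ?L d" if k: "k \<in> hom C d c" for c d k
    using in_pullback_sieve[OF k, of _ "?L c"] dom[OF Comp_in_hom[OF _ k]] homD(2)[OF Comp_in_hom[OF _ k]] by auto
  obtain u where u: "u \<in> hom E T Om" "\<And>c x. c \<in> Obj C \<Longrightarrow> x \<in> Sec T c \<Longrightarrow> \<beta> c (app u c x) = ?M c"
    using arrow[of ?M, OF M Mn] by blast
  obtain v where v: "v \<in> hom E T Om" "\<And>c x. c \<in> Obj C \<Longrightarrow> x \<in> Sec T c \<Longrightarrow> \<beta> c (app v c x) = ?L c"
    using arrow[of ?L, OF L Ln] by blast
  have "u \<cdot>\<^bsub>E\<^esub> t = v \<cdot>\<^bsub>E\<^esub> t"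
  proof (rule faithful[OF E.Comp_in_hom[OF t u(1)] E.Comp_in_hom[OF t v(1)]])
    fix c x assume c: "c \<in> Obj C" and x: "x \<in> Sec X c"
    have "locally d (\<lambda>e l. Sec X e \<noteq> {})" if k: "k \<in> hom C d c" for k d
      using res_in[OF X _ res_in[OF X k x]] homD(4)[OF k] by (intro locallyI) auto
    then have "?M c = ?L c" by auto
    then have "\<beta> c (app u c (app t c x)) = \<beta> c (app v c (app t c x))" using u v c app_in[OF t c x] by simp
    then have "app u c (app t c x) = app v c (app t c x)"
      using b[OF c] app_in[OF u(1) c app_in[OF t c x]] app_in[OF v(1) c app_in[OF t c x]]
      by (auto simp: bij_betw_def dest: inj_onD)
    then show "app (u \<cdot>\<^bsub>E\<^esub> t) c x = app (v \<cdot>\<^bsub>E\<^esub> t) c x" using app_Comp[OF t _ c x] u v by simp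
  qed
  then have uv: "u = v" using e u(1) v(1) E.homD[OF t] by (auto simp: epi_def hom_def)
  have "locally c (\<lambda>d k. Sec X d \<noteq> {})" if c: "c \<in> Obj C" for c
  proof -
    obtain x where x: "x \<in> Sec T c" using terminalD[OF T c] by blast
    have "?M c = ?L c" using u(2)[OF c x] v(2)[OF c x] uv by simp
    moreover have "Id C c \<in> ?M c" using Id_in_hom[OF c] dom by blast
    ultimately show ?thesis using homD(2)[OF Id_in_hom[OF c]] by auto
  qed
  then show ?thesis using X by (auto simp: locally_inhabited_def)
qed

text \<open>Over a stage where \<open>X\<close> has a section, its image is the unique section of
  the terminal object. Two arrows that agree after \<open>t\<close> thus agree on a cover, and
  separatedness concludes.\<close>

lemma locally_inhabited_epi:
  assumes X: "locally_inhabited X" and T: "terminal E T" and t: "t \<in> hom E X T" shows "epi E t"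
  unfolding epi_def
proof (intro conjI ballI impI)
  show "t \<in> Arr E" using E.homD[OF t] by simp
  fix u v assume uv: "u \<in> Arr E" "v \<in> Arr E"
    "Dom E u = Cod E t \<and> Dom E v = Cod E t \<and> Cod E u = Cod E v \<and> u \<cdot>\<^bsub>E\<^esub> t = v \<cdot>\<^bsub>E\<^esub> t"
  define Z where "Z = Cod E u"
  have u: "u \<in> hom E T Z" and v: "v \<in> hom E T Z" and eq: "u \<cdot>\<^bsub>E\<^esub> t = v \<cdot>\<^bsub>E\<^esub> t"
    using uv E.homD(3)[OF t] by (simp_all add: hom_def Z_def)
  note TO = E.homD(5)[OF t] and Z = E.homD(5)[OF u]
  show "u = v"
  proof (rule faithful[OF u v])
    fix c x assume c: "c \<in> Obj C" and x: "x \<in> Sec T c"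
    show "app u c x = app v c x"
    proof (rule separated[OF Z c app_in[OF u c x] app_in[OF v c x]])
      have "locally c (\<lambda>d k. Sec X d \<noteq> {})" using X c by (auto simp: locally_inhabited_def)
      then show "locally c (\<lambda>d k. res Z k (app u c x) = res Z k (app v c x))"
      proof (rule locally_mono[OF c])
        fix d k assume k: "k \<in> hom C d c" and "Sec X d \<noteq> {}"
        then obtain y where y: "y \<in> Sec X d" by blast
        note d = homD(4)[OF k]
        have "res T k x = app t d y"
          using terminalD[OF T d] res_in[OF TO k x] app_in[OF t d y] by fastforce
        then have "app u d (res T k x) = app v d (res T k x)"
          using app_Comp[OF t u d y] app_Comp[OF t v d y] eq by simp
        then show "res Z k (app u c x) = res Z k (app v c x)" using app_res[OF u k x] app_res[OF v k x] by simp
      qed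
    qed
  qed
qed

text \<open>Even the initial sheaf has a section over each degenerate stage, where the empty family
  must glue; so emptiness can be required only elsewhere.\<close>

definition empty_object :: "'o \<Rightarrow> bool" where
  "empty_object X \<longleftrightarrow> X \<in> Obj E \<and> (\<forall>c \<in> Obj C. Sec X c \<noteq> {} \<longrightarrow> degenerate c)"

text \<open>The sections over degenerate stages form a subobject, and an arrow from the initial
  object into it forces all sections to lie over such stages. Conversely, over these stages values
  exist by gluing the empty family and are unique.\<close>

lemma initial_iff_empty: "initial E X \<longleftrightarrow> empty_object X"
proof
  assume I: "initial E X"
  then have X: "X \<in> Obj E" by (simp add: initial_def)
  have "subsheaf X (\<lambda>c x. degenerate c)"
    unfolding subsheaf_def using X degenerate_restrict locally_degenerate by blast
  then obtain Y i where i: "i \<in> hom E Y X" and im: "\<And>c. c \<in> Obj C \<Longrightarrow> app i c ` Sec Y c = {x \<in> Sec X c. degenerate c}"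
    by (rule subobject) blast
  obtain j where j: "j \<in> hom E X Y" using I E.homD(4)[OF i] by (auto simp: initial_def)
  have "degenerate c" if c: "c \<in> Obj C" and "x \<in> Sec X c" for c x
    using im[OF c] app_in[OF j c that(2)] by blast
  then show "empty_object X" using X by (auto simp: empty_object_def)
next
  assume "empty_object X"
  then have X: "X \<in> Obj E" and d: "\<And>c x. c \<in> Obj C \<Longrightarrow> x \<in> Sec X c \<Longrightarrow> degenerate c" by (auto simp: empty_object_def)
  show "initial E X" unfolding initial_def
  proof (intro conjI X ballI ex_ex1I)
    fix Z assume Z: "Z \<in> Obj E"
    \<comment> \<open>No values are prescribed: wherever \<open>X\<close> has a section the empty
      cover already makes the empty relation locally total.\<close>
    have "\<exists>f \<in> hom E X Z. \<forall>c x z. c \<in> Obj C \<longrightarrow> x \<in> Sec X c \<longrightarrow> False \<longrightarrow> app f c x = z"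
      by (rule arrow_by_relation[OF X Z]) (use d degenerate_locally in blast)+
    then show "\<exists>f. f \<in> hom E X Z" by blast
    show "f = g" if "f \<in> hom E X Z" "g \<in> hom E X Z" for f g
      using degenerate_eq[OF Z _ d app_in app_in] that by (intro faithful[OF that]) blast
  qed
qed

text \<open>Strictness of the initial object: a section of \<open>X\<close> is carried to a section
  of \<open>Y\<close> over the same stage.\<close>

lemma empty_object_arrow: "f \<in> hom E X Y \<Longrightarrow> empty_object Y \<Longrightarrow> empty_object X"
  unfolding empty_object_def using app_in E.homD(4) by blast

end

section \<open>Constant objects\<close>

text \<open>The adjunction given by unit and counit is put into universal form: every arrow factors
  uniquely through the unit. The factorisation of \<open>f\<close> is the counit after
  \<open>L f\<close>.\<close>

lemma adjoint_transpose:
  assumes "adjoint_functors C D L R"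
  obtains \<eta> where "\<And>A. A \<in> Obj C \<Longrightarrow> \<eta> A \<in> hom C A (OMap R (OMap L A))"
    "\<And>A B f. f \<in> hom C A B \<Longrightarrow> \<eta> B \<cdot>\<^bsub>C\<^esub> f = AMap R (AMap L f) \<cdot>\<^bsub>C\<^esub> \<eta> A"
    "\<And>A B f. B \<in> Obj D \<Longrightarrow> f \<in> hom C A (OMap R B) \<Longrightarrow> \<exists>g \<in> hom D (OMap L A) B. AMap R g \<cdot>\<^bsub>C\<^esub> \<eta> A = f"
    "\<And>A B g g'. A \<in> Obj C \<Longrightarrow> g \<in> hom D (OMap L A) B \<Longrightarrow> g' \<in> hom D (OMap L A) B \<Longrightarrow>
      AMap R g \<cdot>\<^bsub>C\<^esub> \<eta> A = AMap R g' \<cdot>\<^bsub>C\<^esub> \<eta> A \<Longrightarrow> g = g'"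
proof -
  interpret L: cfunctor C D L using assms by (simp add: adjoint_functors_def)
  interpret R: cfunctor D C R using assms by (simp add: adjoint_functors_def)
  obtain \<eta> \<epsilon> where n: "nat_trans C C id_functor (R \<circ>\<^sub>F L) \<eta>" and e: "nat_trans D D (L \<circ>\<^sub>F R) id_functor \<epsilon>"
    and t1: "\<And>A. A \<in> Obj C \<Longrightarrow> \<epsilon> (OMap L A) \<cdot>\<^bsub>D\<^esub> AMap L (\<eta> A) = Id D (OMap L A)"
    and t2: "\<And>B. B \<in> Obj D \<Longrightarrow> AMap R (\<epsilon> B) \<cdot>\<^bsub>C\<^esub> \<eta> (OMap R B) = Id C (OMap R B)"
    using assms by (auto simp: adjoint_functors_def)
  have n1: "\<eta> A \<in> hom C A (OMap R (OMap L A))" if "A \<in> Obj C" for A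
    using n that by (simp add: nat_trans_def id_functor_def comp_functor_def)
  have "AMap R (AMap L f) \<cdot>\<^bsub>C\<^esub> \<eta> A = \<eta> B \<cdot>\<^bsub>C\<^esub> f" if "f \<in> hom C A B" for A B f
    using n that by (auto simp: nat_trans_def id_functor_def comp_functor_def hom_def)
  note n2 = this[symmetric]
  have e1: "\<epsilon> B \<in> hom D (OMap L (OMap R B)) B" if "B \<in> Obj D" for B
    using e that by (simp add: nat_trans_def id_functor_def comp_functor_def)
  have e2: "g \<cdot>\<^bsub>D\<^esub> \<epsilon> A = \<epsilon> B \<cdot>\<^bsub>D\<^esub> AMap L (AMap R g)" if "g \<in> hom D A B" for A B g
    using e that by (auto simp: nat_trans_def id_functor_def comp_functor_def hom_def)
  show thesis
  proof (rule that[of \<eta>, OF n1 n2])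
    fix A B f assume B: "B \<in> Obj D" and f: "f \<in> hom C A (OMap R B)"
    note A = L.C.homD(4)[OF f]
    note Lf = L.AMap_in_hom[OF f]
    have "AMap R (\<epsilon> B \<cdot>\<^bsub>D\<^esub> AMap L f) \<cdot>\<^bsub>C\<^esub> \<eta> A = AMap R (\<epsilon> B) \<cdot>\<^bsub>C\<^esub> (AMap R (AMap L f) \<cdot>\<^bsub>C\<^esub> \<eta> A)"
      using R.AMap_Comp[OF Lf e1[OF B]]
        L.C.hom_assoc[OF n1[OF A] R.AMap_in_hom[OF Lf] R.AMap_in_hom[OF e1[OF B]]] by simp
    also have "\<dots> = (AMap R (\<epsilon> B) \<cdot>\<^bsub>C\<^esub> \<eta> (OMap R B)) \<cdot>\<^bsub>C\<^esub> f"
      using n2[OF f] L.C.hom_assoc[OF f n1[OF R.OMap_in_Obj[OF B]] R.AMap_in_hom[OF e1[OF B]]] by simp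
    also have "\<dots> = f" using t2[OF B] L.C.hom_Id(2)[OF f] by simp
    finally show "\<exists>g \<in> hom D (OMap L A) B. AMap R g \<cdot>\<^bsub>C\<^esub> \<eta> A = f"
      using L.D.Comp_in_hom[OF Lf e1[OF B]] by blast
  next
    fix A B g g' assume A: "A \<in> Obj C" and g: "g \<in> hom D (OMap L A) B" and g': "g' \<in> hom D (OMap L A) B"
      and eq: "AMap R g \<cdot>\<^bsub>C\<^esub> \<eta> A = AMap R g' \<cdot>\<^bsub>C\<^esub> \<eta> A"
    \<comment> \<open>The counit recovers an arrow from its transpose, which gives
      uniqueness.\<close>
    have r: "\<epsilon> B \<cdot>\<^bsub>D\<^esub> AMap L (AMap R h \<cdot>\<^bsub>C\<^esub> \<eta> A) = h" if h: "h \<in> hom D (OMap L A) B" for h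
    proof -
      note LRh = L.AMap_in_hom[OF R.AMap_in_hom[OF h]] and Ln = L.AMap_in_hom[OF n1[OF A]]
      note LA = L.OMap_in_Obj[OF A] and B = L.D.homD(5)[OF h]
      have "\<epsilon> B \<cdot>\<^bsub>D\<^esub> AMap L (AMap R h \<cdot>\<^bsub>C\<^esub> \<eta> A) = (\<epsilon> B \<cdot>\<^bsub>D\<^esub> AMap L (AMap R h)) \<cdot>\<^bsub>D\<^esub> AMap L (\<eta> A)"
        using L.AMap_Comp[OF n1[OF A] R.AMap_in_hom[OF h]] L.D.hom_assoc[OF Ln LRh e1[OF B]] by simp
      also have "\<dots> = h \<cdot>\<^bsub>D\<^esub> (\<epsilon> (OMap L A) \<cdot>\<^bsub>D\<^esub> AMap L (\<eta> A))"
        using e2[OF h] L.D.hom_assoc[OF Ln e1[OF LA] h] by simp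
      also have "\<dots> = h" using t1[OF A] L.D.hom_Id(1)[OF h] by simp
      finally show ?thesis .
    qed
    show "g = g'" using r[OF g, unfolded eq] r[OF g'] by simp
  qed
qed

lemma hom_Sets: "hom Sets X Y = {Arrow X f Y |f. small X \<and> small Y \<and> f \<in> X \<rightarrow>\<^sub>E Y}"
  by (auto simp: hom_def Sets_def)

lemma Obj_Sets: "Obj Sets = {X. small X}"
  by (simp add: Sets_def)

lemma Comp_Sets: "Arrow Y g Z \<cdot>\<^bsub>Sets\<^esub> Arrow X f W = Arrow X (\<lambda>x\<in>X. g (f x)) Z"
  by (simp add: Sets_def)

lemma inclusion_in_hom: "small X \<Longrightarrow> small Y \<Longrightarrow> X \<subseteq> Y \<Longrightarrow> inclusion X Y \<in> hom Sets X Y"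
  by (auto simp: hom_Sets inclusion_def)

text \<open>\<open>K\<close> assigns to an object its set of components, \<open>D\<close> is the
  inverse image and \<open>R\<close> the direct image. Local connectedness supplies the first
  adjunction, the geometric morphism the second, and connectedness of the topos the full
  faithfulness.\<close>

locale constant_objects = topos_sections E C J Sec res app
  for E :: "('o, 'a) category" and C :: "('u, 'u) category" and J Sec res app +
  fixes K :: "('o, 'a, 'u set, 'u map) cfunctor" and D :: "('u set, 'u map, 'o, 'a) cfunctor"
    and R :: "('o, 'a, 'u set, 'u map) cfunctor"
  assumes components: "adjoint_functors E Sets K D"
    and global: "adjoint_functors Sets E D R"
    and ff: "fully_faithful Sets E D"
begin

sublocale D: cfunctor Sets E D using ff by (simp add: fully_faithful_def)

abbreviation const :: "'u set \<Rightarrow> 'o" ("\<Delta>") where "\<Delta> \<equiv> OMap D"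

lemma const_Obj: "small H \<Longrightarrow> \<Delta> H \<in> Obj E"
  using D.OMap_in_Obj by (simp add: Obj_Sets)

lemma K_small: "X \<in> Obj E \<Longrightarrow> small (OMap K X)"
  using components cfunctor.OMap_in_Obj[of E Sets K X] by (simp add: adjoint_functors_def Obj_Sets)

lemma const_map_in: "small H \<Longrightarrow> small H' \<Longrightarrow> \<phi> \<in> H \<rightarrow>\<^sub>E H' \<Longrightarrow> AMap D (Arrow H \<phi> H') \<in> hom E (\<Delta> H) (\<Delta> H')"
  by (rule D.AMap_in_hom) (auto simp: hom_Sets)

lemma components_transpose:
  obtains \<eta> where "\<And>X. X \<in> Obj E \<Longrightarrow> \<eta> X \<in> hom E X (\<Delta> (OMap K X))"
    "\<And>X H f. small H \<Longrightarrow> f \<in> hom E X (\<Delta> H) \<Longrightarrow>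
      \<exists>\<phi> \<in> OMap K X \<rightarrow>\<^sub>E H. AMap D (Arrow (OMap K X) \<phi> H) \<cdot>\<^bsub>E\<^esub> \<eta> X = f"
    "\<And>X H \<phi> \<psi>. X \<in> Obj E \<Longrightarrow> small H \<Longrightarrow> \<phi> \<in> OMap K X \<rightarrow>\<^sub>E H \<Longrightarrow> \<psi> \<in> OMap K X \<rightarrow>\<^sub>E H \<Longrightarrow>
      AMap D (Arrow (OMap K X) \<phi> H) \<cdot>\<^bsub>E\<^esub> \<eta> X = AMap D (Arrow (OMap K X) \<psi> H) \<cdot>\<^bsub>E\<^esub> \<eta> X \<Longrightarrow> \<phi> = \<psi>"
proof (rule adjoint_transpose[OF components])
  fix \<eta> assume n: "\<And>X. X \<in> Obj E \<Longrightarrow> \<eta> X \<in> hom E X (\<Delta> (OMap K X))"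
    and ex: "\<And>X H f. H \<in> Obj Sets \<Longrightarrow> f \<in> hom E X (\<Delta> H) \<Longrightarrow> \<exists>g \<in> hom Sets (OMap K X) H. AMap D g \<cdot>\<^bsub>E\<^esub> \<eta> X = f"
    and un: "\<And>X H g g'. X \<in> Obj E \<Longrightarrow> g \<in> hom Sets (OMap K X) H \<Longrightarrow> g' \<in> hom Sets (OMap K X) H \<Longrightarrow>
      AMap D g \<cdot>\<^bsub>E\<^esub> \<eta> X = AMap D g' \<cdot>\<^bsub>E\<^esub> \<eta> X \<Longrightarrow> g = g'"
  show thesis
  proof (rule that[OF n])
    show "\<exists>\<phi> \<in> OMap K X \<rightarrow>\<^sub>E H. AMap D (Arrow (OMap K X) \<phi> H) \<cdot>\<^bsub>E\<^esub> \<eta> X = f"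
      if "small H" "f \<in> hom E X (\<Delta> H)" for X H f
      using ex[OF _ that(2)] that(1) by (auto simp: Obj_Sets hom_Sets)
    show "\<phi> = \<psi>" if "X \<in> Obj E" "small H" "\<phi> \<in> OMap K X \<rightarrow>\<^sub>E H" "\<psi> \<in> OMap K X \<rightarrow>\<^sub>E H"
      "AMap D (Arrow (OMap K X) \<phi> H) \<cdot>\<^bsub>E\<^esub> \<eta> X = AMap D (Arrow (OMap K X) \<psi> H) \<cdot>\<^bsub>E\<^esub> \<eta> X" for X H \<phi> \<psi>
      using un[OF that(1) _ _ that(5)] K_small[OF that(1)] that(2-4) by (simp add: hom_Sets)
  qed
qed

text \<open>Transposition along the adjunction of \<open>D\<close> and \<open>R\<close> turns arrows
  out of a constant object into functions on \<open>H\<close>, and functions are determined by their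
  values at points.\<close>

lemma const_jointly_epi:
  assumes H: "small H" and f: "f \<in> hom E (\<Delta> H) Z" and g: "g \<in> hom E (\<Delta> H) Z"
    and eq: "\<And>h. h \<in> H \<Longrightarrow> f \<cdot>\<^bsub>E\<^esub> AMap D (inclusion {h} H) = g \<cdot>\<^bsub>E\<^esub> AMap D (inclusion {h} H)"
  shows "f = g"
proof (rule adjoint_transpose[OF global])
  fix \<eta> assume n: "\<And>A. A \<in> Obj Sets \<Longrightarrow> \<eta> A \<in> hom Sets A (OMap R (\<Delta> A))"
    and nat: "\<And>A B f. f \<in> hom Sets A B \<Longrightarrow> \<eta> B \<cdot>\<^bsub>Sets\<^esub> f = AMap R (AMap D f) \<cdot>\<^bsub>Sets\<^esub> \<eta> A"
    and un: "\<And>A B g g'. A \<in> Obj Sets \<Longrightarrow> g \<in> hom E (\<Delta> A) B \<Longrightarrow> g' \<in> hom E (\<Delta> A) B \<Longrightarrow>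
      AMap R g \<cdot>\<^bsub>Sets\<^esub> \<eta> A = AMap R g' \<cdot>\<^bsub>Sets\<^esub> \<eta> A \<Longrightarrow> g = g'"
  interpret R: cfunctor E Sets R using global by (simp add: adjoint_functors_def)
  have HO: "H \<in> Obj Sets" using H by (simp add: Obj_Sets)
  have inc: "inclusion {h} H \<in> hom Sets {h} H" if "h \<in> H" for h
    using that H by (intro inclusion_in_hom) (auto simp: small_singleton)
  have t: "AMap R (u \<cdot>\<^bsub>E\<^esub> AMap D (inclusion {h} H)) \<cdot>\<^bsub>Sets\<^esub> \<eta> {h} = (AMap R u \<cdot>\<^bsub>Sets\<^esub> \<eta> H) \<cdot>\<^bsub>Sets\<^esub> inclusion {h} H"
    if u: "u \<in> hom E (\<Delta> H) Z" and h: "h \<in> H" for u h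
  proof -
    note Di = D.AMap_in_hom[OF inc[OF h]] and i = inc[OF h]
    have "{h} \<in> Obj Sets" by (simp add: Obj_Sets small_singleton)
    note s = n[OF this]
    show ?thesis
      using R.AMap_Comp[OF Di u] D.C.hom_assoc[OF s R.AMap_in_hom[OF Di] R.AMap_in_hom[OF u]]
        nat[OF i] D.C.hom_assoc[OF i n[OF HO] R.AMap_in_hom[OF u]] by simp
  qed
  have "AMap R f \<cdot>\<^bsub>Sets\<^esub> \<eta> H = AMap R g \<cdot>\<^bsub>Sets\<^esub> \<eta> H"
  proof -
    have fh: "AMap R f \<cdot>\<^bsub>Sets\<^esub> \<eta> H \<in> hom Sets H (OMap R Z)" "AMap R g \<cdot>\<^bsub>Sets\<^esub> \<eta> H \<in> hom Sets H (OMap R Z)"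
      using D.C.Comp_in_hom[OF n[OF HO]] R.AMap_in_hom[OF f] R.AMap_in_hom[OF g] by auto
    then obtain a b where a: "AMap R f \<cdot>\<^bsub>Sets\<^esub> \<eta> H = Arrow H a (OMap R Z)" "a \<in> H \<rightarrow>\<^sub>E OMap R Z"
      and b: "AMap R g \<cdot>\<^bsub>Sets\<^esub> \<eta> H = Arrow H b (OMap R Z)" "b \<in> H \<rightarrow>\<^sub>E OMap R Z" by (auto simp: hom_Sets)
    have "a h = b h" if h: "h \<in> H" for h
    proof -
      have "Arrow H a (OMap R Z) \<cdot>\<^bsub>Sets\<^esub> inclusion {h} H = Arrow H b (OMap R Z) \<cdot>\<^bsub>Sets\<^esub> inclusion {h} H"
        using t[OF f h] t[OF g h] eq[OF h] a(1) b(1) by simp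
      from arg_cong[OF this, of "\<lambda>w. rule w h"] show ?thesis by (simp add: inclusion_def Comp_Sets)
    qed
    then have "a = b" using a(2) b(2) by (intro PiE_ext) auto
    then show ?thesis using a(1) b(1) by simp
  qed
  then show "f = g" by (rule un[OF HO f g])
qed

text \<open>Each arrow \<open>r h\<close> transposes to an element of \<open>R\<close> applied to
  \<open>Z\<close>; these elements form a function on \<open>H\<close>, whose transpose is the
  required arrow. Together with joint epimorphy this exhibits the constant object as the coproduct
  of its points.\<close>

lemma const_copair:
  assumes H: "small H" and Z: "Z \<in> Obj E" and r: "\<And>h. h \<in> H \<Longrightarrow> r h \<in> hom E (\<Delta> {h}) Z"
  shows "\<exists>m \<in> hom E (\<Delta> H) Z. \<forall>h \<in> H. m \<cdot>\<^bsub>E\<^esub> AMap D (inclusion {h} H) = r h"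
proof (rule adjoint_transpose[OF global])
  fix \<eta> assume n: "\<And>A. A \<in> Obj Sets \<Longrightarrow> \<eta> A \<in> hom Sets A (OMap R (\<Delta> A))"
    and nat: "\<And>A B f. f \<in> hom Sets A B \<Longrightarrow> \<eta> B \<cdot>\<^bsub>Sets\<^esub> f = AMap R (AMap D f) \<cdot>\<^bsub>Sets\<^esub> \<eta> A"
    and ex: "\<And>A B f. B \<in> Obj E \<Longrightarrow> f \<in> hom Sets A (OMap R B) \<Longrightarrow> \<exists>g \<in> hom E (\<Delta> A) B. AMap R g \<cdot>\<^bsub>Sets\<^esub> \<eta> A = f"
    and un: "\<And>A B g g'. A \<in> Obj Sets \<Longrightarrow> g \<in> hom E (\<Delta> A) B \<Longrightarrow> g' \<in> hom E (\<Delta> A) B \<Longrightarrow>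
      AMap R g \<cdot>\<^bsub>Sets\<^esub> \<eta> A = AMap R g' \<cdot>\<^bsub>Sets\<^esub> \<eta> A \<Longrightarrow> g = g'"
  interpret R: cfunctor E Sets R using global by (simp add: adjoint_functors_def)
  have HO: "H \<in> Obj Sets" using H by (simp add: Obj_Sets)
  have RZ: "small (OMap R Z)" using R.OMap_in_Obj[OF Z] by (simp add: Obj_Sets)
  have sO: "{h} \<in> Obj Sets" for h :: 'u by (simp add: Obj_Sets small_singleton)
  have inc: "inclusion {h} H \<in> hom Sets {h} H" if "h \<in> H" for h
    using that H by (intro inclusion_in_hom) (auto simp: small_singleton)
  have "\<forall>h \<in> H. \<exists>b. b \<in> OMap R Z \<and> AMap R (r h) \<cdot>\<^bsub>Sets\<^esub> \<eta> {h} = Arrow {h} (\<lambda>x\<in>{h}. b) (OMap R Z)"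
  proof
    fix h assume h: "h \<in> H"
    obtain a where a: "a \<in> {h} \<rightarrow>\<^sub>E OMap R Z" "AMap R (r h) \<cdot>\<^bsub>Sets\<^esub> \<eta> {h} = Arrow {h} a (OMap R Z)"
      using D.C.Comp_in_hom[OF n[OF sO] R.AMap_in_hom[OF r[OF h]]] by (auto simp: hom_Sets)
    then have "a = (\<lambda>x\<in>{h}. a h)" by (auto simp: PiE_def extensional_def)
    then show "\<exists>b. b \<in> OMap R Z \<and> AMap R (r h) \<cdot>\<^bsub>Sets\<^esub> \<eta> {h} = Arrow {h} (\<lambda>x\<in>{h}. b) (OMap R Z)"
      using a by (intro exI[of _ "a h"]) auto
  qed
  from bchoice[OF this] obtain b where b: "\<And>h. h \<in> H \<Longrightarrow> b h \<in> OMap R Z"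
    "\<And>h. h \<in> H \<Longrightarrow> AMap R (r h) \<cdot>\<^bsub>Sets\<^esub> \<eta> {h} = Arrow {h} (\<lambda>x\<in>{h}. b h) (OMap R Z)" by blast
  have "Arrow H (\<lambda>h\<in>H. b h) (OMap R Z) \<in> hom Sets H (OMap R Z)" using b(1) H RZ by (auto simp: hom_Sets)
  then obtain m where m: "m \<in> hom E (\<Delta> H) Z" "AMap R m \<cdot>\<^bsub>Sets\<^esub> \<eta> H = Arrow H (\<lambda>h\<in>H. b h) (OMap R Z)"
    using ex[OF Z] by blast
  have "m \<cdot>\<^bsub>E\<^esub> AMap D (inclusion {h} H) = r h" if h: "h \<in> H" for h
  proof (rule un[OF sO _ r[OF h]])
    note Di = D.AMap_in_hom[OF inc[OF h]] and i = inc[OF h]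
    show "m \<cdot>\<^bsub>E\<^esub> AMap D (inclusion {h} H) \<in> hom E (\<Delta> {h}) Z" by (rule E.Comp_in_hom[OF Di m(1)])
    have "AMap R (m \<cdot>\<^bsub>E\<^esub> AMap D (inclusion {h} H)) \<cdot>\<^bsub>Sets\<^esub> \<eta> {h} = (AMap R m \<cdot>\<^bsub>Sets\<^esub> \<eta> H) \<cdot>\<^bsub>Sets\<^esub> inclusion {h} H"
      using R.AMap_Comp[OF Di m(1)] D.C.hom_assoc[OF n[OF sO] R.AMap_in_hom[OF Di] R.AMap_in_hom[OF m(1)]]
        nat[OF i] D.C.hom_assoc[OF i n[OF HO] R.AMap_in_hom[OF m(1)]] by simp
    also have "\<dots> = Arrow {h} (\<lambda>x\<in>{h}. b h) (OMap R Z)"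
      using h unfolding m(2) inclusion_def Comp_Sets by (auto intro!: restrict_ext)
    finally show "AMap R (m \<cdot>\<^bsub>E\<^esub> AMap D (inclusion {h} H)) \<cdot>\<^bsub>Sets\<^esub> \<eta> {h} = AMap R (r h) \<cdot>\<^bsub>Sets\<^esub> \<eta> {h}"
      using b(2)[OF h] by simp
  qed
  with m(1) show ?thesis by blast
qed

text \<open>By the left adjoint, arrows into this object correspond to functions into a singleton,
  of which there is exactly one.\<close>

lemma const_singleton_terminal: "terminal E (\<Delta> {h})"
  unfolding terminal_def
proof (intro conjI ballI ex_ex1I)
  show O: "\<Delta> {h} \<in> Obj E" by (rule const_Obj[OF small_singleton])
  fix X assume X: "X \<in> Obj E"
  obtain \<eta> where n: "\<And>X. X \<in> Obj E \<Longrightarrow> \<eta> X \<in> hom E X (\<Delta> (OMap K X))"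
    and ex: "\<And>X H f. small H \<Longrightarrow> f \<in> hom E X (\<Delta> H) \<Longrightarrow>
      \<exists>\<phi> \<in> OMap K X \<rightarrow>\<^sub>E H. AMap D (Arrow (OMap K X) \<phi> H) \<cdot>\<^bsub>E\<^esub> \<eta> X = f"
    by (rule components_transpose) blast
  have "(\<lambda>x\<in>OMap K X. h) \<in> OMap K X \<rightarrow>\<^sub>E {h}" by auto
  then show "\<exists>f. f \<in> hom E X (\<Delta> {h})"
    using E.Comp_in_hom[OF n[OF X] const_map_in[OF K_small[OF X] small_singleton]] by blast
  fix f g assume fg: "f \<in> hom E X (\<Delta> {h})" "g \<in> hom E X (\<Delta> {h})"
  obtain \<phi> \<psi> where \<phi>: "\<phi> \<in> OMap K X \<rightarrow>\<^sub>E {h}" "AMap D (Arrow (OMap K X) \<phi> {h}) \<cdot>\<^bsub>E\<^esub> \<eta> X = f"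
    and \<psi>: "\<psi> \<in> OMap K X \<rightarrow>\<^sub>E {h}" "AMap D (Arrow (OMap K X) \<psi> {h}) \<cdot>\<^bsub>E\<^esub> \<eta> X = g"
    using ex[OF small_singleton fg(1)] ex[OF small_singleton fg(2)] by blast
  have "\<phi> = \<psi>" using \<phi>(1) \<psi>(1) by (intro PiE_ext) auto
  then show "f = g" using \<phi> \<psi> by simp
qed

text \<open>This is the coproduct description of constant objects over the empty index set.\<close>

lemma const_empty: "empty_object (\<Delta> {})"
  unfolding initial_iff_empty[symmetric] initial_def
proof (intro conjI ballI ex_ex1I)
  have s: "small ({} :: 'u set)" by (rule small_subset[OF _ small_singleton]) simp
  show "\<Delta> {} \<in> Obj E" by (rule const_Obj[OF s])
  show "\<exists>f. f \<in> hom E (\<Delta> {}) X" if "X \<in> Obj E" for X using const_copair[OF s that] by auto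
  show "f = g" if "f \<in> hom E (\<Delta> {}) X" "g \<in> hom E (\<Delta> {}) X" for X f g
    using const_jointly_epi[OF s that] by simp
qed

section \<open>Points of constant objects\<close>

text \<open>The global element named by \<open>h\<close>, evaluated at the stage \<open>c\<close>.
  The description operator is harmless because the constant object on a singleton is terminal, so it
  has exactly one section over \<open>c\<close>.\<close>

definition pt :: "'u set \<Rightarrow> 'u \<Rightarrow> 'u \<Rightarrow> 'u" where
  "pt H h c = app (AMap D (inclusion {h} H)) c (THE s. s \<in> Sec (\<Delta> {h}) c)"

lemma pt_eq:
  assumes "c \<in> Obj C" "s \<in> Sec (\<Delta> {h}) c" shows "app (AMap D (inclusion {h} H)) c s = pt H h c"
proof -
  have "(THE s. s \<in> Sec (\<Delta> {h}) c) = s"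
    using terminalD[OF const_singleton_terminal assms(1), of h] assms(2) by (intro the_equality) auto
  then show ?thesis by (simp add: pt_def)
qed

lemma singleton_section: "c \<in> Obj C \<Longrightarrow> \<exists>s. s \<in> Sec (\<Delta> {h}) c"
  using terminalD[OF const_singleton_terminal] by blast

lemma singleton_inclusion: "small H \<Longrightarrow> h \<in> H \<Longrightarrow> AMap D (inclusion {h} H) \<in> hom E (\<Delta> {h}) (\<Delta> H)"
  by (intro D.AMap_in_hom inclusion_in_hom small_singleton) auto

lemma pt_in: "small H \<Longrightarrow> h \<in> H \<Longrightarrow> c \<in> Obj C \<Longrightarrow> pt H h c \<in> Sec (\<Delta> H) c"
  using pt_eq singleton_section app_in[OF singleton_inclusion] by metis

lemma pt_res:
  assumes H: "small H" "h \<in> H" and k: "k \<in> hom C d c" shows "res (\<Delta> H) k (pt H h c) = pt H h d"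
proof -
  note c = homD(5)[OF k]
  obtain s where s: "s \<in> Sec (\<Delta> {h}) c" using singleton_section[OF c] by blast
  show ?thesis
    using app_res[OF singleton_inclusion[OF H] k s] pt_eq[OF c s]
      pt_eq[OF homD(4)[OF k] res_in[OF const_Obj[OF small_singleton] k s]] by simp
qed

lemma pt_map:
  assumes H: "small H" "h \<in> H" and H': "small H'" and f: "\<phi> \<in> H \<rightarrow>\<^sub>E H'" and c: "c \<in> Obj C"
  shows "app (AMap D (Arrow H \<phi> H')) c (pt H h c) = pt H' (\<phi> h) c"
proof -
  \<comment> \<open>\<open>?g\<close> carries the point \<open>h\<close> to the point
    \<open>\<phi> h\<close>, so that the square with the two inclusions commutes already in
    \<open>Sets\<close>.\<close>
  let ?g = "Arrow {h} (\<lambda>x\<in>{h}. \<phi> h) {\<phi> h}"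
  have g: "?g \<in> hom Sets {h} {\<phi> h}" by (auto simp: hom_Sets small_singleton)
  have fh: "Arrow H \<phi> H' \<in> hom Sets H H'" using assms by (auto simp: hom_Sets)
  have i: "inclusion {h} H \<in> hom Sets {h} H" using H by (intro inclusion_in_hom) (auto simp: small_singleton)
  have "\<phi> h \<in> H'" using f H by auto
  then have i': "inclusion {\<phi> h} H' \<in> hom Sets {\<phi> h} H'" using H' by (intro inclusion_in_hom) (auto simp: small_singleton)
  have "Arrow H \<phi> H' \<cdot>\<^bsub>Sets\<^esub> inclusion {h} H = inclusion {\<phi> h} H' \<cdot>\<^bsub>Sets\<^esub> ?g"
    unfolding inclusion_def Comp_Sets by (auto intro!: restrict_ext)
  then have eq: "AMap D (Arrow H \<phi> H') \<cdot>\<^bsub>E\<^esub> AMap D (inclusion {h} H) = AMap D (inclusion {\<phi> h} H') \<cdot>\<^bsub>E\<^esub> AMap D ?g"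
    using D.AMap_Comp[OF i fh] D.AMap_Comp[OF g i'] by simp
  obtain s where s: "s \<in> Sec (\<Delta> {h}) c" using singleton_section[OF c] by blast
  note a = D.AMap_in_hom
  show ?thesis
    using app_Comp[OF a[OF i] a[OF fh] c s] app_Comp[OF a[OF g] a[OF i'] c s] eq pt_eq[OF c s]
      pt_eq[OF c app_in[OF a[OF g] c s]] by simp
qed

text \<open>The locally constant sections form a subobject through which every point factors.
  Copairing the points maps the whole constant object into it, and by joint epimorphy this splits
  the inclusion; hence the subobject is everything.\<close>

lemma const_local:
  assumes H: "small H" and c: "c \<in> Obj C" and s: "s \<in> Sec (\<Delta> H) c"
  shows "locally c (\<lambda>d k. \<exists>h \<in> H. res (\<Delta> H) k s = pt H h d)"
proof -
  note O = const_Obj[OF H]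
  define P where "P c s \<longleftrightarrow> locally c (\<lambda>d k. \<exists>h \<in> H. res (\<Delta> H) k s = pt H h d)" for c s
  have "subsheaf (\<Delta> H) P"
    unfolding subsheaf_def
  proof (intro conjI ballI allI impI O)
    show st: "P d (res (\<Delta> H) k x)" if x: "x \<in> Sec (\<Delta> H) c" and k: "k \<in> hom C d c" and P: "P c x" for c d k x
      unfolding P_def
      by (rule locally_mono[OF homD(4)[OF k] locally_pullback[OF P[unfolded P_def] k]]) (simp add: res_comp[OF O k _ x])
    show "P c x" if c: "c \<in> Obj C" and x: "x \<in> Sec (\<Delta> H) c" and l: "locally c (\<lambda>d k. P d (res (\<Delta> H) k x))" for c x
      unfolding P_def
    proof (rule locally_trans[OF c l])
      fix d k assume k: "k \<in> hom C d c" and P: "P d (res (\<Delta> H) k x)"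
      show "locally d (\<lambda>e l. \<exists>h \<in> H. res (\<Delta> H) (k \<cdot>\<^bsub>C\<^esub> l) x = pt H h e)"
        using P unfolding P_def by (rule locally_mono[OF homD(4)[OF k]]) (simp add: res_comp[OF O k _ x])
    qed
  qed
  then obtain Y i where i: "i \<in> hom E Y (\<Delta> H)" and inj: "\<And>c. c \<in> Obj C \<Longrightarrow> inj_on (app i c) (Sec Y c)"
    and im: "\<And>c. c \<in> Obj C \<Longrightarrow> app i c ` Sec Y c = {x \<in> Sec (\<Delta> H) c. P c x}"
    by (rule subobject) blast
  have "\<forall>h \<in> H. \<exists>r. r \<in> hom E (\<Delta> {h}) Y \<and> i \<cdot>\<^bsub>E\<^esub> r = AMap D (inclusion {h} H)"
  proof
    fix h assume h: "h \<in> H"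
    show "\<exists>r. r \<in> hom E (\<Delta> {h}) Y \<and> i \<cdot>\<^bsub>E\<^esub> r = AMap D (inclusion {h} H)"
    proof (rule lift[OF i inj singleton_inclusion[OF H h]])
    show "app (AMap D (inclusion {h} H)) c z \<in> app i c ` Sec Y c" if c: "c \<in> Obj C" and z: "z \<in> Sec (\<Delta> {h}) c" for c z
      unfolding im[OF c] pt_eq[OF c z] P_def
      using pt_in[OF H h c] pt_res[OF H h] h by (auto intro!: locallyI[OF c])
    qed blast+
  qed
  from bchoice[OF this] obtain r where r: "\<And>h. h \<in> H \<Longrightarrow> r h \<in> hom E (\<Delta> {h}) Y"
    "\<And>h. h \<in> H \<Longrightarrow> i \<cdot>\<^bsub>E\<^esub> r h = AMap D (inclusion {h} H)" by blast
  obtain m where m: "m \<in> hom E (\<Delta> H) Y" "\<And>h. h \<in> H \<Longrightarrow> m \<cdot>\<^bsub>E\<^esub> AMap D (inclusion {h} H) = r h"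
    using const_copair[OF H E.homD(4)[OF i] r(1)] by blast
  have im': "i \<cdot>\<^bsub>E\<^esub> m = Id E (\<Delta> H)"
  proof (rule const_jointly_epi[OF H E.Comp_in_hom[OF m(1) i] E.Id_in_hom[OF O]])
    show "(i \<cdot>\<^bsub>E\<^esub> m) \<cdot>\<^bsub>E\<^esub> AMap D (inclusion {h} H) = Id E (\<Delta> H) \<cdot>\<^bsub>E\<^esub> AMap D (inclusion {h} H)" if h: "h \<in> H" for h
      using E.hom_assoc[OF singleton_inclusion[OF H h] m(1) i] m(2)[OF h] r(2)[OF h]
        E.hom_Id(2)[OF singleton_inclusion[OF H h]] by simp
  qed
  have "s = app i c (app m c s)" using app_Comp[OF m(1) i c s] im' app_Id[OF O c s] by simp
  then have "s \<in> app i c ` Sec Y c" using app_in[OF m(1) c s] by blast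
  then show ?thesis using im[OF c] by (simp add: P_def)
qed

text \<open>Let \<open>U\<close> be the part of the terminal object where the two points agree. The
  two constant arrows on \<open>U\<close> coincide, so by the left adjoint the constant functions
  \<open>h\<close> and \<open>h'\<close> on the components of \<open>U\<close> coincide. If
  \<open>h\<close> and \<open>h'\<close> differ, \<open>U\<close> has no components and maps to the
  initial object, so its sections lie over degenerate stages.\<close>

lemma pt_inj:
  assumes H: "small H" and h: "h \<in> H" "h' \<in> H" and c: "c \<in> Obj C" and eq: "pt H h c = pt H h' c"
  shows "h = h' \<or> degenerate c"
proof (rule disjCI)
  assume nd: "\<not> degenerate c"
  obtain \<eta> where n: "\<And>X. X \<in> Obj E \<Longrightarrow> \<eta> X \<in> hom E X (\<Delta> (OMap K X))"
    and ex: "\<And>X H f. small H \<Longrightarrow> f \<in> hom E X (\<Delta> H) \<Longrightarrow>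
      \<exists>\<phi> \<in> OMap K X \<rightarrow>\<^sub>E H. AMap D (Arrow (OMap K X) \<phi> H) \<cdot>\<^bsub>E\<^esub> \<eta> X = f"
    and un: "\<And>X H \<phi> \<psi>. X \<in> Obj E \<Longrightarrow> small H \<Longrightarrow> \<phi> \<in> OMap K X \<rightarrow>\<^sub>E H \<Longrightarrow> \<psi> \<in> OMap K X \<rightarrow>\<^sub>E H \<Longrightarrow>
      AMap D (Arrow (OMap K X) \<phi> H) \<cdot>\<^bsub>E\<^esub> \<eta> X = AMap D (Arrow (OMap K X) \<psi> H) \<cdot>\<^bsub>E\<^esub> \<eta> X \<Longrightarrow> \<phi> = \<psi>"
    by (rule components_transpose) blast
  have O: "\<Delta> {h} \<in> Obj E" by (rule const_Obj[OF small_singleton])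
  note HO = const_Obj[OF H]
  have "subsheaf (\<Delta> {h}) (\<lambda>d x. pt H h d = pt H h' d)"
    unfolding subsheaf_def
  proof (intro conjI ballI allI impI O)
    show "pt H h d = pt H h' d" if "k \<in> hom C d c" "pt H h c = pt H h' c" for c d k
      using pt_res[OF H h(1) that(1)] pt_res[OF H h(2) that(1)] that(2) by simp
    show "pt H h c = pt H h' c" if c: "c \<in> Obj C" and l: "locally c (\<lambda>d k. pt H h d = pt H h' d)" for c
      by (rule separated[OF HO c pt_in[OF H h(1) c] pt_in[OF H h(2) c]], rule locally_mono[OF c l])
        (simp add: pt_res[OF H h(1)] pt_res[OF H h(2)])
  qed
  then obtain U i where i: "i \<in> hom E U (\<Delta> {h})"
    and im: "\<And>c. c \<in> Obj C \<Longrightarrow> app i c ` Sec U c = {x \<in> Sec (\<Delta> {h}) c. pt H h c = pt H h' c}"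
    by (rule subobject) blast
  note U = E.homD(4)[OF i]
  obtain j where j: "j \<in> hom E U (\<Delta> {h'})"
    using const_singleton_terminal[of h'] U unfolding terminal_def by blast
  note i1 = singleton_inclusion[OF H h(1)] and j1 = singleton_inclusion[OF H h(2)]
  have ij: "AMap D (inclusion {h} H) \<cdot>\<^bsub>E\<^esub> i = AMap D (inclusion {h'} H) \<cdot>\<^bsub>E\<^esub> j"
  proof (rule faithful[OF E.Comp_in_hom[OF i i1] E.Comp_in_hom[OF j j1]])
    fix c x assume c: "c \<in> Obj C" and x: "x \<in> Sec U c"
    have "pt H h c = pt H h' c" using im[OF c] x by blast
    then show "app (AMap D (inclusion {h} H) \<cdot>\<^bsub>E\<^esub> i) c x = app (AMap D (inclusion {h'} H) \<cdot>\<^bsub>E\<^esub> j) c x"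
      using app_Comp[OF i i1 c x] app_Comp[OF j j1 c x] pt_eq[OF c app_in[OF i c x]] pt_eq[OF c app_in[OF j c x]] by simp
  qed
  let ?KU = "OMap K U"
  note KU = K_small[OF U]
  \<comment> \<open>An arrow that factors through one point transposes to the constant function with
    that value.\<close>
  have tr: "AMap D (inclusion {g} H) \<cdot>\<^bsub>E\<^esub> u = AMap D (Arrow ?KU (\<lambda>x\<in>?KU. g) H) \<cdot>\<^bsub>E\<^esub> \<eta> U"
    if g: "g \<in> H" and u: "u \<in> hom E U (\<Delta> {g})" for g u
  proof -
    obtain \<phi> where \<phi>: "\<phi> \<in> ?KU \<rightarrow>\<^sub>E {g}" "AMap D (Arrow ?KU \<phi> {g}) \<cdot>\<^bsub>E\<^esub> \<eta> U = u"
      using ex[OF small_singleton u] by blast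
    have f: "Arrow ?KU \<phi> {g} \<in> hom Sets ?KU {g}" using \<phi>(1) KU small_singleton by (auto simp: hom_Sets)
    have ig: "inclusion {g} H \<in> hom Sets {g} H" using g H by (intro inclusion_in_hom) (auto simp: small_singleton)
    have "inclusion {g} H \<cdot>\<^bsub>Sets\<^esub> Arrow ?KU \<phi> {g} = Arrow ?KU (\<lambda>x\<in>?KU. g) H"
      unfolding inclusion_def Comp_Sets using \<phi>(1) by (auto intro!: restrict_ext)
    then show ?thesis
      using D.AMap_Comp[OF f ig] E.hom_assoc[OF n[OF U] D.AMap_in_hom[OF f] D.AMap_in_hom[OF ig]] \<phi>(2) by simp
  qed
  have "(\<lambda>x\<in>?KU. h) = (\<lambda>x\<in>?KU. h')" (is ?eq)
    using tr[OF h(1) i] tr[OF h(2) j] ij h by (intro un[OF U H]) auto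
  from fun_cong[OF this] have hh: "h = h'" if "x \<in> ?KU" for x using that by (metis restrict_apply')
  show "h = h'"
  proof (rule ccontr)
    assume "h \<noteq> h'"
    then have "?KU = {}" using hh by blast
    then have "empty_object U" using empty_object_arrow[OF n[OF U]] const_empty by simp
    moreover obtain s where "s \<in> Sec (\<Delta> {h}) c" using singleton_section[OF c] by blast
    then have "Sec U c \<noteq> {}" using im[OF c] eq by blast
    ultimately show False using nd c by (simp add: empty_object_def)
  qed
qed

lemma ex_two: "\<exists>a b :: 'u. a \<noteq> b"
proof (rule ccontr)
  assume "\<not> ?thesis"
  then have "(UNIV :: 'u set) \<subseteq> {undefined}" by auto
  then show False using infinite_univ finite_subset by blast
qed

lemma small_two: "small {a, b :: 'u}"
  by (simp add: small_def finite_lesspoll_infinite[OF infinite_univ])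

lemma D_faithful: "f \<in> hom Sets X Y \<Longrightarrow> g \<in> hom Sets X Y \<Longrightarrow> AMap D f = AMap D g \<Longrightarrow> f = g"
  using ff D.C.homD(4,5) unfolding fully_faithful_def bij_betw_def by (metis inj_onD)

text \<open>If all stages were degenerate, parallel arrows would coincide, contrary to the
  faithfulness of \<open>D\<close> on the two maps from a point to a two-element set.\<close>

lemma ex_nondegenerate: "\<exists>c \<in> Obj C. \<not> degenerate c"
proof (rule ccontr)
  assume "\<not> ?thesis"
  then have d: "degenerate c" if "c \<in> Obj C" for c using that by blast
  obtain a b :: 'u where ab: "a \<noteq> b" using ex_two by blast
  let ?f = "\<lambda>x. Arrow {a} (\<lambda>y\<in>{a}. x) {a, b}"
  have f: "?f x \<in> hom Sets {a} {a, b}" if "x \<in> {a, b}" for x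
    using that by (auto simp: hom_Sets small_two small_singleton)
  have "AMap D (?f a) = AMap D (?f b)"
  proof (rule faithful[OF D.AMap_in_hom[OF f] D.AMap_in_hom[OF f]])
    fix c x assume c: "c \<in> Obj C" and x: "x \<in> Sec (\<Delta> {a}) c"
    show "app (AMap D (?f a)) c x = app (AMap D (?f b)) c x"
      by (rule degenerate_eq[OF const_Obj[OF small_two] c d[OF c]]; rule app_in[OF D.AMap_in_hom[OF f] c x]) auto
  qed auto
  then have "?f a = ?f b" by (intro D_faithful[OF f f]) auto
  from arg_cong[OF this, of "\<lambda>w. rule w a"] show False using ab by simp
qed

text \<open>By fullness of \<open>D\<close> the arrow comes from a function on a singleton. This is
  the connectedness of the terminal object.\<close>

lemma terminal_const:
  assumes T: "terminal E T" and H: "small H" and f: "f \<in> hom E T (\<Delta> H)"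
  obtains h where "h \<in> H" "\<And>c x. c \<in> Obj C \<Longrightarrow> x \<in> Sec T c \<Longrightarrow> app f c x = pt H h c"
proof -
  let ?a = "undefined :: 'u"
  have O: "\<Delta> {?a} \<in> Obj E" by (rule const_Obj[OF small_singleton])
  obtain g where g: "g \<in> hom E (\<Delta> {?a}) T" using T O unfolding terminal_def by blast
  have "bij_betw (AMap D) (hom Sets {?a} H) (hom E (\<Delta> {?a}) (\<Delta> H))"
    using ff H small_singleton by (auto simp: fully_faithful_def Obj_Sets)
  then have "f \<cdot>\<^bsub>E\<^esub> g \<in> AMap D ` hom Sets {?a} H" using E.Comp_in_hom[OF g f] by (simp add: bij_betw_def)
  then obtain \<phi> where \<phi>: "\<phi> \<in> {?a} \<rightarrow>\<^sub>E H" "f \<cdot>\<^bsub>E\<^esub> g = AMap D (Arrow {?a} \<phi> H)" by (auto simp: hom_Sets)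
  show thesis
  proof (rule that)
    show "\<phi> ?a \<in> H" using \<phi>(1) by auto
    fix c x assume c: "c \<in> Obj C" and x: "x \<in> Sec T c"
    have p: "pt {?a} ?a c \<in> Sec (\<Delta> {?a}) c" using pt_in[OF small_singleton _ c] by simp
    have "x = app g c (pt {?a} ?a c)" using terminalD[OF T c] x app_in[OF g c p] by auto
    then show "app f c x = pt H (\<phi> ?a) c"
      using app_Comp[OF g f c p] \<phi>(2) pt_map[OF small_singleton _ H \<phi>(1) c, of ?a] by simp
  qed
qed

end

section \<open>Connected objects and components\<close>

context topos_sections
begin

text \<open>The two arrows to be copaired define a relation that is locally total because the pieces
  cover, and functional because they meet only over degenerate stages.\<close>

lemma complementary_coproduct:
  assumes i: "i \<in> hom E Y X" and j: "j \<in> hom E Z X"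
    and i1: "\<And>c. c \<in> Obj C \<Longrightarrow> inj_on (app i c) (Sec Y c)"
    and j1: "\<And>c. c \<in> Obj C \<Longrightarrow> inj_on (app j c) (Sec Z c)"
    and dis: "\<And>c y z. c \<in> Obj C \<Longrightarrow> y \<in> Sec Y c \<Longrightarrow> z \<in> Sec Z c \<Longrightarrow> app i c y = app j c z \<Longrightarrow> degenerate c"
    and cov: "\<And>c x. c \<in> Obj C \<Longrightarrow> x \<in> Sec X c \<Longrightarrow>
      locally c (\<lambda>d k. res X k x \<in> app i d ` Sec Y d \<union> app j d ` Sec Z d)"
  shows "is_coproduct E Y Z X i j"
  unfolding is_coproduct_def
proof (intro conjI ballI i j ex_ex1I)
  note Y = E.homD(4)[OF i] and Z = E.homD(4)[OF j] and X = E.homD(5)[OF i]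
  fix W u v assume W: "W \<in> Obj E" and u: "u \<in> hom E Y W" and v: "v \<in> hom E Z W"
  let ?R = "\<lambda>c x w. (\<exists>y \<in> Sec Y c. app i c y = x \<and> app u c y = w) \<or> (\<exists>z \<in> Sec Z c. app j c z = x \<and> app v c z = w)"
  have "\<exists>f \<in> hom E X W. \<forall>c x w. c \<in> Obj C \<longrightarrow> x \<in> Sec X c \<longrightarrow> ?R c x w \<longrightarrow> app f c x = w"
  proof (rule arrow_by_relation[OF X W])
    show cl: "w \<in> Sec W c" if "c \<in> Obj C" "?R c x w" for c x w using that app_in[OF u] app_in[OF v] by blast
    show "w = w'" if c: "c \<in> Obj C" and w: "?R c x w" and w': "?R c x w'" for c x w w'
    proof (cases "degenerate c")
      case True then show ?thesis using degenerate_eq[OF W c] cl[OF c w] cl[OF c w'] by blast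
    next
      case False
      consider y y' where "y \<in> Sec Y c" "y' \<in> Sec Y c" "app i c y = x" "app i c y' = x" "app u c y = w" "app u c y' = w'"
        | z z' where "z \<in> Sec Z c" "z' \<in> Sec Z c" "app j c z = x" "app j c z' = x" "app v c z = w" "app v c z' = w'"
        using w w' dis[OF c] False by (metis (no_types, lifting))
      then show ?thesis
        by cases (use i1[OF c] j1[OF c] in \<open>metis inj_onD\<close>)+
    qed
    show "?R d (res X k x) (res W k w)" if k: "k \<in> hom C d c" and "?R c x w" for c d k x w
      using that(2) app_res[OF i k] app_res[OF j k] app_res[OF u k] app_res[OF v k] res_in[OF Y k] res_in[OF Z k]
      by metis
    show "locally c (\<lambda>d k. \<exists>w. ?R d (res X k x) w)" if "c \<in> Obj C" "x \<in> Sec X c" for c x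
      by (rule locally_mono[OF that(1) cov[OF that]]) force
  qed
  then obtain f where f: "f \<in> hom E X W"
    and fy: "\<And>c y. c \<in> Obj C \<Longrightarrow> y \<in> Sec Y c \<Longrightarrow> app f c (app i c y) = app u c y"
    and fz: "\<And>c z. c \<in> Obj C \<Longrightarrow> z \<in> Sec Z c \<Longrightarrow> app f c (app j c z) = app v c z"
    using app_in[OF i] app_in[OF j] by blast
  have "f \<cdot>\<^bsub>E\<^esub> i = u" "f \<cdot>\<^bsub>E\<^esub> j = v"
    using fy fz by (auto intro!: faithful[OF E.Comp_in_hom[OF i f] u] faithful[OF E.Comp_in_hom[OF j f] v]
        simp: app_Comp[OF i f] app_Comp[OF j f])
  then show "\<exists>m. m \<in> hom E X W \<and> m \<cdot>\<^bsub>E\<^esub> i = u \<and> m \<cdot>\<^bsub>E\<^esub> j = v" using f by blast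
  fix m m' assume m: "m \<in> hom E X W \<and> m \<cdot>\<^bsub>E\<^esub> i = u \<and> m \<cdot>\<^bsub>E\<^esub> j = v"
    and m': "m' \<in> hom E X W \<and> m' \<cdot>\<^bsub>E\<^esub> i = u \<and> m' \<cdot>\<^bsub>E\<^esub> j = v"
  then have mh: "m \<in> hom E X W" and mh': "m' \<in> hom E X W" by blast+
  show "m = m'"
  proof (rule faithful[OF mh mh'])
    fix c x assume c: "c \<in> Obj C" and x: "x \<in> Sec X c"
    show "app m c x = app m' c x"
    proof (rule separated[OF W c app_in[OF mh c x] app_in[OF mh' c x]], rule locally_mono[OF c cov[OF c x]])
      fix d k assume k: "k \<in> hom C d c" and r: "res X k x \<in> app i d ` Sec Y d \<union> app j d ` Sec Z d"
      note d = homD(4)[OF k]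
      have "app m d (res X k x) = app m' d (res X k x)"
        using r m m' app_Comp[OF i mh d] app_Comp[OF j mh d] app_Comp[OF i mh' d] app_Comp[OF j mh' d] by fastforce
      then show "res W k (app m c x) = res W k (app m' c x)" using app_res[OF mh k x] app_res[OF mh' k x] by simp
    qed
  qed
qed

end

context constant_objects
begin

text \<open>Constancy of all arrows to constant objects is the form of connectedness that the
  adjunctions can handle. It is proved equivalent to the one by coproduct decompositions.\<close>

definition sec_connected :: "'o \<Rightarrow> bool" where
  "sec_connected X \<longleftrightarrow> X \<in> Obj E \<and> \<not> empty_object X \<and>
    (\<forall>H f. small H \<longrightarrow> f \<in> hom E X (\<Delta> H) \<longrightarrow> (\<exists>h \<in> H. \<forall>c \<in> Obj C. \<forall>x \<in> Sec X c. app f c x = pt H h c))"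

lemma sec_connectedD:
  assumes "sec_connected X" "small H" "f \<in> hom E X (\<Delta> H)"
  obtains h where "h \<in> H" "\<And>c x. c \<in> Obj C \<Longrightarrow> x \<in> Sec X c \<Longrightarrow> app f c x = pt H h c"
  using assms unfolding sec_connected_def by blast

lemma nonempty_section:
  assumes "X \<in> Obj E" "\<not> empty_object X"
  obtains c x where "c \<in> Obj C" "\<not> degenerate c" "x \<in> Sec X c"
  using assms by (auto simp: empty_object_def)

lemma subsheaf_fibre:
  assumes H: "small H" "h \<in> H" and f: "f \<in> hom E X (\<Delta> H)"
  shows "subsheaf X (\<lambda>c x. app f c x = pt H h c)"
  unfolding subsheaf_def
proof (intro conjI ballI allI impI E.homD(4)[OF f])
  show "app f d (res X k x) = pt H h d" if "x \<in> Sec X c" "k \<in> hom C d c" "app f c x = pt H h c" for c d k x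
    using app_res[OF f that(2,1)] pt_res[OF H that(2)] that(3) by simp
  show "app f c x = pt H h c" if c: "c \<in> Obj C" and x: "x \<in> Sec X c"
    and l: "locally c (\<lambda>d k. app f d (res X k x) = pt H h d)" for c x
    by (rule separated[OF const_Obj[OF H(1)] c app_in[OF f c x] pt_in[OF H c]], rule locally_mono[OF c l])
      (simp add: app_res[OF f _ x] pt_res[OF H])
qed

lemma arrow_local:
  assumes H: "small H" and f: "f \<in> hom E X (\<Delta> H)" and c: "c \<in> Obj C" and x: "x \<in> Sec X c"
  shows "locally c (\<lambda>d k. \<exists>h \<in> H. app f d (res X k x) = pt H h d)"
  by (rule locally_mono[OF c const_local[OF H c app_in[OF f c x]]]) (simp add: app_res[OF f _ x])

text \<open>The fibre over a value \<open>h\<close> and the part where other values are taken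
  decompose \<open>X\<close>. Since \<open>h\<close> is chosen as a value attained over a
  nondegenerate stage, the fibre is not initial, so the other part is.\<close>

lemma connected_object_sec_connected:
  assumes con: "connected_object E X" shows "sec_connected X"
  unfolding sec_connected_def
proof (intro conjI allI impI)
  show X: "X \<in> Obj E" and ne: "\<not> empty_object X"
    using con by (auto simp: connected_object_def initial_iff_empty)
  fix H f assume H: "small H" and f: "f \<in> hom E X (\<Delta> H)"
  note HO = const_Obj[OF H]
  obtain c0 x0 where x0: "c0 \<in> Obj C" "\<not> degenerate c0" "x0 \<in> Sec X c0" by (rule nonempty_section[OF X ne])
  obtain d0 k0 where k0: "k0 \<in> hom C d0 c0" "\<not> degenerate d0" "\<exists>h \<in> H. app f d0 (res X k0 x0) = pt H h d0"
    by (rule not_degenerate_locally[OF x0(1,2) arrow_local[OF H f x0(1,3)]])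
  then obtain h where h: "h \<in> H" "app f d0 (res X k0 x0) = pt H h d0" by blast
  note d0 = homD(4)[OF k0(1)] and x1 = res_in[OF X k0(1) x0(3)]
  \<comment> \<open>A section may take several values other than \<open>h\<close> on different
    members of a cover, so the complement of the fibre has to be described locally.\<close>
  let ?Q = "\<lambda>c x. locally c (\<lambda>d k. \<exists>h' \<in> H. h' \<noteq> h \<and> app f d (res X k x) = pt H h' d)"
  obtain Y i where i: "i \<in> hom E Y X" and i1: "\<And>c. c \<in> Obj C \<Longrightarrow> inj_on (app i c) (Sec Y c)"
    and im: "\<And>c. c \<in> Obj C \<Longrightarrow> app i c ` Sec Y c = {x \<in> Sec X c. app f c x = pt H h c}"
    by (rule subobject[OF subsheaf_fibre[OF H h(1) f]]) blast
  have "subsheaf X ?Q"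
    unfolding subsheaf_def
  proof (intro conjI ballI allI impI X)
    show "?Q d (res X k x)" if x: "x \<in> Sec X c" and k: "k \<in> hom C d c" and Q: "?Q c x" for c d k x
      by (rule locally_mono[OF homD(4)[OF k] locally_pullback[OF Q k]]) (simp add: res_comp[OF X k _ x])
    show "?Q c x" if c: "c \<in> Obj C" and x: "x \<in> Sec X c" and l: "locally c (\<lambda>d k. ?Q d (res X k x))" for c x
    proof (rule locally_trans[OF c l])
      fix d k assume k: "k \<in> hom C d c" and Q: "?Q d (res X k x)"
      show "locally d (\<lambda>e l. \<exists>h' \<in> H. h' \<noteq> h \<and> app f e (res X (k \<cdot>\<^bsub>C\<^esub> l) x) = pt H h' e)"
        by (rule locally_mono[OF homD(4)[OF k] Q]) (simp add: res_comp[OF X k _ x])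
    qed
  qed
  then obtain Z j where j: "j \<in> hom E Z X" and j1: "\<And>c. c \<in> Obj C \<Longrightarrow> inj_on (app j c) (Sec Z c)"
    and jm: "\<And>c. c \<in> Obj C \<Longrightarrow> app j c ` Sec Z c = {x \<in> Sec X c. ?Q c x}"
    by (rule subobject) blast
  have cov: "locally c (\<lambda>d k. res X k x \<in> app i d ` Sec Y d \<union> app j d ` Sec Z d)"
    if c: "c \<in> Obj C" and x: "x \<in> Sec X c" for c x
  proof (rule locally_mono[OF c arrow_local[OF H f c x]])
    fix d k assume k: "k \<in> hom C d c" and "\<exists>h' \<in> H. app f d (res X k x) = pt H h' d"
    then obtain h' where h': "h' \<in> H" "app f d (res X k x) = pt H h' d" by blast
    note d = homD(4)[OF k] and r = res_in[OF X k x]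
    show "res X k x \<in> app i d ` Sec Y d \<union> app j d ` Sec Z d"
    proof (cases "h' = h")
      case True then show ?thesis using im[OF d] r h' by blast
    next
      case False
      have "?Q d (res X k x)"
        using h' False pt_res[OF H h'(1)] app_res[OF f _ r] by (auto intro!: locallyI[OF d])
      then show ?thesis using jm[OF d] r by blast
    qed
  qed
  have "is_coproduct E Y Z X i j"
  proof (rule complementary_coproduct[OF i j i1 j1 _ cov])
    fix c y z assume c: "c \<in> Obj C" and y: "y \<in> Sec Y c" and z: "z \<in> Sec Z c" and eq: "app i c y = app j c z"
    let ?x = "app i c y"
    have x: "?x \<in> Sec X c" "app f c ?x = pt H h c" using im[OF c] y by blast+
    have Q: "?Q c ?x" using jm[OF c] z eq by force
    show "degenerate c"
    proof (rule locally_degenerate[OF c locally_mono[OF c Q]])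
      fix d k assume k: "k \<in> hom C d c" and "\<exists>h' \<in> H. h' \<noteq> h \<and> app f d (res X k ?x) = pt H h' d"
      then obtain h' where h': "h' \<in> H" "h' \<noteq> h" "pt H h d = pt H h' d"
        using app_res[OF f k x(1)] x(2) pt_res[OF H h(1) k] by auto
      then show "degenerate d" using pt_inj[OF H h(1) h'(1) homD(4)[OF k] h'(3)] by blast
    qed
  qed
  then have "empty_object Y \<or> empty_object Z"
    using con E.homD(4)[OF i] E.homD(4)[OF j] by (auto simp: connected_object_def initial_iff_empty)
  moreover have "Sec Y d0 \<noteq> {}" using im[OF d0] x1 h(2) by blast
  then have "\<not> empty_object Y" using k0(2) d0 by (auto simp: empty_object_def)
  ultimately have Z: "\<And>c z. c \<in> Obj C \<Longrightarrow> z \<in> Sec Z c \<Longrightarrow> degenerate c" by (auto simp: empty_object_def)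
  have "app f c x = pt H h c" if c: "c \<in> Obj C" and x: "x \<in> Sec X c" for c x
  proof (rule separated[OF HO c app_in[OF f c x] pt_in[OF H h(1) c]], rule locally_mono[OF c cov[OF c x]])
    fix d k assume k: "k \<in> hom C d c" and r: "res X k x \<in> app i d ` Sec Y d \<union> app j d ` Sec Z d"
    note d = homD(4)[OF k]
    have "app f d (res X k x) = pt H h d"
    proof (cases "degenerate d")
      case True
      show ?thesis by (rule degenerate_eq[OF HO d True app_in[OF f d res_in[OF X k x]] pt_in[OF H h(1) d]])
    next
      case False
      then show ?thesis using r Z[OF d] im[OF d] by blast
    qed
    then show "res (\<Delta> H) k (app f c x) = res (\<Delta> H) k (pt H h c)"
      using app_res[OF f k x] pt_res[OF H h(1) k] by simp
  qed
  then show "\<exists>h \<in> H. \<forall>c \<in> Obj C. \<forall>x \<in> Sec X c. app f c x = pt H h c" using h(1) by blast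
qed

lemma const_arrow:
  assumes X: "X \<in> Obj E" and H: "small H" "h \<in> H"
  obtains f where "f \<in> hom E X (\<Delta> H)" "\<And>c x. c \<in> Obj C \<Longrightarrow> x \<in> Sec X c \<Longrightarrow> app f c x = pt H h c"
proof -
  obtain t where t: "t \<in> hom E X (\<Delta> {h})" using const_singleton_terminal X unfolding terminal_def by blast
  note i = singleton_inclusion[OF H]
  show thesis
    using that[OF E.Comp_in_hom[OF t i]] app_Comp[OF t i] pt_eq app_in[OF t] by simp
qed

text \<open>The arrow to a two-element constant object that is \<open>a\<close> on one summand and
  \<open>b\<close> on the other is constant, and disjointness of the points makes one summand
  initial.\<close>

lemma sec_connected_connected_object:
  assumes con: "sec_connected A" shows "connected_object E A"
  unfolding connected_object_def
proof (intro conjI allI impI)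
  show "A \<in> Obj E" "\<not> initial E A" using con by (auto simp: sec_connected_def initial_iff_empty)
  fix X Y i j assume "X \<in> Obj E \<and> Y \<in> Obj E \<and> is_coproduct E X Y A i j"
  then have X: "X \<in> Obj E" and Y: "Y \<in> Obj E" and cop: "is_coproduct E X Y A i j" by blast+
  have i: "i \<in> hom E X A" and j: "j \<in> hom E Y A" using cop by (auto simp: is_coproduct_def)
  obtain a b :: 'u where ab: "a \<noteq> b" using ex_two by blast
  let ?H = "{a, b}"
  have aH: "a \<in> ?H" and bH: "b \<in> ?H" by auto
  obtain u where u: "u \<in> hom E X (\<Delta> ?H)" "\<And>c x. c \<in> Obj C \<Longrightarrow> x \<in> Sec X c \<Longrightarrow> app u c x = pt ?H a c"
    by (rule const_arrow[OF X small_two aH]) blast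
  obtain v where v: "v \<in> hom E Y (\<Delta> ?H)" "\<And>c x. c \<in> Obj C \<Longrightarrow> x \<in> Sec Y c \<Longrightarrow> app v c x = pt ?H b c"
    by (rule const_arrow[OF Y small_two bH]) blast
  have "\<exists>!m. m \<in> hom E A (\<Delta> ?H) \<and> m \<cdot>\<^bsub>E\<^esub> i = u \<and> m \<cdot>\<^bsub>E\<^esub> j = v"
    using cop const_Obj[OF small_two] u(1) v(1) unfolding is_coproduct_def by blast
  then obtain m where m: "m \<in> hom E A (\<Delta> ?H)" "m \<cdot>\<^bsub>E\<^esub> i = u" "m \<cdot>\<^bsub>E\<^esub> j = v" by blast
  obtain h where h: "h \<in> ?H" "\<And>c x. c \<in> Obj C \<Longrightarrow> x \<in> Sec A c \<Longrightarrow> app m c x = pt ?H h c"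
    by (rule sec_connectedD[OF con small_two m(1)]) blast
  have mi: "pt ?H a c = pt ?H h c" if "c \<in> Obj C" "x \<in> Sec X c" for c x
    using app_Comp[OF i m(1) that] h(2)[OF that(1) app_in[OF i that]] u(2)[OF that] m(2) by simp
  have mj: "pt ?H b c = pt ?H h c" if "c \<in> Obj C" "y \<in> Sec Y c" for c y
    using app_Comp[OF j m(1) that] h(2)[OF that(1) app_in[OF j that]] v(2)[OF that] m(3) by simp
  have "empty_object X \<or> empty_object Y"
  proof (cases "h = a")
    case True
    then have "degenerate c" if "c \<in> Obj C" "y \<in> Sec Y c" for c y
      using mj[OF that] pt_inj[OF small_two bH aH that(1)] ab by auto
    then show ?thesis using Y by (auto simp: empty_object_def)
  next
    case False
    then have "degenerate c" if "c \<in> Obj C" "x \<in> Sec X c" for c x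
      using mi[OF that] pt_inj[OF small_two aH h(1) that(1)] by auto
    then show ?thesis using X by (auto simp: empty_object_def)
  qed
  then show "initial E X \<or> initial E Y" by (simp add: initial_iff_empty)
qed

text \<open>The fibres of \<^term>\<open>\<eta>\<close> are the connected components of \<^term>\<open>X\<close>.\<close>
lemma component_map:
  assumes X: "X \<in> Obj E"
  obtains I \<eta> where "small I" "\<eta> \<in> hom E X (\<Delta> I)"
    "\<And>H f. small H \<Longrightarrow> f \<in> hom E X (\<Delta> H) \<Longrightarrow> \<exists>\<phi> \<in> I \<rightarrow>\<^sub>E H. \<forall>c \<in> Obj C. \<forall>x \<in> Sec X c. \<forall>i \<in> I.
      app \<eta> c x = pt I i c \<longrightarrow> app f c x = pt H (\<phi> i) c"
proof (rule components_transpose)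
  fix \<eta> assume n: "\<And>X. X \<in> Obj E \<Longrightarrow> \<eta> X \<in> hom E X (\<Delta> (OMap K X))"
    and ex: "\<And>X H f. small H \<Longrightarrow> f \<in> hom E X (\<Delta> H) \<Longrightarrow>
      \<exists>\<phi> \<in> OMap K X \<rightarrow>\<^sub>E H. AMap D (Arrow (OMap K X) \<phi> H) \<cdot>\<^bsub>E\<^esub> \<eta> X = f"
  show thesis
  proof (rule that[OF K_small[OF X] n[OF X]])
    fix H f assume H: "small H" and f: "f \<in> hom E X (\<Delta> H)"
    obtain \<phi> where \<phi>: "\<phi> \<in> OMap K X \<rightarrow>\<^sub>E H" "AMap D (Arrow (OMap K X) \<phi> H) \<cdot>\<^bsub>E\<^esub> \<eta> X = f"
      using ex[OF H f] by blast
    have "app f c x = pt H (\<phi> i) c"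
      if c: "c \<in> Obj C" and x: "x \<in> Sec X c" and i: "i \<in> OMap K X" "app (\<eta> X) c x = pt (OMap K X) i c" for c x i
      using app_Comp[OF n[OF X] const_map_in[OF K_small[OF X] H \<phi>(1)] c x] \<phi>(2) i(2)
        pt_map[OF K_small[OF X] i(1) H \<phi>(1) c] by simp
    then show "\<exists>\<phi> \<in> OMap K X \<rightarrow>\<^sub>E H. \<forall>c \<in> Obj C. \<forall>x \<in> Sec X c. \<forall>i \<in> OMap K X.
        app (\<eta> X) c x = pt (OMap K X) i c \<longrightarrow> app f c x = pt H (\<phi> i) c" using \<phi>(1) by blast
  qed
qed

text \<open>An arrow \<open>g\<close> on the component extends to \<open>X\<close> by a constant on
  the other components. The extension factors through the component map, hence is constant on each
  fibre.\<close>

lemma component_connected: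
  assumes I: "small I" and n: "\<eta> \<in> hom E X (\<Delta> I)"
    and fac: "\<And>H f. small H \<Longrightarrow> f \<in> hom E X (\<Delta> H) \<Longrightarrow> \<exists>\<phi> \<in> I \<rightarrow>\<^sub>E H. \<forall>c \<in> Obj C. \<forall>x \<in> Sec X c. \<forall>i \<in> I.
      app \<eta> c x = pt I i c \<longrightarrow> app f c x = pt H (\<phi> i) c"
    and i: "i \<in> I" and j: "j \<in> hom E Z X"
    and j1: "\<And>c. c \<in> Obj C \<Longrightarrow> inj_on (app j c) (Sec Z c)"
    and jm: "\<And>c. c \<in> Obj C \<Longrightarrow> app j c ` Sec Z c = {x \<in> Sec X c. app \<eta> c x = pt I i c}"
    and ne: "\<not> empty_object Z"
  shows "sec_connected Z"
  unfolding sec_connected_def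
proof (intro conjI allI impI ne)
  note X = E.homD(5)[OF j]
  show Z: "Z \<in> Obj E" by (rule E.homD(4)[OF j])
  fix H g assume H: "small H" and g: "g \<in> hom E Z (\<Delta> H)"
  note HO = const_Obj[OF H]
  obtain c0 z0 where z0: "c0 \<in> Obj C" "\<not> degenerate c0" "z0 \<in> Sec Z c0" by (rule nonempty_section[OF Z ne])
  \<comment> \<open>The default value outside \<open>Z\<close>; one exists because \<open>Z\<close>
    has a section over a nondegenerate stage, so \<open>H\<close> is inhabited.\<close>
  obtain h0 where h0: "h0 \<in> H"
    using not_degenerate_locally[OF z0(1,2) arrow_local[OF H g z0(1,3)]] by blast
  let ?R = "\<lambda>c w s. (\<exists>z \<in> Sec Z c. app j c z = w \<and> app g c z = s) \<or>
    (\<exists>i' \<in> I. i' \<noteq> i \<and> app \<eta> c w = pt I i' c \<and> s = pt H h0 c)"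
  have jn: "app \<eta> c (app j c z) = pt I i c" if "c \<in> Obj C" "z \<in> Sec Z c" for c z using jm[OF that(1)] that(2) by blast
  have "\<exists>m \<in> hom E X (\<Delta> H). \<forall>c x w. c \<in> Obj C \<longrightarrow> x \<in> Sec X c \<longrightarrow> ?R c x w \<longrightarrow> app m c x = w"
  proof (rule arrow_by_relation[OF X HO])
    show cl: "s \<in> Sec (\<Delta> H) c" if "c \<in> Obj C" "?R c w s" for c w s
      using that app_in[OF g] pt_in[OF H h0] by blast
    show "s = s'" if c: "c \<in> Obj C" and s: "?R c w s" and s': "?R c w s'" for c w s s'
    proof (cases "degenerate c")
      case True then show ?thesis using degenerate_eq[OF HO c] cl[OF c s] cl[OF c s'] by blast
    next
      case False
      consider z z' where "z \<in> Sec Z c" "z' \<in> Sec Z c" "app j c z = w" "app j c z' = w" "app g c z = s" "app g c z' = s'"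
        | "s = pt H h0 c" "s' = pt H h0 c"
        using s s' jn[OF c] pt_inj[OF I i _ c] False by (metis (no_types, lifting))
      then show ?thesis by cases (use j1[OF c] in \<open>metis inj_onD\<close>)+
    qed
    show "?R d (res X k w) (res (\<Delta> H) k s)" if k: "k \<in> hom C d c" and w: "w \<in> Sec X c" and R: "?R c w s" for c d k w s
      using R
    proof (elim disjE bexE conjE)
      fix z assume z: "z \<in> Sec Z c" "app j c z = w" "app g c z = s"
      then show ?thesis
        using app_res[OF j k z(1)] app_res[OF g k z(1)] by (intro disjI1 bexI[OF _ res_in[OF Z k z(1)]]) simp
    next
      fix i' assume "i' \<in> I" "i' \<noteq> i" "app \<eta> c w = pt I i' c" "s = pt H h0 c"
      then show ?thesis
        using app_res[OF n k w] pt_res[OF I _ k, of i'] pt_res[OF H h0 k] by (intro disjI2 bexI[of _ i']) simp_all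
    qed
    show "locally c (\<lambda>d k. \<exists>s. ?R d (res X k w) s)" if c: "c \<in> Obj C" and w: "w \<in> Sec X c" for c w
    proof (rule locally_mono[OF c arrow_local[OF I n c w]])
      fix d k assume k: "k \<in> hom C d c" and "\<exists>i \<in> I. app \<eta> d (res X k w) = pt I i d"
      then obtain i' where i': "i' \<in> I" "app \<eta> d (res X k w) = pt I i' d" by blast
      show "\<exists>s. ?R d (res X k w) s"
      proof (cases "i' = i")
        case True
        then have "res X k w \<in> app j d ` Sec Z d" using jm[OF homD(4)[OF k]] res_in[OF X k w] i' by blast
        then obtain z where "z \<in> Sec Z d" "app j d z = res X k w" by auto
        then show ?thesis by blast
      next
        case False then show ?thesis using i' by blast
      qed
    qed
  qed
  then obtain m where m: "m \<in> hom E X (\<Delta> H)"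
    and mz: "\<And>c z. c \<in> Obj C \<Longrightarrow> z \<in> Sec Z c \<Longrightarrow> app m c (app j c z) = app g c z"
    using app_in[OF j] by blast
  obtain \<phi> where \<phi>: "\<phi> \<in> I \<rightarrow>\<^sub>E H" "\<And>c x i. c \<in> Obj C \<Longrightarrow> x \<in> Sec X c \<Longrightarrow> i \<in> I \<Longrightarrow>
      app \<eta> c x = pt I i c \<Longrightarrow> app m c x = pt H (\<phi> i) c" using fac[OF H m] by blast
  have "app g c z = pt H (\<phi> i) c" if "c \<in> Obj C" "z \<in> Sec Z c" for c z
    using mz[OF that] \<phi>(2)[OF that(1) app_in[OF j that] i jn[OF that]] by simp
  moreover have "\<phi> i \<in> H" using \<phi>(1) i by auto
  ultimately show "\<exists>h \<in> H. \<forall>c \<in> Obj C. \<forall>z \<in> Sec Z c. app g c z = pt H h c" by blast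
qed

end

section \<open>Torsors under constant groups\<close>

context constant_objects
begin

text \<open>The set \<open>G\<close> only indexes arrows, with the identity and inverses among them;
  what corresponds to the isomorphism of a Galois object are the last two clauses, freeness away
  from degenerate stages and transitivity on a cover.\<close>

definition torsor :: "'o \<Rightarrow> 'u set \<Rightarrow> ('u \<Rightarrow> 'a) \<Rightarrow> bool" where
  "torsor X G F \<longleftrightarrow> small G \<and> locally_inhabited X \<and> (\<forall>g \<in> G. F g \<in> hom E X X) \<and> (\<exists>g \<in> G. F g = Id E X) \<and>
    (\<forall>g \<in> G. \<exists>g' \<in> G. F g' \<cdot>\<^bsub>E\<^esub> F g = Id E X \<and> F g \<cdot>\<^bsub>E\<^esub> F g' = Id E X) \<and>
    (\<forall>c \<in> Obj C. \<forall>x \<in> Sec X c. \<forall>g \<in> G. \<forall>g' \<in> G. app (F g) c x = app (F g') c x \<longrightarrow> g = g' \<or> degenerate c) \<and>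
    (\<forall>c \<in> Obj C. \<forall>x \<in> Sec X c. \<forall>y \<in> Sec X c. locally c (\<lambda>d k. \<exists>g \<in> G. res X k y = app (F g) d (res X k x)))"

lemma torsorI:
  assumes "small G" "locally_inhabited X" "\<And>g. g \<in> G \<Longrightarrow> F g \<in> hom E X X" "\<exists>g \<in> G. F g = Id E X"
    and "\<And>g. g \<in> G \<Longrightarrow> \<exists>g' \<in> G. F g' \<cdot>\<^bsub>E\<^esub> F g = Id E X \<and> F g \<cdot>\<^bsub>E\<^esub> F g' = Id E X"
    and "\<And>c x g g'. c \<in> Obj C \<Longrightarrow> x \<in> Sec X c \<Longrightarrow> g \<in> G \<Longrightarrow> g' \<in> G \<Longrightarrow>
      app (F g) c x = app (F g') c x \<Longrightarrow> g = g' \<or> degenerate c"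
    and "\<And>c x y. c \<in> Obj C \<Longrightarrow> x \<in> Sec X c \<Longrightarrow> y \<in> Sec X c \<Longrightarrow>
      locally c (\<lambda>d k. \<exists>g \<in> G. res X k y = app (F g) d (res X k x))"
  shows "torsor X G F"
  unfolding torsor_def by (intro conjI ballI impI; fact assms | rule assms; assumption)

lemma torsorD:
  assumes "torsor X G F"
  shows "small G" "locally_inhabited X" "g \<in> G \<Longrightarrow> F g \<in> hom E X X" "\<exists>g \<in> G. F g = Id E X"
    and "g \<in> G \<Longrightarrow> \<exists>g' \<in> G. F g' \<cdot>\<^bsub>E\<^esub> F g = Id E X \<and> F g \<cdot>\<^bsub>E\<^esub> F g' = Id E X"
    and "c \<in> Obj C \<Longrightarrow> x \<in> Sec X c \<Longrightarrow> g \<in> G \<Longrightarrow> g' \<in> G \<Longrightarrow>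
      app (F g) c x = app (F g') c x \<Longrightarrow> g = g' \<or> degenerate c"
    and "c \<in> Obj C \<Longrightarrow> x \<in> Sec X c \<Longrightarrow> y \<in> Sec X c \<Longrightarrow>
      locally c (\<lambda>d k. \<exists>g \<in> G. res X k y = app (F g) d (res X k x))"
  using assms by (simp_all add: torsor_def)

lemma torsor_Obj: "torsor X G F \<Longrightarrow> X \<in> Obj E"
  using torsorD(2) by (auto simp: locally_inhabited_def)

lemma torsor_inverse:
  assumes T: "torsor X G F" and g: "g \<in> G"
  obtains g' where "g' \<in> G" "\<And>c x. c \<in> Obj C \<Longrightarrow> x \<in> Sec X c \<Longrightarrow> app (F g') c (app (F g) c x) = x"
    "\<And>c x. c \<in> Obj C \<Longrightarrow> x \<in> Sec X c \<Longrightarrow> app (F g) c (app (F g') c x) = x"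
proof -
  obtain g' where g': "g' \<in> G" "F g' \<cdot>\<^bsub>E\<^esub> F g = Id E X" "F g \<cdot>\<^bsub>E\<^esub> F g' = Id E X"
    using torsorD(5)[OF T g] by blast
  note f = torsorD(3)[OF T g] and f' = torsorD(3)[OF T g'(1)]
  show thesis
    using that[OF g'(1)] app_Comp[OF f f'] app_Comp[OF f' f] g'(2,3) app_Id[OF E.homD(4)[OF f]] by simp
qed

text \<open>The element of \<open>G\<close> that carries \<open>x\<close> to its image under
  \<open>a\<close> exists on a cover and is unique away from degenerate stages, so it glues to an
  arrow from \<open>X\<close> to the constant object on \<open>G\<close>. Connectedness makes this
  arrow constant.\<close>

lemma connected_torsor_endomorphism:
  assumes con: "sec_connected X" and T: "torsor X G F" and a: "a \<in> hom E X X"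
  shows "\<exists>g \<in> G. a = F g"
proof -
  note X = E.homD(4)[OF a] and G = torsorD(1)[OF T] and F = torsorD(3)[OF T]
  note GO = const_Obj[OF G]
  let ?R = "\<lambda>c x s. \<exists>g \<in> G. s = pt G g c \<and> app a c x = app (F g) c x"
  have tot: "locally c (\<lambda>d k. \<exists>s. ?R d (res X k x) s)" if c: "c \<in> Obj C" and x: "x \<in> Sec X c" for c x
  proof (rule locally_mono[OF c torsorD(7)[OF T c x app_in[OF a c x]]])
    fix d k assume k: "k \<in> hom C d c" "\<exists>g \<in> G. res X k (app a c x) = app (F g) d (res X k x)"
    then show "\<exists>s. ?R d (res X k x) s" using app_res[OF a k(1) x] by auto
  qed
  have "\<exists>m \<in> hom E X (\<Delta> G). \<forall>c x s. c \<in> Obj C \<longrightarrow> x \<in> Sec X c \<longrightarrow> ?R c x s \<longrightarrow> app m c x = s"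
  proof (rule arrow_by_relation[OF X GO _ _ _ tot])
    show cl: "s \<in> Sec (\<Delta> G) c" if "c \<in> Obj C" "?R c x s" for c x s using that pt_in[OF G] by blast
    show "s = s'" if c: "c \<in> Obj C" and x: "x \<in> Sec X c" and s: "?R c x s" and s': "?R c x s'" for c x s s'
    proof (cases "degenerate c")
      case True then show ?thesis using degenerate_eq[OF GO c] cl[OF c s] cl[OF c s'] by blast
    next
      case False then show ?thesis using s s' torsorD(6)[OF T c x] by metis
    qed
    show "?R d (res X k x) (res (\<Delta> G) k s)" if k: "k \<in> hom C d c" and x: "x \<in> Sec X c" and "?R c x s" for c d k x s
      using that(3) pt_res[OF G _ k] app_res[OF a k x] app_res[OF F k x] by auto
  qed
  then obtain m where m: "m \<in> hom E X (\<Delta> G)"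
    and mR: "\<And>c x g. c \<in> Obj C \<Longrightarrow> x \<in> Sec X c \<Longrightarrow> g \<in> G \<Longrightarrow> app a c x = app (F g) c x \<Longrightarrow> app m c x = pt G g c"
    by blast
  obtain g where g: "g \<in> G" "\<And>c x. c \<in> Obj C \<Longrightarrow> x \<in> Sec X c \<Longrightarrow> app m c x = pt G g c"
    by (rule sec_connectedD[OF con G m]) blast
  have "a = F g"
  proof (rule faithful[OF a F[OF g(1)]])
    fix c x assume c: "c \<in> Obj C" and x: "x \<in> Sec X c"
    show "app a c x = app (F g) c x"
    proof (rule separated[OF X c app_in[OF a c x] app_in[OF F[OF g(1)] c x]], rule locally_mono[OF c tot[OF c x]])
      fix d k assume k: "k \<in> hom C d c" and "\<exists>s. ?R d (res X k x) s"
      then obtain g' where g': "g' \<in> G" "app a d (res X k x) = app (F g') d (res X k x)" by blast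
      note d = homD(4)[OF k] and r = res_in[OF X k x]
      have "pt G g d = pt G g' d" using mR[OF d r g'] g(2)[OF d r] by simp
      \<comment> \<open>Equality of points gives equality of indices except over a degenerate stage,
        where any two sections agree anyway.\<close>
      then have "g = g' \<or> degenerate d" by (rule pt_inj[OF G g(1) g'(1) d])
      then have "app a d (res X k x) = app (F g) d (res X k x)"
        using g'(2) degenerate_eq[OF X d _ app_in[OF a d r] app_in[OF F[OF g(1)] d r]] by auto
      then show "res X k (app a c x) = res X k (app (F g) c x)"
        using app_res[OF a k x] app_res[OF F[OF g(1)] k x] by simp
    qed
  qed
  with g(1) show ?thesis by blast
qed

text \<open>Freeness at one section over a nondegenerate stage gives injectivity. Surjectivity is
  the description of the endomorphisms, and the inverses in \<open>G\<close> make every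
  \<open>F g\<close> an automorphism.\<close>

lemma torsor_Aut:
  assumes con: "sec_connected X" and T: "torsor X G F"
  shows "bij_betw F G (Aut E X)"
  unfolding bij_betw_def
proof
  have X: "X \<in> Obj E" and ne: "\<not> empty_object X" using con by (auto simp: sec_connected_def)
  obtain c x where x: "c \<in> Obj C" "\<not> degenerate c" "x \<in> Sec X c" by (rule nonempty_section[OF X ne])
  show "inj_on F G" using torsorD(6)[OF T x(1,3)] x(2) by (auto simp: inj_on_def)
  show "F ` G = Aut E X"
  proof
    show "F ` G \<subseteq> Aut E X"
    proof
      fix a assume "a \<in> F ` G"
      then obtain g where g: "g \<in> G" "a = F g" by blast
      obtain g' where g': "g' \<in> G" "F g' \<cdot>\<^bsub>E\<^esub> F g = Id E X" "F g \<cdot>\<^bsub>E\<^esub> F g' = Id E X"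
        using torsorD(5)[OF T g(1)] by blast
      show "a \<in> Aut E X"
        using g torsorD(3)[OF T g(1)] torsorD(3)[OF T g'(1)] g'(2,3) E.homD[OF torsorD(3)[OF T g(1)]]
        by (auto simp: Aut_def iso_def)
    qed
    show "Aut E X \<subseteq> F ` G"
      using connected_torsor_endomorphism[OF con T] by (auto simp: Aut_def)
  qed
qed

section \<open>Galois objects as connected torsors\<close>

text \<open>The canonical map sends (a, h) to (a, h(a)), so its injectivity gives freeness and its
  surjectivity transitivity. The latter holds only on a cover because a section of a constant object
  is a point only locally.\<close>

lemma galois_connected_torsor:
  assumes gD: "inverse_image \<gamma> = D" and gal: "galois_object E \<gamma> A"
  shows "sec_connected A \<and> (\<exists>H e. torsor A H e)"
proof -
  from gal[unfolded galois_object_def, THEN conjunct1] obtain H e P p p' Q q q' m where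
    H: "small H" and e: "bij_betw e H (Aut E A)" and
    P0: "is_product E A (\<Delta> H) P p p'" and Q0: "is_product E A A Q q q'" and
    can: "is_canonical_map E \<gamma> A H e P p p' Q q q' m" and im: "iso E m"
    unfolding gD by (elim exE conjE)
  have con: "sec_connected A"
    using gal by (intro connected_object_sec_connected) (simp add: galois_object_def)
  have li: "locally_inhabited A"
    using gal epi_locally_inhabited by (auto simp: galois_object_def)
  note P = sec_productD[OF is_product_sec_product[OF P0]] and Q = sec_productD[OF is_product_sec_product[OF Q0]]
  note A = E.homD(5)[OF P(1)] and PO = E.homD(4)[OF P(1)]
  have m: "m \<in> hom E P Q" and qm: "q \<cdot>\<^bsub>E\<^esub> m = p" using can by (auto simp: is_canonical_map_def)
  have eh: "e h \<in> hom E A A" "iso E (e h)" if "h \<in> H" for h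
    using e that by (auto simp: bij_betw_def Aut_def)
  \<comment> \<open>\<open>s\<close> is the section a to (a, h) from the definition of the canonical
    map, computed in coordinates before and after that map.\<close>
  have sh: "\<exists>s. s \<in> hom E A P \<and> (\<forall>c \<in> Obj C. \<forall>x \<in> Sec A c.
      app p c (app s c x) = x \<and> app p' c (app s c x) = pt H h c \<and>
      app q c (app m c (app s c x)) = x \<and> app q' c (app m c (app s c x)) = app (e h) c x)" if h: "h \<in> H" for h
  proof -
    obtain s where s: "s \<in> hom E A P" "p \<cdot>\<^bsub>E\<^esub> s = Id E A" "is_constant_element E \<gamma> A H h (p' \<cdot>\<^bsub>E\<^esub> s)"
      "q' \<cdot>\<^bsub>E\<^esub> (m \<cdot>\<^bsub>E\<^esub> s) = e h" using can h by (auto simp: is_canonical_map_def)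
    obtain t where t: "t \<in> hom E A (\<Delta> {h})" "p' \<cdot>\<^bsub>E\<^esub> s = AMap D (inclusion {h} H) \<cdot>\<^bsub>E\<^esub> t"
      using s(3) by (auto simp: is_constant_element_def gD)
    have "app p c (app s c x) = x \<and> app p' c (app s c x) = pt H h c \<and>
      app q c (app m c (app s c x)) = x \<and> app q' c (app m c (app s c x)) = app (e h) c x"
      if c: "c \<in> Obj C" and x: "x \<in> Sec A c" for c x
    proof -
      have 1: "app p c (app s c x) = x" using app_Comp[OF s(1) P(1) c x] s(2) app_Id[OF A c x] by simp
      have 2: "app p' c (app s c x) = pt H h c"
        using app_Comp[OF s(1) P(2) c x] t(2) app_Comp[OF t(1) singleton_inclusion[OF H h] c x]
          pt_eq[OF c app_in[OF t(1) c x]] by simp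
      have 3: "app q c (app m c (app s c x)) = x"
        using app_Comp[OF m Q(1) c app_in[OF s(1) c x]] qm 1 by simp
      have 4: "app q' c (app m c (app s c x)) = app (e h) c x"
        using app_Comp[OF E.Comp_in_hom[OF s(1) m] Q(2) c x] app_Comp[OF s(1) m c x] s(4) by simp
      show ?thesis using 1 2 3 4 by blast
    qed
    with s(1) show ?thesis by blast
  qed
  note bm = isoD[OF m im]
  have "torsor A H e"
  proof (rule torsorI[OF H li])
    show "e h \<in> hom E A A" if "h \<in> H" for h using eh that by blast
    have "iso E (Id E A)" using E.Id_in_hom[OF A] E.homD[OF E.Id_in_hom[OF A]] E.hom_Id[OF E.Id_in_hom[OF A]]
      by (auto simp: iso_def)
    then have "Id E A \<in> Aut E A" using E.Id_in_hom[OF A] by (simp add: Aut_def)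
    then show "\<exists>h \<in> H. e h = Id E A" using e by (metis bij_betw_imp_surj_on imageE)
    show "\<exists>h' \<in> H. e h' \<cdot>\<^bsub>E\<^esub> e h = Id E A \<and> e h \<cdot>\<^bsub>E\<^esub> e h' = Id E A" if h: "h \<in> H" for h
    proof -
      obtain g where g: "g \<in> hom E A A" "g \<cdot>\<^bsub>E\<^esub> e h = Id E A" "e h \<cdot>\<^bsub>E\<^esub> g = Id E A"
        using eh[OF h] E.homD[OF eh(1)[OF h]] by (auto simp: iso_def)
      then have "g \<in> Aut E A" using eh[OF h] E.homD[OF g(1)] by (auto simp: Aut_def iso_def)
      then obtain h' where "h' \<in> H" "g = e h'" using e by (metis bij_betw_imp_surj_on imageE)
      then show ?thesis using g by blast
    qed
    show "h = h' \<or> degenerate c" if c: "c \<in> Obj C" and x: "x \<in> Sec A c" and h: "h \<in> H" "h' \<in> H"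
      and eq: "app (e h) c x = app (e h') c x" for c x h h'
    proof -
      obtain s where s: "s \<in> hom E A P" "\<forall>c \<in> Obj C. \<forall>x \<in> Sec A c.
          app p c (app s c x) = x \<and> app p' c (app s c x) = pt H h c \<and>
          app q c (app m c (app s c x)) = x \<and> app q' c (app m c (app s c x)) = app (e h) c x" using sh[OF h(1)] by blast
      obtain s' where s': "s' \<in> hom E A P" "\<forall>c \<in> Obj C. \<forall>x \<in> Sec A c.
          app p c (app s' c x) = x \<and> app p' c (app s' c x) = pt H h' c \<and>
          app q c (app m c (app s' c x)) = x \<and> app q' c (app m c (app s' c x)) = app (e h') c x" using sh[OF h(2)] by blast
      note i = app_in[OF s(1) c x] and i' = app_in[OF s'(1) c x]
      have "app m c (app s c x) = app m c (app s' c x)"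
        using s(2) s'(2) c x eq by (intro Q(4)[OF c app_in[OF m c i] app_in[OF m c i']]) simp_all
      then have "app s c x = app s' c x" using bm[OF c] i i' by (auto simp: bij_betw_def dest: inj_onD)
      then have "pt H h c = pt H h' c" using s(2) s'(2) c x by metis
      then show ?thesis by (rule pt_inj[OF H h c])
    qed
    show "locally c (\<lambda>d k. \<exists>h \<in> H. res A k y = app (e h) d (res A k x))"
      if c: "c \<in> Obj C" and x: "x \<in> Sec A c" and y: "y \<in> Sec A c" for c x y
    proof -
      obtain w where w: "w \<in> Sec Q c" "app q c w = x" "app q' c w = y" using Q(3)[OF c x y] by blast
      have "w \<in> app m c ` Sec P c" using bm[OF c] w(1) by (simp add: bij_betw_def)
      \<comment> \<open>\<open>v\<close> pairs \<open>x\<close> with a section of the constant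
        group; on a cover this section becomes a point, the element sought.\<close>
      then obtain v where v: "v \<in> Sec P c" "w = app m c v" by blast
      have pv: "app p c v = x" using app_Comp[OF m Q(1) c v(1)] qm v(2) w(2) by simp
      show ?thesis
      proof (rule locally_mono[OF c arrow_local[OF H P(2) c v(1)]])
        fix d k assume k: "k \<in> hom C d c" and "\<exists>h \<in> H. app p' d (res P k v) = pt H h d"
        then obtain h where h: "h \<in> H" "app p' d (res P k v) = pt H h d" by blast
        note d = homD(4)[OF k] and rv = res_in[OF PO k v(1)] and rx = res_in[OF A k x]
        obtain s where s: "s \<in> hom E A P" "\<forall>c \<in> Obj C. \<forall>x \<in> Sec A c.
          app p c (app s c x) = x \<and> app p' c (app s c x) = pt H h c \<and>
          app q c (app m c (app s c x)) = x \<and> app q' c (app m c (app s c x)) = app (e h) c x" using sh[OF h(1)] by blast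
        have "res P k v = app s d (res A k x)"
          using s(2) d rx h(2) app_res[OF P(1) k v(1)] pv
          by (intro P(4)[OF d rv app_in[OF s(1) d rx]]) simp_all
        then have "app q' d (app m d (res P k v)) = app (e h) d (res A k x)" using s(2) d rx by simp
        moreover have "app q' d (app m d (res P k v)) = res A k y"
          using app_res[OF m k v(1)] app_res[OF Q(2) k w(1)] v(2) w(3) by simp
        ultimately show "\<exists>h \<in> H. res A k y = app (e h) d (res A k x)" using h(1) by auto
      qed
    qed
  qed
  with con show ?thesis by blast
qed

text \<open>The canonical map is rebuilt from the action. Freeness makes it injective and
  transitivity makes it surjective, while connectedness identifies the index set with the
  automorphisms.\<close>

lemma connected_torsor_galois:
  assumes gD: "inverse_image \<gamma> = D" and con: "sec_connected A" and T: "torsor A H e"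
  shows "galois_object E \<gamma> A"
  unfolding galois_object_def
proof (intro conjI)
  note A = torsor_Obj[OF T] and H = torsorD(1)[OF T] and F = torsorD(3)[OF T]
  note HO = const_Obj[OF H]
  show "connected_object E A" by (rule sec_connected_connected_object[OF con])
  have tT: "terminal E (\<Delta> {undefined})" by (rule const_singleton_terminal)
  then obtain t where t: "t \<in> hom E A (\<Delta> {undefined})" using A unfolding terminal_def by blast
  show "\<exists>T t. terminal E T \<and> t \<in> hom E A T \<and> epi E t"
    using locally_inhabited_epi[OF torsorD(2)[OF T] tT t] t tT by blast
  obtain P p p' where P0: "sec_product A (\<Delta> H) P p p'" by (rule product_exists[OF A HO])
  obtain Q q q' where Q0: "sec_product A A Q q q'" by (rule product_exists[OF A A])
  note P = sec_productD[OF P0] and Q = sec_productD[OF Q0]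
  note PO = E.homD(4)[OF P(1)]
  \<comment> \<open>The action of a section of the constant object, described where that section is
    a point.\<close>
  let ?R = "\<lambda>c w y. \<exists>h \<in> H. app p' c w = pt H h c \<and> y = app (e h) c (app p c w)"
  have tot: "locally c (\<lambda>d k. \<exists>y. ?R d (res P k w) y)" if c: "c \<in> Obj C" and w: "w \<in> Sec P c" for c w
    by (rule locally_mono[OF c arrow_local[OF H P(2) c w]]) blast
  have "\<exists>a \<in> hom E P A. \<forall>c w y. c \<in> Obj C \<longrightarrow> w \<in> Sec P c \<longrightarrow> ?R c w y \<longrightarrow> app a c w = y"
  proof (rule arrow_by_relation[OF PO A _ _ _ tot])
    show cl: "y \<in> Sec A c" if "c \<in> Obj C" "w \<in> Sec P c" "?R c w y" for c w y
      using that app_in[OF F] app_in[OF P(1)] by blast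
    show "y = y'" if c: "c \<in> Obj C" and w: "w \<in> Sec P c" and y: "?R c w y" and y': "?R c w y'" for c w y y'
    proof (cases "degenerate c")
      case True then show ?thesis using degenerate_eq[OF A c] cl[OF c w y] cl[OF c w y'] by blast
    next
      case False then show ?thesis using y y' pt_inj[OF H _ _ c] by metis
    qed
    show "?R d (res P k w) (res A k y)" if k: "k \<in> hom C d c" and w: "w \<in> Sec P c" and "?R c w y" for c d k w y
      using that(3) app_res[OF P(1) k w] app_res[OF P(2) k w] pt_res[OF H _ k]
        app_res[OF F k app_in[OF P(1) homD(5)[OF k] w]] by auto
  qed
  then obtain a where a: "a \<in> hom E P A" and aR: "\<And>c w h. c \<in> Obj C \<Longrightarrow> w \<in> Sec P c \<Longrightarrow> h \<in> H \<Longrightarrow>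
      app p' c w = pt H h c \<Longrightarrow> app a c w = app (e h) c (app p c w)" by blast
  obtain m where m: "m \<in> hom E P Q" "q \<cdot>\<^bsub>E\<^esub> m = p" "q' \<cdot>\<^bsub>E\<^esub> m = a"
    and qm: "\<And>c w. c \<in> Obj C \<Longrightarrow> w \<in> Sec P c \<Longrightarrow> app q c (app m c w) = app p c w"
    and qm': "\<And>c w. c \<in> Obj C \<Longrightarrow> w \<in> Sec P c \<Longrightarrow> app q' c (app m c w) = app a c w"
    by (rule sec_product_pair[OF Q0 P(1) a]) blast
  have "\<exists>s \<in> hom E A P. p \<cdot>\<^bsub>E\<^esub> s = Id E A \<and> is_constant_element E \<gamma> A H h (p' \<cdot>\<^bsub>E\<^esub> s) \<and>
      q' \<cdot>\<^bsub>E\<^esub> (m \<cdot>\<^bsub>E\<^esub> s) = e h" if h: "h \<in> H" for h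
  proof -
    obtain t where t: "t \<in> hom E A (\<Delta> {h})" using const_singleton_terminal A unfolding terminal_def by blast
    note i = singleton_inclusion[OF H h]
    obtain s where s: "s \<in> hom E A P" "p \<cdot>\<^bsub>E\<^esub> s = Id E A" "p' \<cdot>\<^bsub>E\<^esub> s = AMap D (inclusion {h} H) \<cdot>\<^bsub>E\<^esub> t"
      and ps: "\<And>c x. c \<in> Obj C \<Longrightarrow> x \<in> Sec A c \<Longrightarrow> app p c (app s c x) = app (Id E A) c x"
      and ps': "\<And>c x. c \<in> Obj C \<Longrightarrow> x \<in> Sec A c \<Longrightarrow> app p' c (app s c x) = app (AMap D (inclusion {h} H) \<cdot>\<^bsub>E\<^esub> t) c x"
      by (rule sec_product_pair[OF P0 E.Id_in_hom[OF A] E.Comp_in_hom[OF t i]]) blast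
    have "q' \<cdot>\<^bsub>E\<^esub> (m \<cdot>\<^bsub>E\<^esub> s) = a \<cdot>\<^bsub>E\<^esub> s" using E.hom_assoc[OF s(1) m(1) Q(2)] m(3) by simp
    also have "\<dots> = e h"
    proof (rule faithful[OF E.Comp_in_hom[OF s(1) a] F[OF h]])
      fix c x assume c: "c \<in> Obj C" and x: "x \<in> Sec A c"
      have "app p' c (app s c x) = pt H h c"
        using ps'[OF c x] app_Comp[OF t i c x] pt_eq[OF c app_in[OF t c x]] by simp
      then show "app (a \<cdot>\<^bsub>E\<^esub> s) c x = app (e h) c x"
        using app_Comp[OF s(1) a c x] aR[OF c app_in[OF s(1) c x] h] ps[OF c x] app_Id[OF A c x] by simp
    qed
    finally show ?thesis using s t by (auto simp: is_constant_element_def gD)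
  qed
  then have can: "is_canonical_map E \<gamma> A H e P p p' Q q q' m" using m by (simp add: is_canonical_map_def)
  have "iso E m"
  proof (rule isoI[OF m(1)])
    fix c assume c: "c \<in> Obj C"
    have "inj_on (app m c) (Sec P c)"
    proof (rule inj_onI)
      fix w w' assume w: "w \<in> Sec P c" and w': "w' \<in> Sec P c" and eq: "app m c w = app m c w'"
      have pe: "app p c w = app p c w'" using qm[OF c w] qm[OF c w'] eq by simp
      have ae: "app a c w = app a c w'" using qm'[OF c w] qm'[OF c w'] eq by simp
      have "app p' c w = app p' c w'"
      proof (rule separated[OF HO c app_in[OF P(2) c w] app_in[OF P(2) c w']])
        \<comment> \<open>Both group coordinates must be points over one common cover before
          freeness can compare them.\<close>
        have "locally c (\<lambda>d k. (\<exists>h \<in> H. app p' d (res P k w) = pt H h d) \<and> (\<exists>h \<in> H. app p' d (res P k w') = pt H h d))"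
        proof (rule locally_conj[OF c arrow_local[OF H P(2) c w] arrow_local[OF H P(2) c w']])
          fix d k b l assume k: "k \<in> hom C d c" and "\<exists>h \<in> H. app p' d (res P k w) = pt H h d" and l: "l \<in> hom C b d"
          then show "\<exists>h \<in> H. app p' b (res P (k \<cdot>\<^bsub>C\<^esub> l) w) = pt H h b"
            using res_comp[OF PO k l w] app_res[OF P(2) l res_in[OF PO k w]] pt_res[OF H _ l] by auto
        qed
        then show "locally c (\<lambda>d k. res (\<Delta> H) k (app p' c w) = res (\<Delta> H) k (app p' c w'))"
        proof (rule locally_mono[OF c])
          fix d k assume k: "k \<in> hom C d c" and "(\<exists>h \<in> H. app p' d (res P k w) = pt H h d) \<and> (\<exists>h \<in> H. app p' d (res P k w') = pt H h d)"
          then obtain h h' where h: "h \<in> H" "app p' d (res P k w) = pt H h d"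
            and h': "h' \<in> H" "app p' d (res P k w') = pt H h' d" by blast
          note d = homD(4)[OF k] and r = res_in[OF PO k w] and r' = res_in[OF PO k w']
          have "app (e h) d (app p d (res P k w)) = app (e h') d (app p d (res P k w))"
            using aR[OF d r h] aR[OF d r' h'] app_res[OF a k w] app_res[OF a k w'] ae
              app_res[OF P(1) k w] app_res[OF P(1) k w'] pe by simp
          then have "h = h' \<or> degenerate d" by (rule torsorD(6)[OF T d app_in[OF P(1) d r] h(1) h'(1)])
          then have "pt H h d = pt H h' d"
            using degenerate_eq[OF HO d _ pt_in[OF H h(1) d] pt_in[OF H h'(1) d]] by blast
          then show "res (\<Delta> H) k (app p' c w) = res (\<Delta> H) k (app p' c w')"
            using h h' app_res[OF P(2) k w] app_res[OF P(2) k w'] by simp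
        qed
      qed
      then show "w = w'" by (rule P(4)[OF c w w' pe])
    qed
    moreover have "v \<in> app m c ` Sec P c" if v: "v \<in> Sec Q c" for v
    proof -
      let ?x = "app q c v" and ?y = "app q' c v"
      have x: "?x \<in> Sec A c" and y: "?y \<in> Sec A c" using app_in[OF Q(1) c v] app_in[OF Q(2) c v] .
      \<comment> \<open>An element carrying \<open>?x\<close> to \<open>?y\<close> exists on a
        cover, and freeness makes it unique away from degenerate stages. The corresponding points
        glue to the group coordinate of a preimage of \<open>v\<close>.\<close>
      let ?S = "\<lambda>d k s. \<exists>h \<in> H. s = pt H h d \<and> res A k ?y = app (e h) d (res A k ?x)"
      have tS: "locally c (\<lambda>d k. \<exists>s. ?S d k s)"
        by (rule locally_mono[OF c torsorD(7)[OF T c x y]]) blast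
      have "\<exists>s \<in> Sec (\<Delta> H) c. \<forall>d k z. k \<in> hom C d c \<longrightarrow> ?S d k z \<longrightarrow> res (\<Delta> H) k s = z"
      proof (rule glue[OF HO c _ _ _ tS])
        show cl: "s \<in> Sec (\<Delta> H) d" if "k \<in> hom C d c" "?S d k s" for d k s using that pt_in[OF H _ homD(4)] by blast
        show "s = s'" if k: "k \<in> hom C d c" and s: "?S d k s" and s': "?S d k s'" for d k s s'
        proof (cases "degenerate d")
          case True then show ?thesis using degenerate_eq[OF HO homD(4)[OF k]] cl[OF k s] cl[OF k s'] by blast
        next
          case False then show ?thesis using s s' torsorD(6)[OF T homD(4)[OF k] res_in[OF A k x]] by metis
        qed
        show "?S b (k \<cdot>\<^bsub>C\<^esub> l) (res (\<Delta> H) l s)" if k: "k \<in> hom C d c" and l: "l \<in> hom C b d" and "?S d k s" for d b k l s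
          using that(3) pt_res[OF H _ l] res_comp[OF A k l] x y app_res[OF F l res_in[OF A k x]] by auto
      qed
      then obtain s where s: "s \<in> Sec (\<Delta> H) c" and sS: "\<And>d k h. k \<in> hom C d c \<Longrightarrow> h \<in> H \<Longrightarrow>
          res A k ?y = app (e h) d (res A k ?x) \<Longrightarrow> res (\<Delta> H) k s = pt H h d" by blast
      obtain w where w: "w \<in> Sec P c" "app p c w = ?x" "app p' c w = s" using P(3)[OF c x s] by blast
      have "app a c w = ?y"
      proof (rule separated[OF A c app_in[OF a c w(1)] y], rule locally_mono[OF c torsorD(7)[OF T c x y]])
        fix d k assume k: "k \<in> hom C d c" and "\<exists>h \<in> H. res A k ?y = app (e h) d (res A k ?x)"
        then obtain h where h: "h \<in> H" "res A k ?y = app (e h) d (res A k ?x)" by blast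
        have "app p' d (res P k w) = pt H h d" using app_res[OF P(2) k w(1)] w(3) sS[OF k h] by simp
        then show "res A k (app a c w) = res A k ?y"
          using aR[OF homD(4)[OF k] res_in[OF PO k w(1)] h(1)] app_res[OF a k w(1)] app_res[OF P(1) k w(1)] w(2) h(2) by simp
      qed
      then have "app m c w = v"
        using qm[OF c w(1)] qm'[OF c w(1)] w by (intro Q(4)[OF c app_in[OF m(1) c w(1)] v]) simp_all
      then show ?thesis using w(1) by blast
    qed
    ultimately show "bij_betw (app m c) (Sec P c) (Sec Q c)"
      using app_in[OF m(1) c] by (auto simp: bij_betw_def)
  qed
  then show "\<exists>(H :: 'u set) e P p p' Q q q' c. small H \<and> bij_betw e H (Aut E A) \<and>
      is_product E A (OMap (inverse_image \<gamma>) H) P p p' \<and> is_product E A A Q q q' \<and>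
      is_canonical_map E \<gamma> A H e P p p' Q q q' c \<and> iso E c"
    using H torsor_Aut[OF con T] sec_product_is_product[OF P0] sec_product_is_product[OF Q0] can
    unfolding gD by blast
qed

end

section \<open>Products and components of torsors\<close>

context topos_sections
begin

lemma sec_product_ext:
  assumes P: "sec_product A B P p q" and m: "m \<in> hom E Z P" and n: "n \<in> hom E Z P"
    and "\<And>c z. c \<in> Obj C \<Longrightarrow> z \<in> Sec Z c \<Longrightarrow> app p c (app m c z) = app p c (app n c z)"
    and "\<And>c z. c \<in> Obj C \<Longrightarrow> z \<in> Sec Z c \<Longrightarrow> app q c (app m c z) = app q c (app n c z)"
  shows "m = n"
proof (rule faithful[OF m n])
  fix c z assume "c \<in> Obj C" "z \<in> Sec Z c"
  then show "app m c z = app n c z"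
    using sec_productD(4)[OF P _ app_in[OF m] app_in[OF n]] assms(4,5) by blast
qed

text \<open>Existence of a section persists under restriction, so the covers for the two factors
  have a common refinement.\<close>

lemma locally_inhabited_product:
  assumes P: "sec_product A B P p q" and A: "locally_inhabited A" and B: "locally_inhabited B"
  shows "locally_inhabited P"
  unfolding locally_inhabited_def
proof (intro conjI ballI E.homD(4)[OF sec_productD(1)[OF P]])
  fix c assume c: "c \<in> Obj C"
  have AO: "A \<in> Obj E" and lA: "locally c (\<lambda>d k. Sec A d \<noteq> {})" and lB: "locally c (\<lambda>d k. Sec B d \<noteq> {})"
    using A B c by (auto simp: locally_inhabited_def)
  have "locally c (\<lambda>d k. Sec A d \<noteq> {} \<and> Sec B d \<noteq> {})"
    by (rule locally_conj[OF c lA lB]) (use res_in[OF AO] in blast)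
  then show "locally c (\<lambda>d k. Sec P d \<noteq> {})"
  proof (rule locally_mono[OF c])
    fix d k assume "k \<in> hom C d c" "Sec A d \<noteq> {} \<and> Sec B d \<noteq> {}"
    then show "Sec P d \<noteq> {}" using sec_productD(3)[OF P homD(4)] by blast
  qed
qed

end

context constant_objects
begin

text \<open>Coded pairs of group elements act in each coordinate, and inverses are taken
  coordinatewise. For transitivity the covers belonging to the two coordinates are refined to
  one.\<close>

lemma torsor_product:
  assumes TA: "torsor A G F" and TB: "torsor B G' F'" and P0: "sec_product A B P p q"
  shows "\<exists>H M. torsor P H M"
proof -
  obtain pr :: "'u \<times> 'u \<Rightarrow> 'u" where "inj pr" using pairing_exists by blast
  then have pr[simp]: "pr u = pr v \<longleftrightarrow> u = v" "inv pr (pr u) = u" for u v by (auto simp: inj_eq)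
  note P = sec_productD[OF P0] and F = torsorD(3)[OF TA] and F' = torsorD(3)[OF TB]
  note A = torsor_Obj[OF TA] and B = torsor_Obj[OF TB] and PO = E.homD(4)[OF P(1)]
  let ?Q = "\<lambda>g g' m. m \<in> hom E P P \<and> (\<forall>c \<in> Obj C. \<forall>w \<in> Sec P c.
      app p c (app m c w) = app (F g) c (app p c w) \<and> app q c (app m c w) = app (F' g') c (app q c w))"
  have ex: "\<exists>m. ?Q g g' m" if g: "g \<in> G" and g': "g' \<in> G'" for g g'
  proof -
    obtain m where "m \<in> hom E P P"
      "\<And>c w. c \<in> Obj C \<Longrightarrow> w \<in> Sec P c \<Longrightarrow> app p c (app m c w) = app (F g \<cdot>\<^bsub>E\<^esub> p) c w"
      "\<And>c w. c \<in> Obj C \<Longrightarrow> w \<in> Sec P c \<Longrightarrow> app q c (app m c w) = app (F' g' \<cdot>\<^bsub>E\<^esub> q) c w"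
      by (rule sec_product_pair[OF P0 E.Comp_in_hom[OF P(1) F[OF g]] E.Comp_in_hom[OF P(2) F'[OF g']]]) blast
    then show ?thesis using app_Comp[OF P(1) F[OF g]] app_Comp[OF P(2) F'[OF g']] by auto
  qed
  \<comment> \<open>The arrow for a coded pair is chosen by its effect on the two coordinates, which
    determines it.\<close>
  define M where "M u = (SOME m. ?Q (fst (inv pr u)) (snd (inv pr u)) m)" for u
  have M: "?Q g g' (M (pr (g, g')))" if "g \<in> G" "g' \<in> G'" for g g'
    using someI_ex[OF ex[OF that]] by (simp add: M_def)
  let ?H = "pr ` (G \<times> G')"
  have Mh: "M (pr (g, g')) \<in> hom E P P"
    and Mp: "\<And>c w. c \<in> Obj C \<Longrightarrow> w \<in> Sec P c \<Longrightarrow> app p c (app (M (pr (g, g'))) c w) = app (F g) c (app p c w)"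
    and Mq: "\<And>c w. c \<in> Obj C \<Longrightarrow> w \<in> Sec P c \<Longrightarrow> app q c (app (M (pr (g, g'))) c w) = app (F' g') c (app q c w)"
    if "g \<in> G" "g' \<in> G'" for g g'
    using M[OF that] by auto
  have "torsor P ?H M"
  proof (rule torsorI)
    show "small ?H" by (rule small_pairs[OF torsorD(1)[OF TA] torsorD(1)[OF TB]])
    show "locally_inhabited P" by (rule locally_inhabited_product[OF P0 torsorD(2)[OF TA] torsorD(2)[OF TB]])
    show "M u \<in> hom E P P" if "u \<in> ?H" for u using that Mh by auto
    show "\<exists>u \<in> ?H. M u = Id E P"
    proof -
      obtain g g' where g: "g \<in> G" "F g = Id E A" and g': "g' \<in> G'" "F' g' = Id E B"
        using torsorD(4)[OF TA] torsorD(4)[OF TB] by blast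
      have "M (pr (g, g')) = Id E P"
        using Mp[OF g(1) g'(1)] Mq[OF g(1) g'(1)] g(2) g'(2) app_in[OF P(1)] app_in[OF P(2)]
        by (intro sec_product_ext[OF P0 Mh[OF g(1) g'(1)] E.Id_in_hom[OF PO]]) (simp_all add: app_Id A B PO)
      then show ?thesis using g g' by blast
    qed
    show "\<exists>v \<in> ?H. M v \<cdot>\<^bsub>E\<^esub> M u = Id E P \<and> M u \<cdot>\<^bsub>E\<^esub> M v = Id E P" if u: "u \<in> ?H" for u
    proof -
      obtain g g' where g: "g \<in> G" "g' \<in> G'" "u = pr (g, g')" using u by auto
      obtain h where h: "h \<in> G" "\<And>c x. c \<in> Obj C \<Longrightarrow> x \<in> Sec A c \<Longrightarrow> app (F h) c (app (F g) c x) = x"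
        "\<And>c x. c \<in> Obj C \<Longrightarrow> x \<in> Sec A c \<Longrightarrow> app (F g) c (app (F h) c x) = x"
        by (rule torsor_inverse[OF TA g(1)]) blast
      obtain h' where h': "h' \<in> G'" "\<And>c x. c \<in> Obj C \<Longrightarrow> x \<in> Sec B c \<Longrightarrow> app (F' h') c (app (F' g') c x) = x"
        "\<And>c x. c \<in> Obj C \<Longrightarrow> x \<in> Sec B c \<Longrightarrow> app (F' g') c (app (F' h') c x) = x"
        by (rule torsor_inverse[OF TB g(2)]) blast
      let ?v = "pr (h, h')"
      note Mu = Mh[OF g(1,2), folded g(3)] and Mv = Mh[OF h(1) h'(1)]
      note up = Mp[OF g(1,2), folded g(3)] Mq[OF g(1,2), folded g(3)] Mp[OF h(1) h'(1)] Mq[OF h(1) h'(1)]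
      note cl = app_in[OF Mu] app_in[OF Mv] app_in[OF P(1)] app_in[OF P(2)]
      have "M ?v \<cdot>\<^bsub>E\<^esub> M u = Id E P"
        by (rule sec_product_ext[OF P0 E.Comp_in_hom[OF Mu Mv] E.Id_in_hom[OF PO]])
          (simp_all add: app_Comp[OF Mu Mv] app_Id[OF PO] up cl h h')
      moreover have "M u \<cdot>\<^bsub>E\<^esub> M ?v = Id E P"
        by (rule sec_product_ext[OF P0 E.Comp_in_hom[OF Mv Mu] E.Id_in_hom[OF PO]])
          (simp_all add: app_Comp[OF Mv Mu] app_Id[OF PO] up cl h h')
      ultimately show ?thesis using h(1) h'(1) by blast
    qed
    show "u = v \<or> degenerate c" if c: "c \<in> Obj C" and w: "w \<in> Sec P c" and uv: "u \<in> ?H" "v \<in> ?H"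
      and eq: "app (M u) c w = app (M v) c w" for c w u v
    proof -
      obtain g g' h h' where g: "g \<in> G" "g' \<in> G'" "u = pr (g, g')" and h: "h \<in> G" "h' \<in> G'" "v = pr (h, h')"
        using uv by auto
      have "app (F g) c (app p c w) = app (F h) c (app p c w)"
        using Mp[OF g(1,2) c w] Mp[OF h(1,2) c w] eq g(3) h(3) by simp
      then have 1: "g = h \<or> degenerate c" by (rule torsorD(6)[OF TA c app_in[OF P(1) c w] g(1) h(1)])
      have "app (F' g') c (app q c w) = app (F' h') c (app q c w)"
        using Mq[OF g(1,2) c w] Mq[OF h(1,2) c w] eq g(3) h(3) by simp
      then have "g' = h' \<or> degenerate c" by (rule torsorD(6)[OF TB c app_in[OF P(2) c w] g(2) h(2)])
      then show ?thesis using 1 g h by auto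
    qed
    show "locally c (\<lambda>d k. \<exists>u \<in> ?H. res P k y = app (M u) d (res P k x))"
      if c: "c \<in> Obj C" and x: "x \<in> Sec P c" and y: "y \<in> Sec P c" for c x y
    proof -
      let ?x = "app p c x" and ?y = "app p c y" and ?x' = "app q c x" and ?y' = "app q c y"
      note xp = app_in[OF P(1) c x] app_in[OF P(1) c y] and xq = app_in[OF P(2) c x] app_in[OF P(2) c y]
      have "locally c (\<lambda>d k. (\<exists>g \<in> G. res A k ?y = app (F g) d (res A k ?x)) \<and>
          (\<exists>g \<in> G'. res B k ?y' = app (F' g) d (res B k ?x')))"
      proof (rule locally_conj[OF c torsorD(7)[OF TA c xp] torsorD(7)[OF TB c xq]])
        fix d k b l assume k: "k \<in> hom C d c" and "\<exists>g \<in> G. res A k ?y = app (F g) d (res A k ?x)" and l: "l \<in> hom C b d"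
        then obtain g where g: "g \<in> G" "res A k ?y = app (F g) d (res A k ?x)" by blast
        then have "res A (k \<cdot>\<^bsub>C\<^esub> l) ?y = app (F g) b (res A (k \<cdot>\<^bsub>C\<^esub> l) ?x)"
          using res_comp[OF A k l] xp app_res[OF F[OF g(1)] l res_in[OF A k xp(1)]] by simp
        then show "\<exists>g \<in> G. res A (k \<cdot>\<^bsub>C\<^esub> l) ?y = app (F g) b (res A (k \<cdot>\<^bsub>C\<^esub> l) ?x)" using g(1) by blast
      qed
      then show ?thesis
      proof (rule locally_mono[OF c])
        fix d k assume k: "k \<in> hom C d c" and "(\<exists>g \<in> G. res A k ?y = app (F g) d (res A k ?x)) \<and>
          (\<exists>g \<in> G'. res B k ?y' = app (F' g) d (res B k ?x'))"
        then obtain g g' where g: "g \<in> G" "g' \<in> G'" "res A k ?y = app (F g) d (res A k ?x)"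
          "res B k ?y' = app (F' g') d (res B k ?x')" by blast
        note d = homD(4)[OF k] and rx = res_in[OF PO k x] and ry = res_in[OF PO k y]
        have "res P k y = app (M (pr (g, g'))) d (res P k x)"
          using Mp[OF g(1,2) d rx] Mq[OF g(1,2) d rx] g(3,4) app_res[OF P(1) k] app_res[OF P(2) k] x y
          by (intro P(4)[OF d ry app_in[OF Mh[OF g(1,2)] d rx]]) simp_all
        then show "\<exists>u \<in> ?H. res P k y = app (M u) d (res P k x)" using g(1,2) by blast
      qed
    qed
  qed
  then show ?thesis by blast
qed

text \<open>The trivial group acts on the terminal object, whose connectedness comes from fullness
  of the inverse image. This provides the object showing that the filtered category is not
  empty.\<close>

lemma terminal_connected_torsor:
  assumes T: "terminal E T" shows "sec_connected T \<and> torsor T {undefined} (\<lambda>_. Id E T)"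
proof
  have TO: "T \<in> Obj E" using T by (simp add: terminal_def)
  obtain c where c: "c \<in> Obj C" "\<not> degenerate c" using ex_nondegenerate by blast
  have "\<not> empty_object T" using terminalD[OF T c(1)] c by (auto simp: empty_object_def)
  then show "sec_connected T"
    using TO terminal_const[OF T] unfolding sec_connected_def by metis
  have li: "locally_inhabited T"
    using TO terminalD[OF T] homD(4) by (fastforce simp: locally_inhabited_def intro!: locallyI)
  show "torsor T {undefined} (\<lambda>_. Id E T)"
  proof (rule torsorI[OF small_singleton li])
    show "locally c (\<lambda>d k. \<exists>g \<in> {undefined}. res T k y = app (Id E T) d (res T k x))"
      if c: "c \<in> Obj C" and x: "x \<in> Sec T c" and y: "y \<in> Sec T c" for c x y
    proof (rule locallyI[OF c])
      fix d k assume k: "k \<in> hom C d c"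
      have "x = y" using terminalD[OF T c] x y by auto
      then show "\<exists>g \<in> {undefined}. res T k y = app (Id E T) d (res T k x)"
        using app_Id[OF TO homD(4)[OF k] res_in[OF TO k x]] by simp
    qed
  qed (use E.Id_in_hom[OF TO] E.hom_Id[OF E.Id_in_hom[OF TO]] in auto)
qed

text \<open>Each group element carries components into components, and one that maps a single
  section of \<open>Z\<close> over a nondegenerate stage into \<open>Z\<close> preserves all of
  \<open>Z\<close>. Elements relating two sections of \<open>Z\<close> therefore lie in the
  stabiliser, which makes the restricted action locally transitive.\<close>

lemma torsor_component:
  assumes T: "torsor X G F"
  shows "\<exists>Z j S M. j \<in> hom E Z X \<and> sec_connected Z \<and> torsor Z S M"
proof -
  note X = torsor_Obj[OF T] and F = torsorD(3)[OF T]
  have liX: "locally c (\<lambda>d k. Sec X d \<noteq> {})" if "c \<in> Obj C" for c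
    using torsorD(2)[OF T] that by (auto simp: locally_inhabited_def)
  obtain I \<eta> where I: "small I" and n: "\<eta> \<in> hom E X (\<Delta> I)"
    and fac: "\<And>H f. small H \<Longrightarrow> f \<in> hom E X (\<Delta> H) \<Longrightarrow> \<exists>\<phi> \<in> I \<rightarrow>\<^sub>E H. \<forall>c \<in> Obj C. \<forall>x \<in> Sec X c. \<forall>i \<in> I.
      app \<eta> c x = pt I i c \<longrightarrow> app f c x = pt H (\<phi> i) c"
    by (rule component_map[OF X]) blast
  \<comment> \<open>The component is that of an actual section over a nondegenerate stage, which
    keeps \<open>Z\<close> from being initial.\<close>
  obtain c i x0 where c: "c \<in> Obj C" "\<not> degenerate c" and i: "i \<in> I" and x0: "x0 \<in> Sec X c" "app \<eta> c x0 = pt I i c"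
  proof -
    obtain c1 where c1: "c1 \<in> Obj C" "\<not> degenerate c1" using ex_nondegenerate by blast
    obtain c2 k2 where c2: "k2 \<in> hom C c2 c1" "\<not> degenerate c2" "Sec X c2 \<noteq> {}"
      by (rule not_degenerate_locally[OF c1 liX[OF c1(1)]])
    then obtain x2 where x2: "x2 \<in> Sec X c2" by blast
    note o2 = homD(4)[OF c2(1)]
    obtain c3 k3 where c3: "k3 \<in> hom C c3 c2" "\<not> degenerate c3" "\<exists>i \<in> I. app \<eta> c3 (res X k3 x2) = pt I i c3"
      by (rule not_degenerate_locally[OF o2 c2(2) arrow_local[OF I n o2 x2]])
    then show thesis using that[OF homD(4)[OF c3(1)] c3(2) _ res_in[OF X c3(1) x2]] by blast
  qed
  obtain Z j where j: "j \<in> hom E Z X" and j1: "\<And>c. c \<in> Obj C \<Longrightarrow> inj_on (app j c) (Sec Z c)"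
    and jm: "\<And>c. c \<in> Obj C \<Longrightarrow> app j c ` Sec Z c = {x \<in> Sec X c. app \<eta> c x = pt I i c}"
    by (rule subobject[OF subsheaf_fibre[OF I i n]]) blast
  note ZO = E.homD(4)[OF j]
  have jn: "app \<eta> c (app j c z) = pt I i c" if "c \<in> Obj C" "z \<in> Sec Z c" for c z using jm[OF that(1)] that(2) by blast
  have "Sec Z c \<noteq> {}" using jm[OF c(1)] x0 by blast
  then have ne: "\<not> empty_object Z" using c by (auto simp: empty_object_def)
  have con: "sec_connected Z" by (rule component_connected[OF I n fac i j j1 jm ne])
  \<comment> \<open>The component map after a translation factors through the component map, so the
    component of a translate depends only on the component translated.\<close>
  have perm: "\<exists>\<phi> \<in> I \<rightarrow>\<^sub>E I. \<forall>c \<in> Obj C. \<forall>x \<in> Sec X c. \<forall>i \<in> I.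
      app \<eta> c x = pt I i c \<longrightarrow> app \<eta> c (app (F g) c x) = pt I (\<phi> i) c" if g: "g \<in> G" for g
    using fac[OF I E.Comp_in_hom[OF F[OF g] n]] app_Comp[OF F[OF g] n] by simp

  define S where "S = {g \<in> G. \<forall>c \<in> Obj C. \<forall>x \<in> Sec X c. app \<eta> c x = pt I i c \<longrightarrow> app \<eta> c (app (F g) c x) = pt I i c}"
  have SG: "g \<in> G" if "g \<in> S" for g using that by (simp add: S_def)
  \<comment> \<open>Since \<open>\<phi>\<close> records the effect on all components, one section
    over one nondegenerate stage decides membership in the stabiliser.\<close>
  have SI: "g \<in> S" if g: "g \<in> G" and d: "d \<in> Obj C" "\<not> degenerate d" and x: "x \<in> Sec X d"
    "app \<eta> d x = pt I i d" "app \<eta> d (app (F g) d x) = pt I i d" for g d x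
  proof -
    obtain \<phi> where \<phi>: "\<phi> \<in> I \<rightarrow>\<^sub>E I" "\<forall>c \<in> Obj C. \<forall>x \<in> Sec X c. \<forall>i \<in> I.
      app \<eta> c x = pt I i c \<longrightarrow> app \<eta> c (app (F g) c x) = pt I (\<phi> i) c" using perm[OF g] by blast
    have "\<phi> i \<in> I" using \<phi>(1) i by auto
    moreover have "pt I (\<phi> i) d = pt I i d" using \<phi>(2) d x i by simp
    ultimately have "\<phi> i = i" using pt_inj[OF I _ i d(1)] d(2) by blast
    then show ?thesis using \<phi>(2) g i by (auto simp: S_def)
  qed
  have "\<forall>g \<in> S. \<exists>m. m \<in> hom E Z Z \<and> (\<forall>c \<in> Obj C. \<forall>z \<in> Sec Z c. app j c (app m c z) = app (F g) c (app j c z))"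
  proof
    fix g assume g: "g \<in> S"
    note Fg = F[OF SG[OF g]]
    show "\<exists>m. m \<in> hom E Z Z \<and> (\<forall>c \<in> Obj C. \<forall>z \<in> Sec Z c. app j c (app m c z) = app (F g) c (app j c z))"
    proof (rule lift[OF j j1 E.Comp_in_hom[OF j Fg]])
      show "app (F g \<cdot>\<^bsub>E\<^esub> j) c z \<in> app j c ` Sec Z c" if c: "c \<in> Obj C" and z: "z \<in> Sec Z c" for c z
        unfolding jm[OF c] using app_Comp[OF j Fg c z] app_in[OF Fg c app_in[OF j c z]] g jn[OF c z] app_in[OF j c z] c
        by (simp add: S_def)
    qed (use app_Comp[OF j Fg] in auto)
  qed
  from bchoice[OF this] obtain M where M: "\<And>g. g \<in> S \<Longrightarrow> M g \<in> hom E Z Z"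
    "\<And>g c z. g \<in> S \<Longrightarrow> c \<in> Obj C \<Longrightarrow> z \<in> Sec Z c \<Longrightarrow> app j c (app (M g) c z) = app (F g) c (app j c z)" by blast
  have jD: "z = z'" if "c \<in> Obj C" "z \<in> Sec Z c" "z' \<in> Sec Z c" "app j c z = app j c z'" for c z z'
    using j1[OF that(1)] that by (metis inj_onD)
  obtain g0 where g0: "g0 \<in> G" "F g0 = Id E X" using torsorD(4)[OF T] by blast
  have g0S: "g0 \<in> S" using SI[OF g0(1) c x0] g0(2) app_Id[OF X c(1) x0(1)] x0(2) by simp
  have M0: "M g0 = Id E Z"
  proof (rule faithful[OF M(1)[OF g0S] E.Id_in_hom[OF ZO]])
    fix c z assume c: "c \<in> Obj C" and z: "z \<in> Sec Z c"
    show "app (M g0) c z = app (Id E Z) c z"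
      using M(2)[OF g0S c z] g0(2) app_Id[OF X c app_in[OF j c z]] app_Id[OF ZO c z]
      by (intro jD[OF c app_in[OF M(1)[OF g0S] c z]]) (simp_all add: z)
  qed
  text \<open>The predicate \<open>hit\<close> below is constant on orbits, hence descends to the terminal object.\<close>
  define LI where "LI c = locally c (\<lambda>d k. Sec Z d \<noteq> {})" for c
  define hit where "hit i' \<longleftrightarrow> (\<forall>c \<in> Obj C. \<forall>x \<in> Sec X c. app \<eta> c x = pt I i' c \<longrightarrow> LI c)" for i'
  obtain a b :: 'u where ab: "a \<noteq> b" using ex_two by blast
  let ?H = "{a, b}"
  \<comment> \<open>Depending only on the component, \<open>hit\<close> can be recorded by an arrow
    to a two-element constant object; \<open>a\<close> stands for true.\<close>
  define \<chi> where "\<chi> = (\<lambda>i'\<in>I. if hit i' then a else b)"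
  have \<chi>: "\<chi> \<in> I \<rightarrow>\<^sub>E ?H" by (auto simp: \<chi>_def)
  define r where "r = AMap D (Arrow I \<chi> ?H) \<cdot>\<^bsub>E\<^esub> \<eta>"
  note Dx = const_map_in[OF I small_two \<chi>]
  have r: "r \<in> hom E X (\<Delta> ?H)" unfolding r_def by (rule E.Comp_in_hom[OF n Dx])
  have r_pt: "app r c x = pt ?H (if hit i' then a else b) c"
    if "c \<in> Obj C" "x \<in> Sec X c" "i' \<in> I" "app \<eta> c x = pt I i' c" for c x i'
    using app_Comp[OF n Dx that(1,2)] pt_map[OF I that(3) small_two \<chi> that(1)] that(3,4) by (simp add: r_def \<chi>_def)
  note HO = const_Obj[OF small_two]
  \<comment> \<open>A translate lives over the same stage as the original section, so
    \<open>hit\<close> passes from \<open>\<phi> i1\<close> to \<open>i1\<close>. The inverse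
    element brings the component back to \<open>i1\<close> and gives the other implication.\<close>
  have inv: "app r c (app (F g) c x) = app r c x" if g: "g \<in> G" and c: "c \<in> Obj C" and x: "x \<in> Sec X c" for g c x
  proof (rule separated[OF HO c app_in[OF r c app_in[OF F[OF g] c x]] app_in[OF r c x]],
      rule locally_mono[OF c arrow_local[OF I n c x]])
    fix d k assume k: "k \<in> hom C d c" and "\<exists>i \<in> I. app \<eta> d (res X k x) = pt I i d"
    then obtain i1 where i1: "i1 \<in> I" "app \<eta> d (res X k x) = pt I i1 d" by blast
    note d = homD(4)[OF k] and rx = res_in[OF X k x] and Fg = F[OF g]
    obtain g' where g': "g' \<in> G" "\<And>c x. c \<in> Obj C \<Longrightarrow> x \<in> Sec X c \<Longrightarrow> app (F g') c (app (F g) c x) = x"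
      by (rule torsor_inverse[OF T g]) blast
    obtain \<phi> where \<phi>: "\<phi> \<in> I \<rightarrow>\<^sub>E I" "\<And>c x i. c \<in> Obj C \<Longrightarrow> x \<in> Sec X c \<Longrightarrow> i \<in> I \<Longrightarrow>
      app \<eta> c x = pt I i c \<Longrightarrow> app \<eta> c (app (F g) c x) = pt I (\<phi> i) c" using perm[OF g] by blast
    obtain \<psi> where \<psi>: "\<psi> \<in> I \<rightarrow>\<^sub>E I" "\<And>c x i. c \<in> Obj C \<Longrightarrow> x \<in> Sec X c \<Longrightarrow> i \<in> I \<Longrightarrow>
      app \<eta> c x = pt I i c \<Longrightarrow> app \<eta> c (app (F g') c x) = pt I (\<psi> i) c" using perm[OF g'(1)] by blast
    have i2: "\<phi> i1 \<in> I" and i3: "\<psi> (\<phi> i1) \<in> I" using \<phi>(1) \<psi>(1) i1(1) by auto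
    note e2 = \<phi>(2)[OF d rx i1]
    note Fx = app_in[OF Fg d rx]
    have "app r d (app (F g) d (res X k x)) = app r d (res X k x)"
    proof (cases "degenerate d")
      case True show ?thesis by (rule degenerate_eq[OF HO d True app_in[OF r d Fx] app_in[OF r d rx]])
    next
      case False
      have "pt I (\<psi> (\<phi> i1)) d = pt I i1 d" using \<psi>(2)[OF d Fx i2 e2] g'(2)[OF d rx] i1(2) by simp
      then have i31: "\<psi> (\<phi> i1) = i1" using pt_inj[OF I i3 i1(1) d] False by blast
      have "hit (\<phi> i1) \<Longrightarrow> hit i1"
        unfolding hit_def using \<phi>(2) i1(1) app_in[OF Fg] by blast
      moreover have "hit i1 \<Longrightarrow> hit (\<phi> i1)"
        unfolding hit_def using \<psi>(2)[OF _ _ i2] app_in[OF F[OF g'(1)]] i31 by metis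
      ultimately show ?thesis using r_pt[OF d rx i1] r_pt[OF d Fx i2 e2] by auto
    qed
    then show "res (\<Delta> ?H) k (app r c (app (F g) c x)) = res (\<Delta> ?H) k (app r c x)"
      using app_res[OF r k x] app_res[OF r k app_in[OF Fg c x]] app_res[OF Fg k x] by simp
  qed
  have rr: "app r c y = app r c x" if c: "c \<in> Obj C" and x: "x \<in> Sec X c" and y: "y \<in> Sec X c" for c x y
  proof (rule separated[OF HO c app_in[OF r c y] app_in[OF r c x]], rule locally_mono[OF c torsorD(7)[OF T c x y]])
    fix d k assume k: "k \<in> hom C d c" and "\<exists>g \<in> G. res X k y = app (F g) d (res X k x)"
    then show "res (\<Delta> ?H) k (app r c y) = res (\<Delta> ?H) k (app r c x)"
      using inv[OF _ homD(4)[OF k] res_in[OF X k x]] app_res[OF r k x] app_res[OF r k y] by auto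
  qed
  let ?T = "\<Delta> {undefined}"
  have tT: "terminal E ?T" by (rule const_singleton_terminal)
  then have TO: "?T \<in> Obj E" by (simp add: terminal_def)
  \<comment> \<open>By invariance and transitivity \<open>r\<close> takes the same value at all
    sections over a stage, and as \<open>X\<close> is locally inhabited this value defines an arrow
    on the terminal object.\<close>
  have "\<exists>f \<in> hom E ?T (\<Delta> ?H). \<forall>c t s. c \<in> Obj C \<longrightarrow> t \<in> Sec ?T c \<longrightarrow> (\<exists>x \<in> Sec X c. s = app r c x) \<longrightarrow> app f c t = s"
  proof (rule arrow_by_relation[OF TO HO])
    show "s \<in> Sec (\<Delta> ?H) c" if "c \<in> Obj C" "\<exists>x \<in> Sec X c. s = app r c x" for c s using that app_in[OF r] by blast
    show "s = s'" if "c \<in> Obj C" "\<exists>x \<in> Sec X c. s = app r c x" "\<exists>x \<in> Sec X c. s' = app r c x" for c s s'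
      using that rr[OF that(1)] by blast
    show "\<exists>x \<in> Sec X d. res (\<Delta> ?H) k s = app r d x" if k: "k \<in> hom C d c" and "\<exists>x \<in> Sec X c. s = app r c x" for c d k s
      using that(2) app_res[OF r k] res_in[OF X k] by metis
    show "locally c (\<lambda>d k. \<exists>s. \<exists>x \<in> Sec X d. s = app r d x)" if c: "c \<in> Obj C" for c
      by (rule locally_mono[OF c liX[OF c]]) blast
  qed
  then obtain f where f: "f \<in> hom E ?T (\<Delta> ?H)"
    "\<And>c t x. c \<in> Obj C \<Longrightarrow> t \<in> Sec ?T c \<Longrightarrow> x \<in> Sec X c \<Longrightarrow> app f c t = app r c x" by blast
  obtain h where h: "h \<in> ?H" "\<And>c t. c \<in> Obj C \<Longrightarrow> t \<in> Sec ?T c \<Longrightarrow> app f c t = pt ?H h c"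
    by (rule terminal_const[OF tT small_two f(1)]) blast
  have rh: "app r c x = pt ?H h c" if c: "c \<in> Obj C" and x: "x \<in> Sec X c" for c x
    using singleton_section[OF c] f(2)[OF c _ x] h(2)[OF c] by metis
  have LIZ: "LI c" if "c \<in> Obj C" "z \<in> Sec Z c" for c z
    unfolding LI_def using res_in[OF ZO _ that(2)] by (intro locallyI[OF that(1)]) blast
  have "hit i" unfolding hit_def
  proof (intro ballI impI)
    fix c x assume c: "c \<in> Obj C" and "x \<in> Sec X c" "app \<eta> c x = pt I i c"
    then have "x \<in> app j c ` Sec Z c" using jm by blast
    then show "LI c" using LIZ[OF c] by blast
  qed
  \<comment> \<open>The constant value is identified at \<open>x0\<close>, which lies in
    \<open>Z\<close>; nondegeneracy of its stage separates \<open>a\<close> from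
    \<open>b\<close>.\<close>
  then have "pt ?H a c = pt ?H h c" using r_pt[OF c(1) x0(1) i x0(2)] rh[OF c(1) x0(1)] by simp
  then have ha: "h = a" using pt_inj[OF small_two _ h(1) c(1), of a] c(2) by auto
  have LIX: "LI c" if c: "c \<in> Obj C" and x: "x \<in> Sec X c" for c x
    unfolding LI_def
  proof (rule locally_trans[OF c arrow_local[OF I n c x]])
    fix d k assume k: "k \<in> hom C d c" and "\<exists>i \<in> I. app \<eta> d (res X k x) = pt I i d"
    then obtain i1 where i1: "i1 \<in> I" "app \<eta> d (res X k x) = pt I i1 d" by blast
    note d = homD(4)[OF k] and rx = res_in[OF X k x]
    have "pt ?H (if hit i1 then a else b) d = pt ?H a d" using r_pt[OF d rx i1] rh[OF d rx] ha by simp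
    moreover have "pt ?H b d = pt ?H a d \<Longrightarrow> b = a \<or> degenerate d" by (rule pt_inj[OF small_two _ _ d]) auto
    ultimately have "hit i1 \<or> degenerate d" using ab by (auto split: if_splits)
    then have "LI d" using i1 d rx degenerate_locally[OF d] by (auto simp: hit_def LI_def)
    then show "locally d (\<lambda>e l. Sec Z e \<noteq> {})" by (simp add: LI_def)
  qed
  have liZ: "locally_inhabited Z"
    unfolding locally_inhabited_def
  proof (intro conjI ZO ballI)
    fix c assume c: "c \<in> Obj C"
    show "locally c (\<lambda>d k. Sec Z d \<noteq> {})"
    proof (rule locally_trans[OF c liX[OF c]])
      fix d k assume k: "k \<in> hom C d c" and "Sec X d \<noteq> {}"
      then show "locally d (\<lambda>e l. Sec Z e \<noteq> {})" using LIX[OF homD(4)[OF k]] by (auto simp: LI_def)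
    qed
  qed
  have "S \<subseteq> G" by (auto simp: S_def)
  then have "small S" using torsorD(1)[OF T] by (rule small_subset)
  then have "torsor Z S M"
  proof (rule torsorI[OF _ liZ M(1)])
    show "\<exists>g \<in> S. M g = Id E Z" using g0S M0 by blast
    show "\<exists>g' \<in> S. M g' \<cdot>\<^bsub>E\<^esub> M g = Id E Z \<and> M g \<cdot>\<^bsub>E\<^esub> M g' = Id E Z" if g: "g \<in> S" for g
    proof -
      note gG = SG[OF g]
      obtain g' where g': "g' \<in> G" "\<And>c x. c \<in> Obj C \<Longrightarrow> x \<in> Sec X c \<Longrightarrow> app (F g') c (app (F g) c x) = x"
        "\<And>c x. c \<in> Obj C \<Longrightarrow> x \<in> Sec X c \<Longrightarrow> app (F g) c (app (F g') c x) = x"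
        by (rule torsor_inverse[OF T gG]) blast
      have g'S: "g' \<in> S"
      proof (rule SI[OF g'(1) c app_in[OF F[OF gG] c(1) x0(1)]])
        show "app \<eta> c (app (F g) c x0) = pt I i c" using g c x0 by (simp add: S_def)
        show "app \<eta> c (app (F g') c (app (F g) c x0)) = pt I i c" using g'(2)[OF c(1) x0(1)] x0(2) by simp
      qed
      have comp: "M u \<cdot>\<^bsub>E\<^esub> M v = Id E Z" if u: "u \<in> S" and v: "v \<in> S"
        and uv: "\<And>c x. c \<in> Obj C \<Longrightarrow> x \<in> Sec X c \<Longrightarrow> app (F u) c (app (F v) c x) = x" for u v
      proof (rule faithful[OF E.Comp_in_hom[OF M(1)[OF v] M(1)[OF u]] E.Id_in_hom[OF ZO]])
        fix c z assume c: "c \<in> Obj C" and z: "z \<in> Sec Z c"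
        note vz = app_in[OF M(1)[OF v] c z]
        have "app (M u) c (app (M v) c z) = z"
          using M(2)[OF u c vz] M(2)[OF v c z] uv[OF c app_in[OF j c z]]
          by (intro jD[OF c app_in[OF M(1)[OF u] c vz] z]) simp
        then show "app (M u \<cdot>\<^bsub>E\<^esub> M v) c z = app (Id E Z) c z"
          using app_Comp[OF M(1)[OF v] M(1)[OF u] c z] app_Id[OF ZO c z] by simp
      qed
      show ?thesis using comp[OF g'S g g'(2)] comp[OF g g'S g'(3)] g'S by blast
    qed
    show "g = g' \<or> degenerate c" if c: "c \<in> Obj C" and z: "z \<in> Sec Z c" and g: "g \<in> S" "g' \<in> S"
      and eq: "app (M g) c z = app (M g') c z" for c z g g'
      using torsorD(6)[OF T c app_in[OF j c z] SG[OF g(1)] SG[OF g(2)]] M(2)[OF g(1) c z] M(2)[OF g(2) c z] eq by simp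
    show "locally c (\<lambda>d k. \<exists>g \<in> S. res Z k y = app (M g) d (res Z k x))"
      if c: "c \<in> Obj C" and x: "x \<in> Sec Z c" and y: "y \<in> Sec Z c" for c x y
    proof (rule locally_mono[OF c torsorD(7)[OF T c app_in[OF j c x] app_in[OF j c y]]])
      fix d k assume k: "k \<in> hom C d c" and "\<exists>g \<in> G. res X k (app j c y) = app (F g) d (res X k (app j c x))"
      then obtain g where g: "g \<in> G" "app j d (res Z k y) = app (F g) d (app j d (res Z k x))"
        using app_res[OF j k x] app_res[OF j k y] by auto
      note d = homD(4)[OF k] and rx = res_in[OF ZO k x] and ry = res_in[OF ZO k y]
      show "\<exists>g \<in> S. res Z k y = app (M g) d (res Z k x)"
      proof (cases "degenerate d")
        case True
        have "res Z k y = app (M g0) d (res Z k x)"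
          by (rule degenerate_eq[OF ZO d True ry app_in[OF M(1)[OF g0S] d rx]])
        then show ?thesis using g0S by blast
      next
        case False
        \<comment> \<open>Both sections lie in \<open>Z\<close> and \<open>g\<close> carries one to
          the other, so this one nondegenerate stage puts \<open>g\<close> into the
          stabiliser.\<close>
        have gS: "g \<in> S" using jn[OF d ry] g(2) by (intro SI[OF g(1) d False app_in[OF j d rx] jn[OF d rx]]) simp
        have "res Z k y = app (M g) d (res Z k x)"
          using M(2)[OF gS d rx] g(2) by (intro jD[OF d ry app_in[OF M(1)[OF gS] d rx]]) simp
        then show ?thesis using gS by blast
      qed
    qed
  qed
  with j con show ?thesis by blast
qed

lemma galois_terminal:
  assumes gD: "inverse_image \<gamma> = D" shows "\<exists>T. galois_object E \<gamma> T"
  using connected_torsor_galois[OF gD] terminal_connected_torsor[OF const_singleton_terminal] by blast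

lemma galois_pair_dominated:
  assumes gD: "inverse_image \<gamma> = D" and A: "galois_object E \<gamma> A" and B: "galois_object E \<gamma> B"
  shows "\<exists>Z u v. galois_object E \<gamma> Z \<and> u \<in> hom E Z A \<and> v \<in> hom E Z B"
proof -
  obtain G F where TA: "torsor A G F" using galois_connected_torsor[OF gD A] by blast
  obtain G' F' where TB: "torsor B G' F'" using galois_connected_torsor[OF gD B] by blast
  obtain P p q where P: "sec_product A B P p q" by (rule product_exists[OF torsor_Obj[OF TA] torsor_Obj[OF TB]])
  obtain H M where TP: "torsor P H M" using torsor_product[OF TA TB P] by blast
  obtain Z j S N where j: "j \<in> hom E Z P" and con: "sec_connected Z" and TZ: "torsor Z S N"
    using torsor_component[OF TP] by blast
  show ?thesis
    using connected_torsor_galois[OF gD con TZ] E.Comp_in_hom[OF j sec_productD(1)[OF P]]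
      E.Comp_in_hom[OF j sec_productD(2)[OF P]] by blast
qed

end

section \<open>The sections of a Grothendieck topos\<close>

lemma (in category) iso_left_cancel:
  assumes i: "i \<in> hom C B D" "iso C i" and f: "f \<in> hom C A B" and g: "g \<in> hom C A B" and eq: "i \<cdot> f = i \<cdot> g"
  shows "f = g"
proof -
  obtain j where j: "j \<in> hom C D B" "j \<cdot> i = Id C B" using i homD[OF i(1)] by (auto simp: iso_def)
  have "j \<cdot> (i \<cdot> f) = j \<cdot> (i \<cdot> g)" using eq by simp
  then show ?thesis using hom_assoc[OF f i(1) j(1)] hom_assoc[OF g i(1) j(1)] j(2) hom_Id(2)[OF f] hom_Id(2)[OF g] by simp
qed

lemma (in category) iso_right_cancel:
  assumes i: "i \<in> hom C A B" "iso C i" and f: "f \<in> hom C B D" and g: "g \<in> hom C B D" and eq: "f \<cdot> i = g \<cdot> i"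
  shows "f = g"
proof -
  obtain j where j: "j \<in> hom C B A" "i \<cdot> j = Id C B" using i homD[OF i(1)] by (auto simp: iso_def)
  have "(f \<cdot> i) \<cdot> j = (g \<cdot> i) \<cdot> j" using eq by simp
  then show ?thesis using hom_assoc[OF j(1) i(1) f] hom_assoc[OF j(1) i(1) g] j(2) hom_Id(1)[OF f] hom_Id(1)[OF g] by simp
qed

text \<open>No triangle identities are available, so fullness combines both transformations:
  naturality of \<open>\<eta>\<close> shows that the proposed preimage and \<open>h\<close> have the
  same image under \<open>G\<close>, and naturality of \<open>\<epsilon>\<close> then makes them
  equal before \<open>G\<close> is applied.\<close>

lemma equivalence_fully_faithful:
  assumes "equivalent_categories C D"
  obtains F where "cfunctor C D F"
    "\<And>X Y f g. f \<in> hom C X Y \<Longrightarrow> g \<in> hom C X Y \<Longrightarrow> AMap F f = AMap F g \<Longrightarrow> f = g"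
    "\<And>X Y h. X \<in> Obj C \<Longrightarrow> Y \<in> Obj C \<Longrightarrow> h \<in> hom D (OMap F X) (OMap F Y) \<Longrightarrow> \<exists>f \<in> hom C X Y. AMap F f = h"
    "\<And>M. M \<in> Obj D \<Longrightarrow> \<exists>X \<in> Obj C. \<exists>i \<in> hom D (OMap F X) M. iso D i"
proof -
  obtain F G \<eta> \<epsilon> where F: "cfunctor C D F" and G: "cfunctor D C G"
    and n: "nat_trans C C id_functor (G \<circ>\<^sub>F F) \<eta>" and ni: "\<And>A. A \<in> Obj C \<Longrightarrow> iso C (\<eta> A)"
    and e: "nat_trans D D (F \<circ>\<^sub>F G) id_functor \<epsilon>" and ei: "\<And>B. B \<in> Obj D \<Longrightarrow> iso D (\<epsilon> B)"
    using assms unfolding equivalent_categories_def by blast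
  interpret F: cfunctor C D F by (rule F)
  interpret G: cfunctor D C G by (rule G)
  have n1: "\<eta> A \<in> hom C A (OMap G (OMap F A))" if "A \<in> Obj C" for A
    using n that by (simp add: nat_trans_def id_functor_def comp_functor_def)
  have n2: "AMap G (AMap F f) \<cdot>\<^bsub>C\<^esub> \<eta> A = \<eta> B \<cdot>\<^bsub>C\<^esub> f" if "f \<in> hom C A B" for A B f
    using n that by (auto simp: nat_trans_def id_functor_def comp_functor_def hom_def)
  have e1: "\<epsilon> B \<in> hom D (OMap F (OMap G B)) B" if "B \<in> Obj D" for B
    using e that by (simp add: nat_trans_def id_functor_def comp_functor_def)
  have e2: "g \<cdot>\<^bsub>D\<^esub> \<epsilon> A = \<epsilon> B \<cdot>\<^bsub>D\<^esub> AMap F (AMap G g)" if "g \<in> hom D A B" for A B g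
    using e that by (auto simp: nat_trans_def id_functor_def comp_functor_def hom_def)
  show thesis
  proof (rule that[OF F])
    fix X Y f g assume f: "f \<in> hom C X Y" and g: "g \<in> hom C X Y" and eq: "AMap F f = AMap F g"
    note Y = F.C.homD(5)[OF f]
    have "\<eta> Y \<cdot>\<^bsub>C\<^esub> f = \<eta> Y \<cdot>\<^bsub>C\<^esub> g" using n2[OF f] n2[OF g] eq by simp
    then show "f = g" by (rule F.C.iso_left_cancel[OF n1[OF Y] ni[OF Y] f g])
  next
    fix X Y h assume X: "X \<in> Obj C" and Y: "Y \<in> Obj C" and h: "h \<in> hom D (OMap F X) (OMap F Y)"
    \<comment> \<open>\<open>i\<close> is the inverse of \<open>\<eta> Y\<close>; conjugating
      \<open>G h\<close> by the unit gives the candidate for a preimage of \<open>h\<close>.\<close>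
    obtain i where i: "i \<in> hom C (OMap G (OMap F Y)) Y" "\<eta> Y \<cdot>\<^bsub>C\<^esub> i = Id C (OMap G (OMap F Y))"
      using ni[OF Y] F.C.homD[OF n1[OF Y]] by (auto simp: iso_def)
    note Gh = G.AMap_in_hom[OF h]
    have Ghn: "AMap G h \<cdot>\<^bsub>C\<^esub> \<eta> X \<in> hom C X (OMap G (OMap F Y))" by (rule F.C.Comp_in_hom[OF n1[OF X] Gh])
    let ?f = "i \<cdot>\<^bsub>C\<^esub> (AMap G h \<cdot>\<^bsub>C\<^esub> \<eta> X)"
    have f: "?f \<in> hom C X Y" by (rule F.C.Comp_in_hom[OF Ghn i(1)])
    have "AMap G (AMap F ?f) \<cdot>\<^bsub>C\<^esub> \<eta> X = AMap G h \<cdot>\<^bsub>C\<^esub> \<eta> X"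
      using n2[OF f] F.C.hom_assoc[OF Ghn i(1) n1[OF Y]] i(2) F.C.hom_Id(2)[OF Ghn] by simp
    then have GG: "AMap G (AMap F ?f) = AMap G h"
      by (rule F.C.iso_right_cancel[OF n1[OF X] ni[OF X] G.AMap_in_hom[OF F.AMap_in_hom[OF f]] Gh])
    note FX = F.OMap_in_Obj[OF X]
    have "AMap F ?f \<cdot>\<^bsub>D\<^esub> \<epsilon> (OMap F X) = h \<cdot>\<^bsub>D\<^esub> \<epsilon> (OMap F X)"
      using e2[OF F.AMap_in_hom[OF f]] e2[OF h] GG by simp
    then have "AMap F ?f = h" by (rule F.D.iso_right_cancel[OF e1[OF FX] ei[OF FX] F.AMap_in_hom[OF f] h])
    with f show "\<exists>f \<in> hom C X Y. AMap F f = h" by blast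
  next
    fix M assume "M \<in> Obj D"
    then show "\<exists>X \<in> Obj C. \<exists>i \<in> hom D (OMap F X) M. iso D i"
      using G.OMap_in_Obj e1 ei by blast
  qed
qed

section \<open>Sheaves on a site in terms of elements\<close>

lemma op_simps: "Obj (op_category C) = Obj C" "Arr (op_category C) = Arr C" "Dom (op_category C) = Cod C"
  "Cod (op_category C) = Dom C" "Id (op_category C) = Id C" "f \<cdot>\<^bsub>op_category C\<^esub> g = g \<cdot>\<^bsub>C\<^esub> f"
  by (simp_all add: op_category_def)

lemma hom_op: "hom (op_category C) A B = hom C B A"
  by (auto simp: hom_def op_simps)

lemma category_op:
  assumes "category C" shows "category (op_category C)"
proof -
  interpret category C by (rule assms)
  show ?thesis
    by unfold_locales
      (auto simp: op_simps hom_op Dom_in_Obj Cod_in_Obj Id_in_hom Comp_Id Id_Comp Comp_assoc intro: Comp_in_hom)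
qed

lemma Sets_rule_in: "g \<in> hom Sets X Y \<Longrightarrow> x \<in> X \<Longrightarrow> rule g x \<in> Y"
  by (auto simp: hom_Sets)

lemma Sets_rule_Comp: "f \<in> hom Sets X Y \<Longrightarrow> g \<in> hom Sets Y Z \<Longrightarrow> x \<in> X \<Longrightarrow> rule (g \<cdot>\<^bsub>Sets\<^esub> f) x = rule g (rule f x)"
  by (auto simp: hom_Sets Comp_Sets)

lemma Sets_ext:
  assumes f: "f \<in> hom Sets X Y" and g: "g \<in> hom Sets X Y" and eq: "\<And>x. x \<in> X \<Longrightarrow> rule f x = rule g x"
  shows "f = g"
proof -
  obtain \<phi> \<psi> where "\<phi> \<in> X \<rightarrow>\<^sub>E Y" "\<psi> \<in> X \<rightarrow>\<^sub>E Y" "f = Arrow X \<phi> Y" "g = Arrow X \<psi> Y"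
    using f g by (auto simp: hom_Sets)
  then show ?thesis using eq PiE_ext[of \<phi> X "\<lambda>_. Y" \<psi>] by simp
qed

lemma Sets_Id_rule: "x \<in> X \<Longrightarrow> rule (Id Sets X) x = x"
  by (simp add: Sets_def)

text \<open>That \<open>Sets\<close> is a category is carried as an assumption; it is later
  discharged by the inverse image functor, whose source is \<open>Sets\<close>.\<close>

context
  fixes C :: "('u, 'u) category" and J :: "'u \<Rightarrow> 'u set set"
  assumes top: "grothendieck_topology C J" and catSets: "category (Sets :: ('u set, 'u map) category)"
begin

interpretation grothendieck_topology C J by (rule top)

abbreviation (input) Sh :: "(('u, 'u, 'u set, 'u map) cfunctor,
    (('u, 'u, 'u set, 'u map) cfunctor, 'u \<Rightarrow> 'u map) arrow) category" where
  "Sh \<equiv> Sheaves C J"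

lemma Obj_Sheaves: "M \<in> Obj Sh \<longleftrightarrow> cfunctor (op_category C) Sets M \<and> OMap M \<in> extensional (Obj C) \<and>
    AMap M \<in> extensional (Arr C) \<and> is_sheaf C J M"
  by (simp add: Sheaves_def full_subcategory_def functor_category_def Let_def op_simps)

lemma hom_Sheaves: "\<alpha> \<in> hom Sh M N \<longleftrightarrow> M \<in> Obj Sh \<and> N \<in> Obj Sh \<and>
    (\<exists>\<beta>. \<alpha> = Arrow M \<beta> N \<and> nat_trans (op_category C) Sets M N \<beta> \<and> \<beta> \<in> extensional (Obj C))"
  by (auto simp: Sheaves_def full_subcategory_def functor_category_def Let_def op_simps hom_def)

lemma Comp_Sheaves: "\<beta> \<cdot>\<^bsub>Sh\<^esub> \<alpha> =
    Arrow (source \<alpha>) (\<lambda>c\<in>Obj C. rule \<beta> c \<cdot>\<^bsub>Sets\<^esub> rule \<alpha> c) (target \<beta>)"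
  by (simp add: Sheaves_def full_subcategory_def functor_category_def Let_def op_simps)

lemma Id_Sheaves: "Id Sh M = Arrow M (\<lambda>c\<in>Obj C. Id Sets (OMap M c)) M"
  by (simp add: Sheaves_def full_subcategory_def functor_category_def Let_def op_simps)

lemma sheaf_restriction: "M \<in> Obj Sh \<Longrightarrow> k \<in> hom C d c \<Longrightarrow> AMap M k \<in> hom Sets (OMap M c) (OMap M d)"
  using cfunctor.AMap_in_hom[of "op_category C" Sets M] by (simp add: Obj_Sheaves hom_op)

lemma sheaf_morphism_component:
  "\<alpha> \<in> hom Sh M N \<Longrightarrow> c \<in> Obj C \<Longrightarrow> rule \<alpha> c \<in> hom Sets (OMap M c) (OMap N c)"
  by (auto simp: hom_Sheaves nat_trans_def op_simps)

lemma sheaf_morphism_natural: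
  assumes a: "\<alpha> \<in> hom Sh M N" and k: "k \<in> hom C d c" and x: "x \<in> OMap M c"
  shows "rule (rule \<alpha> d) (rule (AMap M k) x) = rule (AMap N k) (rule (rule \<alpha> c) x)"
proof -
  have M: "M \<in> Obj Sh" and N: "N \<in> Obj Sh" using a by (auto simp: hom_Sheaves)
  note d = homD(4)[OF k] and c = homD(5)[OF k]
  obtain \<beta> where "\<alpha> = Arrow M \<beta> N" "nat_trans (op_category C) Sets M N \<beta>" using a by (auto simp: hom_Sheaves)
  then have "AMap N k \<cdot>\<^bsub>Sets\<^esub> rule \<alpha> c = rule \<alpha> d \<cdot>\<^bsub>Sets\<^esub> AMap M k"
    using homD(1-3)[OF k] by (auto simp: nat_trans_def op_simps)
  then show ?thesis
    using Sets_rule_Comp[OF sheaf_restriction[OF M k] sheaf_morphism_component[OF a d] x]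
      Sets_rule_Comp[OF sheaf_morphism_component[OF a c] sheaf_restriction[OF N k] x] by simp
qed

lemma sheaf_morphism_ext:
  assumes a: "\<alpha> \<in> hom Sh M N" and b: "\<beta> \<in> hom Sh M N"
    and eq: "\<And>c x. c \<in> Obj C \<Longrightarrow> x \<in> OMap M c \<Longrightarrow> rule (rule \<alpha> c) x = rule (rule \<beta> c) x"
  shows "\<alpha> = \<beta>"
proof -
  have "rule \<alpha> = rule \<beta>"
  proof (rule extensionalityI)
    show "rule \<alpha> \<in> extensional (Obj C)" "rule \<beta> \<in> extensional (Obj C)" using a b by (auto simp: hom_Sheaves)
    fix c assume c: "c \<in> Obj C"
    show "rule \<alpha> c = rule \<beta> c"
      by (rule Sets_ext[OF sheaf_morphism_component[OF a c] sheaf_morphism_component[OF b c] eq[OF c]])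
  qed
  then show ?thesis using a b by (auto simp: hom_Sheaves)
qed

lemma sheaf_morphismI:
  assumes M: "M \<in> Obj Sh" and N: "N \<in> Obj Sh"
    and cl: "\<And>c x. c \<in> Obj C \<Longrightarrow> x \<in> OMap M c \<Longrightarrow> \<phi> c x \<in> OMap N c"
    and nat: "\<And>c d k x. k \<in> hom C d c \<Longrightarrow> x \<in> OMap M c \<Longrightarrow> \<phi> d (rule (AMap M k) x) = rule (AMap N k) (\<phi> c x)"
  shows "\<exists>\<alpha> \<in> hom Sh M N. \<forall>c \<in> Obj C. \<forall>x \<in> OMap M c. rule (rule \<alpha> c) x = \<phi> c x"
proof -
  define \<beta> where "\<beta> = (\<lambda>c\<in>Obj C. Arrow (OMap M c) (\<lambda>x\<in>OMap M c. \<phi> c x) (OMap N c))"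
  have small: "small (OMap L c)" if "L \<in> Obj Sh" "c \<in> Obj C" for L c
    using cfunctor.OMap_in_Obj[of "op_category C" Sets L c] that by (simp add: Obj_Sheaves op_simps Obj_Sets)
  have bh: "\<beta> c \<in> hom Sets (OMap M c) (OMap N c)" if "c \<in> Obj C" for c
    using that cl small[OF M] small[OF N] by (auto simp: \<beta>_def hom_Sets)
  have "AMap N k \<cdot>\<^bsub>Sets\<^esub> \<beta> (Cod C k) = \<beta> (Dom C k) \<cdot>\<^bsub>Sets\<^esub> AMap M k" if "k \<in> Arr C" for k
  proof -
    have k: "k \<in> hom C (Dom C k) (Cod C k)" using that by (rule homI)
    note d = homD(4)[OF k] and c = homD(5)[OF k]
    note rM = sheaf_restriction[OF M k] and rN = sheaf_restriction[OF N k]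
    show ?thesis
    proof (rule Sets_ext[OF category.Comp_in_hom[OF catSets bh[OF c] rN] category.Comp_in_hom[OF catSets rM bh[OF d]]])
      fix x assume x: "x \<in> OMap M (Cod C k)"
      show "rule (AMap N k \<cdot>\<^bsub>Sets\<^esub> \<beta> (Cod C k)) x = rule (\<beta> (Dom C k) \<cdot>\<^bsub>Sets\<^esub> AMap M k) x"
        using Sets_rule_Comp[OF bh[OF c] rN x] Sets_rule_Comp[OF rM bh[OF d] x] nat[OF k x] x c d Sets_rule_in[OF rM x]
        by (simp add: \<beta>_def)
    qed
  qed
  then have "nat_trans (op_category C) Sets M N \<beta>"
    using M N bh by (auto simp: nat_trans_def Obj_Sheaves op_simps)
  then have "Arrow M \<beta> N \<in> hom Sh M N" using M N by (simp add: hom_Sheaves \<beta>_def)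
  then show ?thesis by (intro bexI[of _ "Arrow M \<beta> N"]) (auto simp: \<beta>_def)
qed

lemma sheaf_object_data:
  assumes M: "M \<in> Obj Sh" shows "sheaf_data (OMap M) (\<lambda>k. rule (AMap M k))"
proof -
  interpret M: cfunctor "op_category C" Sets M using M by (simp add: Obj_Sheaves)
  note r = sheaf_restriction[OF M]
  have sh: "\<exists>!z. z \<in> OMap M c \<and> (\<forall>f \<in> S. rule (AMap M f) z = y f)"
    if "c \<in> Obj C" "S \<in> J c" "\<forall>f \<in> S. y f \<in> OMap M (Dom C f)"
      "\<forall>f \<in> S. \<forall>g \<in> Arr C. Cod C g = Dom C f \<longrightarrow> rule (AMap M g) (y f) = y (f \<cdot>\<^bsub>C\<^esub> g)" for c S y
    using M that by (auto simp: Obj_Sheaves is_sheaf_def matching_family_def)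
  show ?thesis
    unfolding sheaf_data_def
  proof (intro conjI ballI allI impI)
    show "small (OMap M c)" if "c \<in> Obj C" for c using M.OMap_in_Obj that by (simp add: op_simps Obj_Sets)
    show "rule (AMap M k) x \<in> OMap M d" if "x \<in> OMap M c" "k \<in> hom C d c" for c d k x
      using Sets_rule_in[OF r] that by blast
    show "rule (AMap M (Id C c)) x = x" if "c \<in> Obj C" "x \<in> OMap M c" for c x
      using M.AMap_Id that by (simp add: op_simps Sets_Id_rule)
    show "rule (AMap M (k \<cdot>\<^bsub>C\<^esub> l)) x = rule (AMap M l) (rule (AMap M k) x)"
      if x: "x \<in> OMap M c" and kl: "k \<in> hom C d c \<and> l \<in> hom C e d" for c d e k l x
      using M.AMap_Comp[of k c d l e] kl Sets_rule_Comp[OF r[of k d c] r[of l e d] x] by (simp add: hom_op op_simps)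
    show "\<exists>!z. z \<in> OMap M c \<and> (\<forall>f \<in> S. rule (AMap M f) z = y f)"
      if "c \<in> Obj C" "S \<in> J c" "(\<forall>f \<in> S. y f \<in> OMap M (Dom C f)) \<and>
      (\<forall>f \<in> S. \<forall>g \<in> Arr C. Cod C g = Dom C f \<longrightarrow> rule (AMap M g) (y f) = y (f \<cdot>\<^bsub>C\<^esub> g))" for c S y
      by (rule sh) (use that in simp_all)
  qed
qed

text \<open>The functor is cut off outside the objects and arrows of the site, as the functor
  category demands, hence agreement with the given data is asserted only inside.\<close>

lemma sheaf_data_object:
  fixes T :: "'u \<Rightarrow> 'u set"
  assumes T: "sheaf_data T r"
  shows "\<exists>M \<in> Obj Sh. (\<forall>c \<in> Obj C. OMap M c = T c) \<and> (\<forall>c d k. \<forall>x \<in> T c. k \<in> hom C d c \<longrightarrow> rule (AMap M k) x = r k x)"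
proof -
  define M :: "('u, 'u, 'u set, 'u map) cfunctor" where
    "M = \<lparr>OMap = (\<lambda>c\<in>Obj C. T c), AMap = (\<lambda>k\<in>Arr C. Arrow (T (Cod C k)) (\<lambda>x\<in>T (Cod C k). r k x) (T (Dom C k)))\<rparr>"
  note t = sheaf_dataD[OF T]
  have O: "OMap M c = T c" if "c \<in> Obj C" for c using that by (simp add: M_def)
  have A: "AMap M k = Arrow (T c) (\<lambda>x\<in>T c. r k x) (T d)" if "k \<in> hom C d c" for k c d
    using that by (auto simp: M_def hom_def)
  have Ah: "AMap M k \<in> hom Sets (T c) (T d)" if k: "k \<in> hom C d c" for k c d
    using t(1)[OF homD(4)[OF k]] t(1)[OF homD(5)[OF k]] t(2)[OF k] A[OF k] by (auto simp: hom_Sets)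
  have Ar: "rule (AMap M k) x = r k x" if "k \<in> hom C d c" "x \<in> T c" for k c d x using A[OF that(1)] that(2) by simp
  have f: "cfunctor (op_category C) Sets M"
  proof (intro cfunctor.intro cfunctor_axioms.intro category_op catSets)
    show "category C" by unfold_locales
    show "OMap M c \<in> Obj Sets" if "c \<in> Obj (op_category C)" for c
      using that t(1) O by (simp add: op_simps Obj_Sets)
    show "AMap M k \<in> hom Sets (OMap M c) (OMap M d)" if "k \<in> hom (op_category C) c d" for c d k
      using that Ah O homD(4,5) by (simp add: hom_op)
    show "AMap M (Id (op_category C) c) = Id Sets (OMap M c)" if "c \<in> Obj (op_category C)" for c
    proof -
      have c: "c \<in> Obj C" using that by (simp add: op_simps)
      have "(\<lambda>x\<in>T c. r (Id C c) x) = (\<lambda>x\<in>T c. x)" using t(3)[OF c] by (rule restrict_ext)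
      then show ?thesis using A[OF Id_in_hom[OF c]] O[OF c] by (simp add: op_simps Sets_def)
    qed
    show "AMap M (l \<cdot>\<^bsub>op_category C\<^esub> k) = AMap M l \<cdot>\<^bsub>Sets\<^esub> AMap M k"
      if "k \<in> hom (op_category C) c d" "l \<in> hom (op_category C) d e" for c d e k l
    proof -
      have k: "k \<in> hom C d c" and l: "l \<in> hom C e d" using that by (simp_all add: hom_op)
      have "(\<lambda>x\<in>T c. r (k \<cdot>\<^bsub>C\<^esub> l) x) = (\<lambda>x\<in>T c. (\<lambda>x\<in>T d. r l x) ((\<lambda>x\<in>T c. r k x) x))"
        using t(4)[OF k l] t(2)[OF k] by (intro restrict_ext) simp
      then show ?thesis using A[OF Comp_in_hom[OF l k]] A[OF k] A[OF l] by (simp add: op_simps Comp_Sets)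
    qed
  qed
  have "is_sheaf C J M"
    unfolding is_sheaf_def
  proof (intro ballI allI impI)
    fix c S y assume c: "c \<in> Obj C" and S: "S \<in> J c" and m: "matching_family C M S y"
    have h: "f \<in> hom C (Dom C f) c" if "f \<in> S" for f
      using covering_sieve[OF c S] that by (auto simp: sieve_def hom_def)
    have y: "\<forall>f \<in> S. y f \<in> T (Dom C f)" using m O homD(4)[OF h] by (auto simp: matching_family_def)
    have "\<exists>!z. z \<in> T c \<and> (\<forall>f \<in> S. r f z = y f)"
    proof (rule t(5)[OF c S y], intro ballI impI)
      fix f g assume f: "f \<in> S" and g: "g \<in> Arr C" "Cod C g = Dom C f"
      then have "g \<in> hom C (Dom C g) (Dom C f)" by (simp add: hom_def)
      then have "rule (AMap M g) (y f) = r g (y f)" using Ar y f by blast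
      then show "r g (y f) = y (f \<cdot>\<^bsub>C\<^esub> g)" using m f g by (auto simp: matching_family_def)
    qed
    moreover have "z \<in> OMap M c \<and> (\<forall>f \<in> S. rule (AMap M f) z = y f) \<longleftrightarrow> z \<in> T c \<and> (\<forall>f \<in> S. r f z = y f)" for z
      using O[OF c] Ar[OF h] by auto
    ultimately show "\<exists>!z. z \<in> OMap M c \<and> (\<forall>f \<in> S. rule (AMap M f) z = y f)" by simp
  qed
  then have "M \<in> Obj Sh" using f unfolding Obj_Sheaves by (simp add: M_def)
  then show ?thesis using O Ar by blast
qed

lemma sheaf_iso_bij:
  assumes i: "\<alpha> \<in> hom Sh M N" "iso Sh \<alpha>" and c: "c \<in> Obj C"
  shows "bij_betw (rule (rule \<alpha> c)) (OMap M c) (OMap N c)"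
proof -
  have "Dom Sh \<alpha> = M" "Cod Sh \<alpha> = N" using i(1) by (auto simp: hom_def)
  then obtain \<beta> where b: "\<beta> \<in> hom Sh N M" "\<beta> \<cdot>\<^bsub>Sh\<^esub> \<alpha> = Id Sh M" "\<alpha> \<cdot>\<^bsub>Sh\<^esub> \<beta> = Id Sh N"
    using i(2) by (auto simp: iso_def)
  note a1 = sheaf_morphism_component[OF i(1) c] and b1 = sheaf_morphism_component[OF b(1) c]
  have "rule \<beta> c \<cdot>\<^bsub>Sets\<^esub> rule \<alpha> c = Id Sets (OMap M c)"
    using arg_cong[OF b(2), of "\<lambda>w. rule w c"] c by (simp add: Comp_Sheaves Id_Sheaves)
  then have 1: "rule (rule \<beta> c) (rule (rule \<alpha> c) x) = x" if "x \<in> OMap M c" for x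
    using Sets_rule_Comp[OF a1 b1 that] Sets_Id_rule[OF that] by simp
  have "rule \<alpha> c \<cdot>\<^bsub>Sets\<^esub> rule \<beta> c = Id Sets (OMap N c)"
    using arg_cong[OF b(3), of "\<lambda>w. rule w c"] c by (simp add: Comp_Sheaves Id_Sheaves)
  then have 2: "rule (rule \<alpha> c) (rule (rule \<beta> c) x) = x" if "x \<in> OMap N c" for x
    using Sets_rule_Comp[OF b1 a1 that] Sets_Id_rule[OF that] by simp
  show ?thesis
    by (rule bij_betw_byWitness[of _ "rule (rule \<beta> c)"]) (use 1 2 Sets_rule_in[OF a1] Sets_rule_in[OF b1] in auto)
qed

text \<open>The sections of \<open>X\<close> are those of the sheaf to which the equivalence sends
  it. Constructed sheaves are represented in \<open>E\<close> by essential surjectivity, and arrows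
  correspond because the equivalence is full and faithful.\<close>

lemma sheaf_equivalence_sections:
  fixes E :: "('o, 'a) category"
  assumes U: "grothendieck_universe TYPE('u)" and small: "small (Arr C)" and eq: "equivalent_categories E Sh"
  shows "\<exists>Sec res app. topos_sections E C J Sec res app"
proof (rule equivalence_fully_faithful[OF eq])
  fix F assume F: "cfunctor E Sh F"
    and faithful: "\<And>X Y f g. f \<in> hom E X Y \<Longrightarrow> g \<in> hom E X Y \<Longrightarrow> AMap F f = AMap F g \<Longrightarrow> f = g"
    and full: "\<And>X Y h. X \<in> Obj E \<Longrightarrow> Y \<in> Obj E \<Longrightarrow> h \<in> hom Sh (OMap F X) (OMap F Y) \<Longrightarrow> \<exists>f \<in> hom E X Y. AMap F f = h"
    and ess: "\<And>M. M \<in> Obj Sh \<Longrightarrow> \<exists>X \<in> Obj E. \<exists>i \<in> hom Sh (OMap F X) M. iso Sh i"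
  interpret F: cfunctor E Sh F by (rule F)
  have "topos_sections E C J (\<lambda>X. OMap (OMap F X)) (\<lambda>X k. rule (AMap (OMap F X) k)) (\<lambda>f c. rule (rule (AMap F f) c))"
  proof (intro topos_sections.intro topos_sections_axioms.intro F.C.category_axioms top)
    show "sheaf_data (OMap (OMap F X)) (\<lambda>k. rule (AMap (OMap F X) k))" if "X \<in> Obj E" for X
      by (rule sheaf_object_data[OF F.OMap_in_Obj[OF that]])
    show "rule (rule (AMap F f) c) x \<in> OMap (OMap F Y) c"
      if "f \<in> hom E X Y" "c \<in> Obj C" "x \<in> OMap (OMap F X) c" for f X Y c x
      by (rule Sets_rule_in[OF sheaf_morphism_component[OF F.AMap_in_hom[OF that(1)] that(2)] that(3)])
    show "rule (rule (AMap F f) d) (rule (AMap (OMap F X) k) x) = rule (AMap (OMap F Y) k) (rule (rule (AMap F f) c) x)"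
      if "f \<in> hom E X Y" "k \<in> hom C d c" "x \<in> OMap (OMap F X) c" for f X Y c d k x
      by (rule sheaf_morphism_natural[OF F.AMap_in_hom[OF that(1)] that(2,3)])
    show "rule (rule (AMap F (Id E X)) c) x = x" if "X \<in> Obj E" "c \<in> Obj C" "x \<in> OMap (OMap F X) c" for X c x
      using F.AMap_Id[OF that(1)] that by (simp add: Id_Sheaves Sets_Id_rule)
    show "rule (rule (AMap F (g \<cdot>\<^bsub>E\<^esub> f)) c) x = rule (rule (AMap F g) c) (rule (rule (AMap F f) c) x)"
      if f: "f \<in> hom E X Y" and g: "g \<in> hom E Y Z" and c: "c \<in> Obj C" and x: "x \<in> OMap (OMap F X) c" for f g X Y Z c x
      using F.AMap_Comp[OF f g] c
        Sets_rule_Comp[OF sheaf_morphism_component[OF F.AMap_in_hom[OF f] c] sheaf_morphism_component[OF F.AMap_in_hom[OF g] c] x]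
      by (simp add: Comp_Sheaves)
    show "f = g" if "f \<in> hom E X Y" "g \<in> hom E X Y"
      "\<And>c x. c \<in> Obj C \<Longrightarrow> x \<in> OMap (OMap F X) c \<Longrightarrow> rule (rule (AMap F f) c) x = rule (rule (AMap F g) c) x" for f g X Y
      by (rule faithful[OF that(1,2)], rule sheaf_morphism_ext[OF F.AMap_in_hom[OF that(1)] F.AMap_in_hom[OF that(2)] that(3)])
    show "\<exists>f \<in> hom E X Y. \<forall>c \<in> Obj C. \<forall>x \<in> OMap (OMap F X) c. rule (rule (AMap F f) c) x = \<phi> c x"
      if X: "X \<in> Obj E" and Y: "Y \<in> Obj E"
        and cl: "\<And>c x. c \<in> Obj C \<Longrightarrow> x \<in> OMap (OMap F X) c \<Longrightarrow> \<phi> c x \<in> OMap (OMap F Y) c"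
        and nat: "\<And>c d k x. k \<in> hom C d c \<Longrightarrow> x \<in> OMap (OMap F X) c \<Longrightarrow>
          \<phi> d (rule (AMap (OMap F X) k) x) = rule (AMap (OMap F Y) k) (\<phi> c x)" for X Y \<phi>
      using sheaf_morphismI[OF F.OMap_in_Obj[OF X] F.OMap_in_Obj[OF Y] cl nat] full[OF X Y] by metis
    show "\<exists>X \<in> Obj E. \<exists>\<beta>. (\<forall>c \<in> Obj C. bij_betw (\<beta> c) (OMap (OMap F X) c) (T c)) \<and>
        (\<forall>c d k. \<forall>x \<in> OMap (OMap F X) c. k \<in> hom C d c \<longrightarrow> \<beta> d (rule (AMap (OMap F X) k) x) = r k (\<beta> c x))"
      if T: "sheaf_data T r" for T :: "'u \<Rightarrow> 'u set" and r
    proof -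
      obtain M where M: "M \<in> Obj Sh" "\<And>c. c \<in> Obj C \<Longrightarrow> OMap M c = T c"
        "\<And>c d k x. x \<in> T c \<Longrightarrow> k \<in> hom C d c \<Longrightarrow> rule (AMap M k) x = r k x" using sheaf_data_object[OF T] by blast
      obtain X i where X: "X \<in> Obj E" and i: "i \<in> hom Sh (OMap F X) M" "iso Sh i" using ess[OF M(1)] by blast
      note b = sheaf_iso_bij[OF i]
      have "rule (rule i d) (rule (AMap (OMap F X) k) x) = r k (rule (rule i c) x)"
        if x: "x \<in> OMap (OMap F X) c" and k: "k \<in> hom C d c" for c d k x
        using sheaf_morphism_natural[OF i(1) k x] M(3)[OF _ k] M(2)[OF homD(5)[OF k]] bij_betw_apply[OF b[OF homD(5)[OF k]] x] by simp
      then show ?thesis using X b M(2) by (intro bexI[OF _ X] exI[of _ "\<lambda>c. rule (rule i c)"]) auto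
    qed
    show "Pow X \<prec> (UNIV :: 'u set)" if "small X" for X :: "'u set"
      using U that by (simp add: grothendieck_universe_def)
    obtain X :: "'u set" where "infinite X" using U by (auto simp: grothendieck_universe_def)
    then show "infinite (UNIV :: 'u set)" by (rule infinite_super[OF subset_UNIV])
    show "small (\<Union>i \<in> I. X i)" if "small I" "\<And>i. i \<in> I \<Longrightarrow> small (X i)" for I :: "'u set" and X :: "'u \<Rightarrow> 'u set"
      using U that by (simp add: grothendieck_universe_def)
    show "small (Arr C)" by (rule small)
  qed
  then show ?thesis by blast
qed

end

text \<open>The site, the sections and the left adjoint are existentially given and do not occur in
  the conclusions, so they are fixed here once and the results obtained for them are
  exported.\<close>

lemma galois_objects_cofiltered:
  fixes E :: "('o, 'a) category"
    and \<gamma> :: "('o, 'a, 'u set, 'u map) geometric_morphism"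
  assumes U: "grothendieck_universe TYPE('u)" and E: "grothendieck_topos TYPE('u) E"
    and g: "geometric_morphism E Sets \<gamma>" and con: "connected_topos E \<gamma>" and lc: "locally_connected_topos E \<gamma>"
  shows "\<exists>T. galois_object E \<gamma> T"
    and "galois_object E \<gamma> A \<Longrightarrow> galois_object E \<gamma> B \<Longrightarrow>
      \<exists>Z u v. galois_object E \<gamma> Z \<and> u \<in> hom E Z A \<and> v \<in> hom E Z B"
proof -
  have ff: "fully_faithful Sets E (inverse_image \<gamma>)" using con by (simp add: connected_topos_def)
  interpret D: cfunctor Sets E "inverse_image \<gamma>" using ff by (simp add: fully_faithful_def)
  obtain C :: "('u, 'u) category" and J where C: "small (Arr C)" "grothendieck_topology C J"
    "equivalent_categories E (Sheaves C J :: (('u, 'u, 'u set, 'u map) cfunctor,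
          (('u, 'u, 'u set, 'u map) cfunctor, 'u \<Rightarrow> 'u map) arrow) category)"
    using E by (auto simp: grothendieck_topos_def)
  obtain Sec res app where ts: "topos_sections E C J Sec res app"
    using sheaf_equivalence_sections[OF C(2) D.C.category_axioms U C(1,3)] by blast
  obtain K where K: "adjoint_functors E Sets K (inverse_image \<gamma>)" using lc by (auto simp: locally_connected_topos_def)
  interpret constant_objects E C J Sec res app K "inverse_image \<gamma>" "direct_image \<gamma>"
    using ts K g ff by (simp add: constant_objects_def constant_objects_axioms_def geometric_morphism_def)
  show "\<exists>T. galois_object E \<gamma> T" by (rule galois_terminal[OF refl])
  show "galois_object E \<gamma> A \<Longrightarrow> galois_object E \<gamma> B \<Longrightarrow>
      \<exists>Z u v. galois_object E \<gamma> Z \<and> u \<in> hom E Z A \<and> v \<in> hom E Z B"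
    by (rule galois_pair_dominated[OF refl])
qed

section \<open>Formal cells\<close>

lemma full_subcategory_simps:
  "Obj (full_subcategory C P) = {A \<in> Obj C. P A}"
  "Arr (full_subcategory C P) = {f \<in> Arr C. P (Dom C f) \<and> P (Cod C f)}"
  "Dom (full_subcategory C P) = Dom C" "Cod (full_subcategory C P) = Cod C" "Id (full_subcategory C P) = Id C"
  "Comp (full_subcategory C P) = Comp C"
  by (simp_all add: full_subcategory_def)

lemma hom_full_subcategory: "f \<in> hom (full_subcategory C P) A B \<longleftrightarrow> f \<in> hom C A B \<and> P A \<and> P B"
  by (auto simp: full_subcategory_def hom_def)

lemma category_full_subcategory:
  assumes "category C" shows "category (full_subcategory C P)"
proof -
  interpret category C by (rule assms)
  show ?thesis
    by unfold_locales
      (auto simp: hom_full_subcategory full_subcategory_simps Dom_in_Obj Cod_in_Obj Id_in_hom Comp_Id Id_Comp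
        Comp_assoc intro: Comp_in_hom)
qed

lemma formal_simps [simp]:
  "Obj (add_formal_cells C) = Obj C" "Arr (add_formal_cells C) = Arr C" "Dom (add_formal_cells C) = Dom C"
  "Cod (add_formal_cells C) = Cod C" "Id (add_formal_cells C) = Id C" "Comp (add_formal_cells C) = Comp C"
  "hom (add_formal_cells C) = hom C" "src (add_formal_cells C) = theta_src" "tgt (add_formal_cells C) = theta_tgt"
  "id_cell (add_formal_cells C) u = \<theta> u u"
  "vcomp (add_formal_cells C) \<beta> \<alpha> = \<theta> (theta_tgt \<beta>) (theta_src \<alpha>)"
  "hcomp (add_formal_cells C) \<beta> \<alpha> = \<theta> (theta_tgt \<beta> \<cdot>\<^bsub>C\<^esub> theta_tgt \<alpha>) (theta_src \<beta> \<cdot>\<^bsub>C\<^esub> theta_src \<alpha>)"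
  by (auto simp: add_formal_cells_def hom_def fun_eq_iff)

lemma in_formal_cells: "\<alpha> \<in> cells (add_formal_cells C) u v \<longleftrightarrow> (\<exists>A B. u \<in> hom C A B \<and> v \<in> hom C A B \<and> \<alpha> = \<theta> v u)"
  by (auto simp: cells_def add_formal_cells_def hom_def)

lemma in_formal_Cell: "\<alpha> \<in> Cell (add_formal_cells C) \<longleftrightarrow> (\<exists>A B u v. u \<in> hom C A B \<and> v \<in> hom C A B \<and> \<alpha> = \<theta> v u)"
  by (auto simp: add_formal_cells_def hom_def)

text \<open>A formal cell is determined by its source and target, so each law for cells reduces to a
  law for composition of arrows in \<open>C\<close>.\<close>

lemma formal_two_category:
  fixes C :: "('o, 'a) category" (structure)
  assumes "category C" shows "two_category (add_formal_cells C)"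
proof -
  interpret category C by (rule assms)
  have c: "category (add_formal_cells C)"
    by unfold_locales (auto simp: Dom_in_Obj Cod_in_Obj Id_in_hom Comp_Id Id_Comp Comp_assoc intro: Comp_in_hom)
  have id: "f \<cdot> Id C A = f" if "f \<in> Arr C" "Dom C f = A" for f A using Comp_Id that by blast
  have id': "Id C A \<cdot> f = f" if "f \<in> Arr C" "Cod C f = A" for f A using Id_Comp that by blast
  show ?thesis
  proof (intro two_category.intro c two_category_axioms.intro, unfold in_formal_cells in_formal_Cell formal_simps)
    show "\<exists>A B. u \<in> hom C A B \<and> u \<in> hom C A B \<and> \<theta> u u = \<theta> u u" if "u \<in> Arr C" for u
      using homI[OF that] by blast
    show "\<exists>A B. r \<cdot> u \<in> hom C A B \<and> s \<cdot> v \<in> hom C A B \<and>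
        \<theta> (theta_tgt \<beta> \<cdot> theta_tgt \<alpha>) (theta_src \<beta> \<cdot> theta_src \<alpha>) = \<theta> (s \<cdot> v) (r \<cdot> u)"
      if ex: "\<exists>A B. u \<in> hom C A B \<and> v \<in> hom C A B \<and> \<alpha> = \<theta> v u" "\<exists>A B. r \<in> hom C A B \<and> s \<in> hom C A B \<and> \<beta> = \<theta> s r"
        and cod: "Cod C u = Dom C r" for \<alpha> \<beta> u v r s
    proof -
      obtain A B D F where "u \<in> hom C A B" "v \<in> hom C A B" "r \<in> hom C D F" "s \<in> hom C D F" "\<alpha> = \<theta> v u" "\<beta> = \<theta> s r"
        using ex by blast
      moreover have "B = D" using cod calculation by (simp add: hom_def)
      ultimately show ?thesis using Comp_in_hom by (intro exI[of _ A] exI[of _ F]) auto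
    qed
    show "\<theta> (theta_tgt (\<theta> (theta_tgt \<delta> \<cdot> theta_tgt \<beta>) (theta_src \<delta> \<cdot> theta_src \<beta>)) \<cdot> theta_tgt \<alpha>)
        (theta_src (\<theta> (theta_tgt \<delta> \<cdot> theta_tgt \<beta>) (theta_src \<delta> \<cdot> theta_src \<beta>)) \<cdot> theta_src \<alpha>) =
      \<theta> (theta_tgt \<delta> \<cdot> theta_tgt (\<theta> (theta_tgt \<beta> \<cdot> theta_tgt \<alpha>) (theta_src \<beta> \<cdot> theta_src \<alpha>)))
        (theta_src \<delta> \<cdot> theta_src (\<theta> (theta_tgt \<beta> \<cdot> theta_tgt \<alpha>) (theta_src \<beta> \<cdot> theta_src \<alpha>)))"
      if "\<exists>A B. u \<in> hom C A B \<and> v \<in> hom C A B \<and> \<alpha> = \<theta> v u" "\<exists>A B. r \<in> hom C A B \<and> s \<in> hom C A B \<and> \<beta> = \<theta> s r"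
        "\<exists>A B. x \<in> hom C A B \<and> y \<in> hom C A B \<and> \<delta> = \<theta> y x" "Cod C u = Dom C r" "Cod C r = Dom C x" for \<alpha> \<beta> \<delta> u v r s x y
      using that by (auto simp: hom_def Comp_assoc)
  qed (auto simp: hom_def Dom_in_Obj Cod_in_Obj id id')
qed

text \<open>Spans over pairs of objects are enough: for F1 any span over the two domains works,
  because all parallel arrows are joined by an invertible cell, and for F2 any span over the two
  given vertices.\<close>

lemma formal_inversely_2_filtered:
  fixes C :: "('o, 'a) category" (structure)
  assumes "category C" and ne: "Obj C \<noteq> {}"
    and F0: "\<And>X Y. X \<in> Obj C \<Longrightarrow> Y \<in> Obj C \<Longrightarrow> \<exists>Z u v. u \<in> hom C Z X \<and> v \<in> hom C Z Y"
  shows "inversely_2_filtered (add_formal_cells C)"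
proof -
  interpret category C by (rule assms)
  have inv: "invertible_cell (add_formal_cells C) (\<theta> v u)" if "u \<in> hom C A B" "v \<in> hom C A B" for u v A B
    unfolding invertible_cell_def inverse_cells_def using that
    by (intro exI[of _ "\<theta> u v"]) (simp add: in_formal_cells in_formal_Cell, blast)
  show ?thesis
  proof (intro inversely_2_filtered.intro formal_two_category assms(1) inversely_2_filtered_axioms.intro,
      unfold formal_simps)
    show "Obj C \<noteq> {}" by (rule ne)
    show "\<exists>Z \<in> Obj C. (\<exists>u. u \<in> hom C Z X) \<and> (\<exists>v. v \<in> hom C Z Y)" if "X \<in> Obj C" "Y \<in> Obj C" for X Y
      using F0[OF that] homD(4) by blast
    show "\<exists>Z \<in> Obj C. \<exists>u \<in> hom C Z X. \<exists>v \<in> hom C Z Y. \<exists>\<gamma> \<in> cells (add_formal_cells C) (f \<cdot> u) (g \<cdot> v).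
        invertible_cell (add_formal_cells C) \<gamma>"
      if f: "f \<in> hom C X E" and g: "g \<in> hom C Y E" for f g X Y E
    proof -
      obtain Z u v where uv: "u \<in> hom C Z X" "v \<in> hom C Z Y" using F0[OF homD(4)[OF f] homD(4)[OF g]] by blast
      note fu = Comp_in_hom[OF uv(1) f] and gv = Comp_in_hom[OF uv(2) g]
      have "\<theta> (g \<cdot> v) (f \<cdot> u) \<in> cells (add_formal_cells C) (f \<cdot> u) (g \<cdot> v)"
        unfolding in_formal_cells using fu gv by blast
      then show ?thesis using inv[OF fu gv] uv homD(4)[OF uv(1)] by blast
    qed
    fix f g u\<^sub>1 v\<^sub>1 u\<^sub>2 v\<^sub>2 X Y E Z\<^sub>1 Z\<^sub>2 \<gamma>\<^sub>1 \<gamma>\<^sub>2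
    assume f: "f \<in> hom C X E" and g: "g \<in> hom C Y E"
      and u1: "u\<^sub>1 \<in> hom C Z\<^sub>1 X" and v1: "v\<^sub>1 \<in> hom C Z\<^sub>1 Y" and c1: "\<gamma>\<^sub>1 \<in> cells (add_formal_cells C) (f \<cdot> u\<^sub>1) (g \<cdot> v\<^sub>1)"
      and u2: "u\<^sub>2 \<in> hom C Z\<^sub>2 X" and v2: "v\<^sub>2 \<in> hom C Z\<^sub>2 Y" and c2: "\<gamma>\<^sub>2 \<in> cells (add_formal_cells C) (f \<cdot> u\<^sub>2) (g \<cdot> v\<^sub>2)"
    obtain Z w1 w2 where w: "w1 \<in> hom C Z Z\<^sub>1" "w2 \<in> hom C Z Z\<^sub>2" using F0[OF homD(4)[OF u1] homD(4)[OF u2]] by blast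
    note a = Comp_in_hom[OF w(1) u1] Comp_in_hom[OF w(2) u2] and b = Comp_in_hom[OF w(1) v1] Comp_in_hom[OF w(2) v2]
    have g1: "\<gamma>\<^sub>1 = \<theta> (g \<cdot> v\<^sub>1) (f \<cdot> u\<^sub>1)" and g2: "\<gamma>\<^sub>2 = \<theta> (g \<cdot> v\<^sub>2) (f \<cdot> u\<^sub>2)"
      using c1 c2 by (auto simp: in_formal_cells)
    show "\<exists>Z \<in> Obj C. \<exists>w\<^sub>1 \<in> hom C Z Z\<^sub>1. \<exists>w\<^sub>2 \<in> hom C Z Z\<^sub>2.
        \<exists>\<alpha> \<in> cells (add_formal_cells C) (u\<^sub>1 \<cdot> w\<^sub>1) (u\<^sub>2 \<cdot> w\<^sub>2). \<exists>\<beta> \<in> cells (add_formal_cells C) (v\<^sub>1 \<cdot> w\<^sub>1) (v\<^sub>2 \<cdot> w\<^sub>2).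
          invertible_cell (add_formal_cells C) \<alpha> \<and> invertible_cell (add_formal_cells C) \<beta> \<and>
          \<theta> (theta_tgt (\<theta> (theta_tgt (\<theta> g g) \<cdot> theta_tgt \<beta>) (theta_src (\<theta> g g) \<cdot> theta_src \<beta>)))
            (theta_src (\<theta> (theta_tgt \<gamma>\<^sub>1 \<cdot> theta_tgt (\<theta> w\<^sub>1 w\<^sub>1)) (theta_src \<gamma>\<^sub>1 \<cdot> theta_src (\<theta> w\<^sub>1 w\<^sub>1)))) =
          \<theta> (theta_tgt (\<theta> (theta_tgt \<gamma>\<^sub>2 \<cdot> theta_tgt (\<theta> w\<^sub>2 w\<^sub>2)) (theta_src \<gamma>\<^sub>2 \<cdot> theta_src (\<theta> w\<^sub>2 w\<^sub>2))))
            (theta_src (\<theta> (theta_tgt (\<theta> f f) \<cdot> theta_tgt \<alpha>) (theta_src (\<theta> f f) \<cdot> theta_src \<alpha>)))"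
    proof (intro bexI conjI)
      show "Z \<in> Obj C" by (rule homD(4)[OF w(1)])
      show "w1 \<in> hom C Z Z\<^sub>1" "w2 \<in> hom C Z Z\<^sub>2" by (fact w)+
      show "\<theta> (u\<^sub>2 \<cdot> w2) (u\<^sub>1 \<cdot> w1) \<in> cells (add_formal_cells C) (u\<^sub>1 \<cdot> w1) (u\<^sub>2 \<cdot> w2)"
        "\<theta> (v\<^sub>2 \<cdot> w2) (v\<^sub>1 \<cdot> w1) \<in> cells (add_formal_cells C) (v\<^sub>1 \<cdot> w1) (v\<^sub>2 \<cdot> w2)"
        unfolding in_formal_cells using a b by blast+
    \<comment> \<open>Both sides of the required equation run from the composite of
      \<open>f\<close>, \<open>u\<^sub>1\<close>, \<open>w1\<close> to that of \<open>g\<close>,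
      \<open>v\<^sub>2\<close>, \<open>w2\<close>, bracketed differently; associativity identifies
      them.\<close>
    qed (use inv[OF a] inv[OF b] hom_assoc[OF w(1) u1 f] hom_assoc[OF w(2) v2 g] in \<open>simp_all add: g1 g2\<close>)
  qed
qed

text \<open>The equations hold by the way the cells are composed once the Galois objects form a
  category; the geometry enters in the last conjunct, through the existence and the domination of
  Galois objects.\<close>

theorem proposition1p4:
  fixes E :: "('o, 'a) category"
    and \<gamma> :: "('o, 'a, 'u set, 'u map) geometric_morphism"
  assumes "grothendieck_universe TYPE('u)"
    and "grothendieck_topos TYPE('u) E"
    and "geometric_morphism E Sets \<gamma>"
    and "connected_topos E \<gamma>"
    and "locally_connected_topos E \<gamma>"
  shows "let \<A> = full_subcategory E (galois_object E \<gamma>);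
             \<A>\<^sub>2 = add_formal_cells \<A>
         in two_category \<A>\<^sub>2
          \<and> category.truncate \<A>\<^sub>2 = \<A>
          \<and> (\<forall>A B. \<forall>u \<in> hom \<A> A B. \<forall>v \<in> hom \<A> A B. cells \<A>\<^sub>2 u v = {\<theta> v u})
          \<and> (\<forall>A B. \<forall>u \<in> hom \<A> A B. \<theta> u u = id_cell \<A>\<^sub>2 u)
          \<and> (\<forall>A B. \<forall>u \<in> hom \<A> A B. \<forall>v \<in> hom \<A> A B. \<forall>w \<in> hom \<A> A B.
                vcomp \<A>\<^sub>2 (\<theta> w v) (\<theta> v u) = \<theta> w u)
          \<and> (\<forall>A B. \<forall>u \<in> hom \<A> A B. \<forall>v \<in> hom \<A> A B. inverse_cells \<A>\<^sub>2 (\<theta> v u) (\<theta> u v))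
          \<and> (\<forall>A B C. \<forall>u \<in> hom \<A> A B. \<forall>v \<in> hom \<A> A B. \<forall>r \<in> hom \<A> B C. \<forall>s \<in> hom \<A> B C.
                hcomp \<A>\<^sub>2 (\<theta> s r) (\<theta> v u) = \<theta> (s \<cdot>\<^bsub>\<A>\<^esub> v) (r \<cdot>\<^bsub>\<A>\<^esub> u))
          \<and> inversely_2_filtered \<A>\<^sub>2"
proof -
  define \<A> where "\<A> = full_subcategory E (galois_object E \<gamma>)"
  have "category E" using assms(4) by (simp add: connected_topos_def fully_faithful_def cfunctor_def)
  then have cat: "category \<A>" unfolding \<A>_def by (rule category_full_subcategory)
  note cof = galois_objects_cofiltered[OF assms]
  have gObj: "A \<in> Obj E" if "galois_object E \<gamma> A" for A
    using that by (simp add: galois_object_def connected_object_def)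
  have fil: "inversely_2_filtered (add_formal_cells \<A>)"
  proof (rule formal_inversely_2_filtered[OF cat])
    show "Obj \<A> \<noteq> {}" using cof(1) gObj by (auto simp: \<A>_def full_subcategory_def)
    fix X Y assume "X \<in> Obj \<A>" "Y \<in> Obj \<A>"
    then have XY: "galois_object E \<gamma> X" "galois_object E \<gamma> Y" by (auto simp: \<A>_def full_subcategory_def)
    show "\<exists>Z u v. u \<in> hom \<A> Z X \<and> v \<in> hom \<A> Z Y"
      using cof(2)[OF XY] XY unfolding \<A>_def hom_full_subcategory by blast
  qed
  have cells: "cells (add_formal_cells \<A>) u v = {\<theta> v u}" if "u \<in> hom \<A> A B" "v \<in> hom \<A> A B" for u v A B
    using that by (intro set_eqI) (simp add: in_formal_cells, blast)
  have inv: "inverse_cells (add_formal_cells \<A>) (\<theta> v u) (\<theta> u v)" if "u \<in> hom \<A> A B" "v \<in> hom \<A> A B" for u v A B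
    using that by (simp add: inverse_cells_def in_formal_cells in_formal_Cell) blast
  \<comment> \<open>Dropping the fields for cells returns the full subcategory itself, so the
    objects and arrows are left as they were.\<close>
  have tr: "category.truncate (add_formal_cells \<A>) = \<A>"
    by (simp add: category.truncate_def add_formal_cells_def)
  show ?thesis
    unfolding Let_def \<A>_def[symmetric]
    using formal_two_category[OF cat] fil cells inv tr by auto
qed

end
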